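(* Let $\Bbbk$ be a commutative ring, let $A$ be an associative unital $\Bbbk$-algebra which is projective as a $\Bbbk$-module, and let $\delta:A\to A$ be a $\Bbbk$-linear derivation. If $M$ is a right $A$-module, $N$ is a left $A$-module, and $f:M\to M$ and $g:N\to N$ are $\delta$-operators, then there is a canonical morphism of graded $\Bbbk$-modules $$\nabla^{f,g}_\bullet:\operatorname{Tor}^A_\bullet(M,N)\to\operatorname{Tor}^A_\bullet(M,N)$$ such that for each projective resolution $\eta:Q_\bullet\to N$ of $N$ by left $A$-modules and each $\delta$-lifting $g_\bullet:Q_\bullet\to Q_\bullet$ of $g$ to $Q_\bullet$ the diagram $$\begin{array}{ccc} H(M\otimes_AQ_\bullet) & \xrightarrow{\ \nabla_\bullet^{f,g,Q_\bullet}\ } & H(M\otimes_AQ_\bullet)\\ \downarrow{\cong} & & \downarrow{\cong}\\ \operatorname{Tor}^A_\bullet(M,N) & \xrightarrow{\ \nabla^{f,g}_\bullet\ } & \operatorname{Tor}^A_\bullet(M,N)\end{array}$$ commutes, where the vertical arrows are the canonical isomorphisms and $\nabla_\bullet^{f,g,Q_\bullet}=H(f\boxtimes g_\bullet)$.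
   Context: Linear means $\Bbbk$-linear. A $\delta$-operator on a left $A$-module $N$ is a linear map $g:N\to N$ with $g(an)=\delta(a)n+ag(n)$ for all $a\in A$, $n\in N$; on a right $A$-module $M$ it is a linear map $f:M\to M$ with $f(ma)=f(m)a+m\delta(a)$ for all $a\in A$, $m\in M$. A $\delta$-lifting of $g:N\to N$ to a projective resolution $\eta:Q_\bullet\to N$ with differentials $d_i$ is a sequence $g_\bullet=(g_i)_{i\ge0}$ of $\delta$-operators $g_i:Q_i\to Q_i$ with $\eta g_0=g\eta$ and $d_ig_i=g_{i-1}d_i$ for all $i\ge1$. For $\delta$-operators $f$ on a right module $M$ and $g$ on a left module $N$, $f\boxtimes g:M\otimes_AN\to M\otimes_AN$ is the well-defined linear map with $(f\boxtimes g)(m\otimes n)=f(m)\otimes n+m\otimes g(n)$. The morphism of complexes $f\boxtimes g_\bullet:M\otimes_AQ_\bullet\to M\otimes_AQ_\bullet$ is $f\boxtimes g_i$ in degree $i$, and $H(f\boxtimes g_\bullet)$ is the map it induces on homology. *)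

theory Defs
  imports "HOL-Algebra.Module" "HOL-Algebra.AbelCoset" "HOL-Library.FSet"
begin

text \<open>
  Modules over a possibly noncommutative ring use the record \<open>module\<close> of HOL-Algebra; its fields
  \<open>mult\<close> and \<open>one\<close> play no role. A right module is encoded with the same record, the
  term \<open>a \<odot>\<^bsub>M\<^esub> m\<close> standing for $m a$.
\<close>

locale left_module = R?: ring R + M?: abelian_group M
    for R :: "('r, 'z) ring_scheme" (structure) and M :: "('r, 'x) module" (structure) +
  assumes smult_closed:
      "\<lbrakk>a \<in> carrier R; x \<in> carrier M\<rbrakk> \<Longrightarrow> a \<odot>\<^bsub>M\<^esub> x \<in> carrier M"
    and smult_l_distr:
      "\<lbrakk>a \<in> carrier R; b \<in> carrier R; x \<in> carrier M\<rbrakk> \<Longrightarrow>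
        (a \<oplus> b) \<odot>\<^bsub>M\<^esub> x = a \<odot>\<^bsub>M\<^esub> x \<oplus>\<^bsub>M\<^esub> b \<odot>\<^bsub>M\<^esub> x"
    and smult_r_distr:
      "\<lbrakk>a \<in> carrier R; x \<in> carrier M; y \<in> carrier M\<rbrakk> \<Longrightarrow>
        a \<odot>\<^bsub>M\<^esub> (x \<oplus>\<^bsub>M\<^esub> y) = a \<odot>\<^bsub>M\<^esub> x \<oplus>\<^bsub>M\<^esub> a \<odot>\<^bsub>M\<^esub> y"
    and smult_assoc:
      "\<lbrakk>a \<in> carrier R; b \<in> carrier R; x \<in> carrier M\<rbrakk> \<Longrightarrow>
        (a \<otimes> b) \<odot>\<^bsub>M\<^esub> x = a \<odot>\<^bsub>M\<^esub> (b \<odot>\<^bsub>M\<^esub> x)"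
    and smult_one:
      "x \<in> carrier M \<Longrightarrow> \<one> \<odot>\<^bsub>M\<^esub> x = x"

locale right_module = R?: ring R + M?: abelian_group M
    for R :: "('r, 'z) ring_scheme" (structure) and M :: "('r, 'x) module" (structure) +
  assumes smult_closed:
      "\<lbrakk>a \<in> carrier R; x \<in> carrier M\<rbrakk> \<Longrightarrow> a \<odot>\<^bsub>M\<^esub> x \<in> carrier M"
    and smult_l_distr:
      "\<lbrakk>a \<in> carrier R; b \<in> carrier R; x \<in> carrier M\<rbrakk> \<Longrightarrow>
        (a \<oplus> b) \<odot>\<^bsub>M\<^esub> x = a \<odot>\<^bsub>M\<^esub> x \<oplus>\<^bsub>M\<^esub> b \<odot>\<^bsub>M\<^esub> x"
    and smult_r_distr:
      "\<lbrakk>a \<in> carrier R; x \<in> carrier M; y \<in> carrier M\<rbrakk> \<Longrightarrow>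
        a \<odot>\<^bsub>M\<^esub> (x \<oplus>\<^bsub>M\<^esub> y) = a \<odot>\<^bsub>M\<^esub> x \<oplus>\<^bsub>M\<^esub> a \<odot>\<^bsub>M\<^esub> y"
    and smult_assoc:
      "\<lbrakk>a \<in> carrier R; b \<in> carrier R; x \<in> carrier M\<rbrakk> \<Longrightarrow>
        (a \<otimes> b) \<odot>\<^bsub>M\<^esub> x = b \<odot>\<^bsub>M\<^esub> (a \<odot>\<^bsub>M\<^esub> x)"
    and smult_one:
      "x \<in> carrier M \<Longrightarrow> \<one> \<odot>\<^bsub>M\<^esub> x = x"

lemma left_module_iff_module:
  assumes "cring K"
  shows "left_module K X \<longleftrightarrow> module K X"
proof
  assume "left_module K X"
  then interpret left_module K X .
  show "module K X"
    by (intro moduleI assms M.abelian_group_axioms smult_closed smult_l_distr smult_r_distr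
        smult_assoc smult_one)
next
  assume "module K X"
  then interpret module K X .
  show "left_module K X"
    by (intro left_module.intro left_module_axioms.intro R.ring_axioms M.abelian_group_axioms
        smult_closed smult_l_distr smult_r_distr smult_assoc1 smult_one)
qed

definition mod_hom ::
  "('r, 'z) ring_scheme \<Rightarrow> ('r, 'x) module \<Rightarrow> ('r, 'y) module \<Rightarrow> ('x \<Rightarrow> 'y) set" where
  "mod_hom R X Y =
    {h \<in> carrier X \<rightarrow> carrier Y.
      (\<forall>x\<in>carrier X. \<forall>y\<in>carrier X. h (x \<oplus>\<^bsub>X\<^esub> y) = h x \<oplus>\<^bsub>Y\<^esub> h y) \<and>
      (\<forall>r\<in>carrier R. \<forall>x\<in>carrier X. h (r \<odot>\<^bsub>X\<^esub> x) = r \<odot>\<^bsub>Y\<^esub> h x)}"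

definition mod_iso ::
  "('r, 'z) ring_scheme \<Rightarrow> ('r, 'x) module \<Rightarrow> ('r, 'y) module \<Rightarrow> ('x \<Rightarrow> 'y) set" where
  "mod_iso R X Y = {h \<in> mod_hom R X Y. bij_betw h (carrier X) (carrier Y)}"

text \<open>
  Projectivity is the lifting property. HOL does not quantify over types, so the test modules are
  confined to two types. This is no restriction: they include the free module on the carrier of
  \<open>P\<close> and \<open>P\<close> itself, and a splitting of the canonical surjection between these two gives the
  lifting property against all modules.
\<close>

definition projective_module :: "('r, 'z) ring_scheme \<Rightarrow> ('r, 'p) module \<Rightarrow> bool" where
  "projective_module R P \<longleftrightarrow>
    left_module R P \<and>
    (\<forall>(X :: ('r, 'p \<Rightarrow> 'r) module) (Y :: ('r, 'p) module).
      left_module R X \<and> left_module R Y \<longrightarrow>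
      (\<forall>e\<in>mod_hom R X Y. \<forall>h\<in>mod_hom R P Y. e ` carrier X = carrier Y \<longrightarrow>
        (\<exists>h'\<in>mod_hom R P X. \<forall>p\<in>carrier P. e (h' p) = h p)))"

locale k_algebra = module K A + A?: ring A
    for K :: "('k, 'z) ring_scheme" (structure) and A :: "('k, 'a) module" (structure) +
  assumes smult_mult_left:
      "\<lbrakk>r \<in> carrier K; a \<in> carrier A; b \<in> carrier A\<rbrakk> \<Longrightarrow>
        (r \<odot>\<^bsub>A\<^esub> a) \<otimes>\<^bsub>A\<^esub> b = r \<odot>\<^bsub>A\<^esub> (a \<otimes>\<^bsub>A\<^esub> b)"
    and smult_mult_right:
      "\<lbrakk>r \<in> carrier K; a \<in> carrier A; b \<in> carrier A\<rbrakk> \<Longrightarrow>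
        a \<otimes>\<^bsub>A\<^esub> (r \<odot>\<^bsub>A\<^esub> b) = r \<odot>\<^bsub>A\<^esub> (a \<otimes>\<^bsub>A\<^esub> b)"

text \<open>The \<open>K\<close>-module underlying a (left or right) module over a \<open>K\<close>-algebra.\<close>

definition restrict_scalars :: "('k, 'a) module \<Rightarrow> ('a, 'x) module \<Rightarrow> ('k, 'x) module" where
  "restrict_scalars A X =
    \<lparr>carrier = carrier X, mult = mult X, one = one X, zero = zero X, add = add X,
     smult = (\<lambda>r x. (r \<odot>\<^bsub>A\<^esub> \<one>\<^bsub>A\<^esub>) \<odot>\<^bsub>X\<^esub> x)\<rparr>"

definition derivation :: "('k, 'z) ring_scheme \<Rightarrow> ('k, 'a) module \<Rightarrow> ('a \<Rightarrow> 'a) \<Rightarrow> bool" where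
  "derivation K A \<delta> \<longleftrightarrow>
    \<delta> \<in> mod_hom K A A \<and>
    (\<forall>a\<in>carrier A. \<forall>b\<in>carrier A. \<delta> (a \<otimes>\<^bsub>A\<^esub> b) = \<delta> a \<otimes>\<^bsub>A\<^esub> b \<oplus>\<^bsub>A\<^esub> a \<otimes>\<^bsub>A\<^esub> \<delta> b)"

definition left_delta_operator ::
  "('k, 'z) ring_scheme \<Rightarrow> ('k, 'a) module \<Rightarrow> ('a \<Rightarrow> 'a) \<Rightarrow> ('a, 'n) module \<Rightarrow> ('n \<Rightarrow> 'n) \<Rightarrow> bool"
  where
  "left_delta_operator K A \<delta> N g \<longleftrightarrow>
    g \<in> mod_hom K (restrict_scalars A N) (restrict_scalars A N) \<and>
    (\<forall>a\<in>carrier A. \<forall>n\<in>carrier N. g (a \<odot>\<^bsub>N\<^esub> n) = \<delta> a \<odot>\<^bsub>N\<^esub> n \<oplus>\<^bsub>N\<^esub> a \<odot>\<^bsub>N\<^esub> g n)"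

definition right_delta_operator ::
  "('k, 'z) ring_scheme \<Rightarrow> ('k, 'a) module \<Rightarrow> ('a \<Rightarrow> 'a) \<Rightarrow> ('a, 'm) module \<Rightarrow> ('m \<Rightarrow> 'm) \<Rightarrow> bool"
  where
  "right_delta_operator K A \<delta> M f \<longleftrightarrow>
    f \<in> mod_hom K (restrict_scalars A M) (restrict_scalars A M) \<and>
    (\<forall>a\<in>carrier A. \<forall>m\<in>carrier M. f (a \<odot>\<^bsub>M\<^esub> m) = a \<odot>\<^bsub>M\<^esub> f m \<oplus>\<^bsub>M\<^esub> \<delta> a \<odot>\<^bsub>M\<^esub> m)"


section \<open>Free modules, quotients and tensor products\<close>

definition free_module :: "('r, 'z) ring_scheme \<Rightarrow> 's set \<Rightarrow> ('r, 's \<Rightarrow> 'r) module" where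
  "free_module R S =
    \<lparr>carrier = {p. finite {x. p x \<noteq> \<zero>\<^bsub>R\<^esub>} \<and> (\<forall>x. p x \<in> carrier R) \<and> (\<forall>x. x \<notin> S \<longrightarrow> p x = \<zero>\<^bsub>R\<^esub>)},
     mult = undefined, one = undefined,
     zero = (\<lambda>x. \<zero>\<^bsub>R\<^esub>), add = (\<lambda>p q x. p x \<oplus>\<^bsub>R\<^esub> q x), smult = (\<lambda>r p x. r \<otimes>\<^bsub>R\<^esub> p x)\<rparr>"

definition free_gen :: "('r, 'z) ring_scheme \<Rightarrow> 's \<Rightarrow> 's \<Rightarrow> 'r" where
  "free_gen R s = (\<lambda>x. if x = s then \<one>\<^bsub>R\<^esub> else \<zero>\<^bsub>R\<^esub>)"

definition quotient_module :: "('r, 'x) module \<Rightarrow> 'x set \<Rightarrow> ('r, 'x set) module" where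
  "quotient_module X U =
    \<lparr>carrier = a_rcosets\<^bsub>X\<^esub> U, mult = undefined, one = undefined,
     zero = U, add = (\<lambda>C D. C <+>\<^bsub>X\<^esub> D), smult = (\<lambda>r C. \<Union>x\<in>C. U +>\<^bsub>X\<^esub> (r \<odot>\<^bsub>X\<^esub> x))\<rparr>"

definition submodule_span :: "('r, 'z) ring_scheme \<Rightarrow> ('r, 'x) module \<Rightarrow> 'x set \<Rightarrow> 'x set" where
  "submodule_span R X B = \<Inter> {U. submodule U R X \<and> B \<subseteq> U}"

text \<open>
  As a \<open>K\<close>-module, $M \otimes_A N$ is the free \<open>K\<close>-module on the pairs $(m, n)$ modulo
  biadditivity, $ma \otimes n = m \otimes an$ and $r (m \otimes n) = (r m) \otimes n$.
\<close>

definition tensor_relators ::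
  "('k, 'z) ring_scheme \<Rightarrow> ('k, 'a) module \<Rightarrow> ('a, 'm) module \<Rightarrow> ('a, 'n) module \<Rightarrow>
    ('m \<times> 'n \<Rightarrow> 'k) set" where
  "tensor_relators K A M N =
    (let F = free_module K (carrier M \<times> carrier N); e = free_gen K in
      {e (m \<oplus>\<^bsub>M\<^esub> m', n) \<ominus>\<^bsub>F\<^esub> (e (m, n) \<oplus>\<^bsub>F\<^esub> e (m', n)) | m m' n.
        m \<in> carrier M \<and> m' \<in> carrier M \<and> n \<in> carrier N} \<union>
      {e (m, n \<oplus>\<^bsub>N\<^esub> n') \<ominus>\<^bsub>F\<^esub> (e (m, n) \<oplus>\<^bsub>F\<^esub> e (m, n')) | m n n'.
        m \<in> carrier M \<and> n \<in> carrier N \<and> n' \<in> carrier N} \<union>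
      {e (a \<odot>\<^bsub>M\<^esub> m, n) \<ominus>\<^bsub>F\<^esub> e (m, a \<odot>\<^bsub>N\<^esub> n) | a m n.
        a \<in> carrier A \<and> m \<in> carrier M \<and> n \<in> carrier N} \<union>
      {r \<odot>\<^bsub>F\<^esub> e (m, n) \<ominus>\<^bsub>F\<^esub> e ((r \<odot>\<^bsub>A\<^esub> \<one>\<^bsub>A\<^esub>) \<odot>\<^bsub>M\<^esub> m, n) | r m n.
        r \<in> carrier K \<and> m \<in> carrier M \<and> n \<in> carrier N})"

definition tensor_kernel ::
  "('k, 'z) ring_scheme \<Rightarrow> ('k, 'a) module \<Rightarrow> ('a, 'm) module \<Rightarrow> ('a, 'n) module \<Rightarrow>
    ('m \<times> 'n \<Rightarrow> 'k) set" where
  "tensor_kernel K A M N =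
    submodule_span K (free_module K (carrier M \<times> carrier N)) (tensor_relators K A M N)"

definition tensor ::
  "('k, 'z) ring_scheme \<Rightarrow> ('k, 'a) module \<Rightarrow> ('a, 'm) module \<Rightarrow> ('a, 'n) module \<Rightarrow>
    ('k, ('m \<times> 'n \<Rightarrow> 'k) set) module" where
  "tensor K A M N =
    quotient_module (free_module K (carrier M \<times> carrier N)) (tensor_kernel K A M N)"

definition pure_tensor ::
  "('k, 'z) ring_scheme \<Rightarrow> ('k, 'a) module \<Rightarrow> ('a, 'm) module \<Rightarrow> ('a, 'n) module \<Rightarrow>
    'm \<Rightarrow> 'n \<Rightarrow> ('m \<times> 'n \<Rightarrow> 'k) set" where
  "pure_tensor K A M N m n =
    tensor_kernel K A M N +>\<^bsub>free_module K (carrier M \<times> carrier N)\<^esub> free_gen K (m, n)"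

text \<open>The linear map out of $M \otimes_A N$ sending $m \otimes n$ to \<open>\<beta> m n\<close>.\<close>

definition tensor_lift ::
  "('k, 'z) ring_scheme \<Rightarrow> ('k, 'a) module \<Rightarrow> ('a, 'm) module \<Rightarrow> ('a, 'n) module \<Rightarrow>
    ('k, 'y) module \<Rightarrow> ('m \<Rightarrow> 'n \<Rightarrow> 'y) \<Rightarrow> ('m \<times> 'n \<Rightarrow> 'k) set \<Rightarrow> 'y" where
  "tensor_lift K A M N Y \<beta> =
    (THE h. h \<in> mod_hom K (tensor K A M N) Y \<inter> extensional (carrier (tensor K A M N)) \<and>
      (\<forall>m\<in>carrier M. \<forall>n\<in>carrier N. h (pure_tensor K A M N m n) = \<beta> m n))"

text \<open>$\mathrm{id}_M \otimes h$ for an \<open>A\<close>-linear map \<open>h\<close> from \<open>X\<close> to \<open>Y\<close>.\<close>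

definition tensor_map ::
  "('k, 'z) ring_scheme \<Rightarrow> ('k, 'a) module \<Rightarrow> ('a, 'm) module \<Rightarrow> ('a, 'x) module \<Rightarrow>
    ('a, 'y) module \<Rightarrow> ('x \<Rightarrow> 'y) \<Rightarrow> ('m \<times> 'x \<Rightarrow> 'k) set \<Rightarrow> ('m \<times> 'y \<Rightarrow> 'k) set" where
  "tensor_map K A M X Y h =
    tensor_lift K A M X (tensor K A M Y) (\<lambda>m x. pure_tensor K A M Y m (h x))"

definition boxtimes ::
  "('k, 'z) ring_scheme \<Rightarrow> ('k, 'a) module \<Rightarrow> ('a, 'm) module \<Rightarrow> ('a, 'n) module \<Rightarrow>
    ('m \<Rightarrow> 'm) \<Rightarrow> ('n \<Rightarrow> 'n) \<Rightarrow> ('m \<times> 'n \<Rightarrow> 'k) set \<Rightarrow> ('m \<times> 'n \<Rightarrow> 'k) set" where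
  "boxtimes K A M N f g =
    tensor_lift K A M N (tensor K A M N)
      (\<lambda>m n. pure_tensor K A M N (f m) n \<oplus>\<^bsub>tensor K A M N\<^esub> pure_tensor K A M N m (g n))"


section \<open>Complexes and homology\<close>

text \<open>
  A nonnegatively graded complex is a family of modules \<open>C i\<close> with maps \<open>d i\<close> from \<open>C i\<close> to
  \<open>C (i - 1)\<close> for \<open>i \<ge> 1\<close>; the map \<open>d 0\<close> is never used.
\<close>

definition cycles :: "(nat \<Rightarrow> ('k, 'c) module) \<Rightarrow> (nat \<Rightarrow> 'c \<Rightarrow> 'c) \<Rightarrow> nat \<Rightarrow> 'c set" where
  "cycles C d n =
    (if n = 0 then carrier (C 0) else {x \<in> carrier (C n). d n x = \<zero>\<^bsub>C (n - 1)\<^esub>})"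

definition boundaries :: "(nat \<Rightarrow> ('k, 'c) module) \<Rightarrow> (nat \<Rightarrow> 'c \<Rightarrow> 'c) \<Rightarrow> nat \<Rightarrow> 'c set" where
  "boundaries C d n = d (Suc n) ` carrier (C (Suc n))"

definition homology ::
  "(nat \<Rightarrow> ('k, 'c) module) \<Rightarrow> (nat \<Rightarrow> 'c \<Rightarrow> 'c) \<Rightarrow> nat \<Rightarrow> ('k, 'c set) module" where
  "homology C d n = quotient_module ((C n)\<lparr>carrier := cycles C d n\<rparr>) (boundaries C d n)"

text \<open>The map on homology induced by a chain map \<open>\<phi>\<close>, where \<open>(C', d')\<close> is the target complex.\<close>

definition homology_map ::
  "(nat \<Rightarrow> ('k, 'e) module) \<Rightarrow> (nat \<Rightarrow> 'e \<Rightarrow> 'e) \<Rightarrow> (nat \<Rightarrow> 'c \<Rightarrow> 'e) \<Rightarrow> nat \<Rightarrow>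
    'c set \<Rightarrow> 'e set" where
  "homology_map C' d' \<phi> n Z = (\<Union>z\<in>Z. boundaries C' d' n +>\<^bsub>C' n\<^esub> \<phi> n z)"

definition tensor_complex ::
  "('k, 'z) ring_scheme \<Rightarrow> ('k, 'a) module \<Rightarrow> ('a, 'm) module \<Rightarrow> (nat \<Rightarrow> ('a, 'q) module) \<Rightarrow>
    nat \<Rightarrow> ('k, ('m \<times> 'q \<Rightarrow> 'k) set) module" where
  "tensor_complex K A M Q i = tensor K A M (Q i)"

definition tensor_diff ::
  "('k, 'z) ring_scheme \<Rightarrow> ('k, 'a) module \<Rightarrow> ('a, 'm) module \<Rightarrow> (nat \<Rightarrow> ('a, 'q) module) \<Rightarrow>
    (nat \<Rightarrow> 'q \<Rightarrow> 'q) \<Rightarrow> nat \<Rightarrow> ('m \<times> 'q \<Rightarrow> 'k) set \<Rightarrow> ('m \<times> 'q \<Rightarrow> 'k) set" where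
  "tensor_diff K A M Q d i = tensor_map K A M (Q i) (Q (i - 1)) (d i)"

definition tensor_homology ::
  "('k, 'z) ring_scheme \<Rightarrow> ('k, 'a) module \<Rightarrow> ('a, 'm) module \<Rightarrow> (nat \<Rightarrow> ('a, 'q) module) \<Rightarrow>
    (nat \<Rightarrow> 'q \<Rightarrow> 'q) \<Rightarrow> nat \<Rightarrow> ('k, ('m \<times> 'q \<Rightarrow> 'k) set set) module" where
  "tensor_homology K A M Q d = homology (tensor_complex K A M Q) (tensor_diff K A M Q d)"


section \<open>Projective resolutions and the functor Tor\<close>

definition projective_resolution ::
  "('a, 'z) ring_scheme \<Rightarrow> ('a, 'n) module \<Rightarrow> (nat \<Rightarrow> ('a, 'q) module) \<Rightarrow>
    (nat \<Rightarrow> 'q \<Rightarrow> 'q) \<Rightarrow> ('q \<Rightarrow> 'n) \<Rightarrow> bool" where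
  "projective_resolution A N Q d \<eta> \<longleftrightarrow>
    (\<forall>i. projective_module A (Q i)) \<and>
    (\<forall>i. d (Suc i) \<in> mod_hom A (Q (Suc i)) (Q i)) \<and>
    \<eta> \<in> mod_hom A (Q 0) N \<and>
    \<eta> ` carrier (Q 0) = carrier N \<and>
    d 1 ` carrier (Q 1) = {q \<in> carrier (Q 0). \<eta> q = \<zero>\<^bsub>N\<^esub>} \<and>
    (\<forall>i. d (Suc (Suc i)) ` carrier (Q (Suc (Suc i))) =
      {q \<in> carrier (Q (Suc i)). d (Suc i) q = \<zero>\<^bsub>Q i\<^esub>})"

definition delta_lifting ::
  "('k, 'z) ring_scheme \<Rightarrow> ('k, 'a) module \<Rightarrow> ('a \<Rightarrow> 'a) \<Rightarrow> ('n \<Rightarrow> 'n) \<Rightarrow>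
    (nat \<Rightarrow> ('a, 'q) module) \<Rightarrow> (nat \<Rightarrow> 'q \<Rightarrow> 'q) \<Rightarrow> ('q \<Rightarrow> 'n) \<Rightarrow> (nat \<Rightarrow> 'q \<Rightarrow> 'q) \<Rightarrow> bool"
  where
  "delta_lifting K A \<delta> g Q d \<eta> gs \<longleftrightarrow>
    (\<forall>i. left_delta_operator K A \<delta> (Q i) (gs i)) \<and>
    (\<forall>q\<in>carrier (Q 0). \<eta> (gs 0 q) = g (\<eta> q)) \<and>
    (\<forall>i\<ge>1. \<forall>q\<in>carrier (Q i). d i (gs i q) = gs (i - 1) (d i q))"

definition comparison_map ::
  "('a, 'z) ring_scheme \<Rightarrow> (nat \<Rightarrow> ('a, 'q) module) \<Rightarrow> (nat \<Rightarrow> 'q \<Rightarrow> 'q) \<Rightarrow> ('q \<Rightarrow> 'n) \<Rightarrow>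
    (nat \<Rightarrow> ('a, 'p) module) \<Rightarrow> (nat \<Rightarrow> 'p \<Rightarrow> 'p) \<Rightarrow> ('p \<Rightarrow> 'n) \<Rightarrow> (nat \<Rightarrow> 'q \<Rightarrow> 'p) \<Rightarrow> bool"
  where
  "comparison_map A Q d \<eta> P d' \<eta>' \<phi> \<longleftrightarrow>
    (\<forall>i. \<phi> i \<in> mod_hom A (Q i) (P i)) \<and>
    (\<forall>q\<in>carrier (Q 0). \<eta>' (\<phi> 0 q) = \<eta> q) \<and>
    (\<forall>i\<ge>1. \<forall>q\<in>carrier (Q i). d' i (\<phi> i q) = \<phi> (i - 1) (d i q))"

text \<open>
  Tor is the homology of $M \otimes_A F_\bullet$ for the standard free resolution $F_\bullet$ of
  \<open>N\<close>: the module $F_0$ is free on the set \<open>N\<close>, and $F_{i+1}$ is free on the kernel of the map out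
  of $F_i$. Finitely supported functions on $F_i$ would live in a new type for each \<open>i\<close>; the
  following datatype holds all the $F_i$ at once, a function being stored as its finite graph
  outside the zeros.
\<close>

datatype ('a, 'n) syz = Gen 'n | Comb "(('a, 'n) syz \<times> 'a) fset"

definition encode_syz ::
  "('a, 'z) ring_scheme \<Rightarrow> (('a, 'n) syz \<Rightarrow> 'a) \<Rightarrow> ('a, 'n) syz" where
  "encode_syz A p = Comb (Abs_fset {(x, p x) | x. p x \<noteq> \<zero>\<^bsub>A\<^esub>})"

text \<open>Transport of a module structure along a map that is injective on the carrier.\<close>

definition transport_module :: "('x \<Rightarrow> 'y) \<Rightarrow> ('r, 'x) module \<Rightarrow> ('r, 'y) module" where
  "transport_module h X =
    (let h' = inv_into (carrier X) h in
      \<lparr>carrier = h ` carrier X, mult = undefined, one = undefined, zero = h \<zero>\<^bsub>X\<^esub>,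
       add = (\<lambda>u v. h (h' u \<oplus>\<^bsub>X\<^esub> h' v)), smult = (\<lambda>r u. h (r \<odot>\<^bsub>X\<^esub> h' u))\<rparr>)"

definition syz_free ::
  "('a, 'z) ring_scheme \<Rightarrow> ('a, 'n) syz set \<Rightarrow> ('a, ('a, 'n) syz) module" where
  "syz_free A S = transport_module (encode_syz A) (free_module A S)"

text \<open>The \<open>A\<close>-linear map from the free module on a subset \<open>S\<close> of \<open>X\<close> to \<open>X\<close> fixing each \<open>s \<in> S\<close>.\<close>

definition syz_eval ::
  "('a, 'z) ring_scheme \<Rightarrow> ('a, ('a, 'n) syz) module \<Rightarrow> ('a, 'n) syz set \<Rightarrow>
    ('a, 'n) syz \<Rightarrow> ('a, 'n) syz" where
  "syz_eval A X S u =
    (let p = inv_into (carrier (free_module A S)) (encode_syz A) u in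
      (\<Oplus>\<^bsub>X\<^esub>x\<in>{x. p x \<noteq> \<zero>\<^bsub>A\<^esub>}. p x \<odot>\<^bsub>X\<^esub> x))"

text \<open>
  Stage 0 is a copy of \<open>N\<close> with all its elements; stage \<open>n + 1\<close> is $F_n$ with the kernel of its map
  to the module of stage \<open>n\<close>.
\<close>

primrec standard_stage ::
  "('a, 'z) ring_scheme \<Rightarrow> ('a, 'n) module \<Rightarrow> nat \<Rightarrow>
    ('a, ('a, 'n) syz) module \<times> ('a, 'n) syz set" where
  "standard_stage A N 0 = (transport_module Gen N, Gen ` carrier N)"
| "standard_stage A N (Suc n) =
    (case standard_stage A N n of (X, S) \<Rightarrow>
      (syz_free A S, {u \<in> carrier (syz_free A S). syz_eval A X S u = \<zero>\<^bsub>X\<^esub>}))"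

definition standard_res ::
  "('a, 'z) ring_scheme \<Rightarrow> ('a, 'n) module \<Rightarrow> nat \<Rightarrow> ('a, ('a, 'n) syz) module" where
  "standard_res A N i = fst (standard_stage A N (Suc i))"

definition standard_diff ::
  "('a, 'z) ring_scheme \<Rightarrow> ('a, 'n) module \<Rightarrow> nat \<Rightarrow> ('a, 'n) syz \<Rightarrow> ('a, 'n) syz" where
  "standard_diff A N i = (case standard_stage A N i of (X, S) \<Rightarrow> syz_eval A X S)"

definition standard_aug ::
  "('a, 'z) ring_scheme \<Rightarrow> ('a, 'n) module \<Rightarrow> ('a, 'n) syz \<Rightarrow> 'n" where
  "standard_aug A N u = inv_into UNIV Gen (standard_diff A N 0 u)"

definition Tor ::
  "('k, 'z) ring_scheme \<Rightarrow> ('k, 'a) module \<Rightarrow> ('a, 'm) module \<Rightarrow> ('a, 'n) module \<Rightarrow> nat \<Rightarrow>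
    ('k, ('m \<times> ('a, 'n) syz \<Rightarrow> 'k) set set) module" where
  "Tor K A M N = tensor_homology K A M (standard_res A N) (standard_diff A N)"

text \<open>
  The canonical map from $H_n(M \otimes_A Q_\bullet)$ to Tor is induced by a comparison map over the
  identity of \<open>N\<close>. By the comparison theorem one exists, and the choice does not matter since any
  two are homotopic.
\<close>

definition tor_iso ::
  "('k, 'z) ring_scheme \<Rightarrow> ('k, 'a) module \<Rightarrow> ('a, 'm) module \<Rightarrow> ('a, 'n) module \<Rightarrow>
    (nat \<Rightarrow> ('a, 'q) module) \<Rightarrow> (nat \<Rightarrow> 'q \<Rightarrow> 'q) \<Rightarrow> ('q \<Rightarrow> 'n) \<Rightarrow> nat \<Rightarrow>
    ('m \<times> 'q \<Rightarrow> 'k) set set \<Rightarrow> ('m \<times> ('a, 'n) syz \<Rightarrow> 'k) set set" where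
  "tor_iso K A M N Q d \<eta> =
    (let F = standard_res A N;
         \<phi> = (SOME \<phi>. comparison_map A Q d \<eta> F (standard_diff A N) (standard_aug A N) \<phi>)
     in homology_map (tensor_complex K A M F) (tensor_diff K A M F (standard_diff A N))
          (\<lambda>i. tensor_map K A M (Q i) (F i) (\<phi> i)))"


section \<open>The induced maps on Tor\<close>

text \<open>$H(f \boxtimes g_\bullet)$ for a lifting $g_\bullet$ of $g$ to the resolution \<open>Q\<close>.\<close>

definition nabla_res ::
  "('k, 'z) ring_scheme \<Rightarrow> ('k, 'a) module \<Rightarrow> ('a, 'm) module \<Rightarrow> ('m \<Rightarrow> 'm) \<Rightarrow>
    (nat \<Rightarrow> ('a, 'q) module) \<Rightarrow> (nat \<Rightarrow> 'q \<Rightarrow> 'q) \<Rightarrow> (nat \<Rightarrow> 'q \<Rightarrow> 'q) \<Rightarrow> nat \<Rightarrow>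
    ('m \<times> 'q \<Rightarrow> 'k) set set \<Rightarrow> ('m \<times> 'q \<Rightarrow> 'k) set set" where
  "nabla_res K A M f Q d gs =
    homology_map (tensor_complex K A M Q) (tensor_diff K A M Q d)
      (\<lambda>i. boxtimes K A M (Q i) f (gs i))"

definition graded_tor_endo ::
  "('k, 'z) ring_scheme \<Rightarrow> ('k, 'a) module \<Rightarrow> ('a, 'm) module \<Rightarrow> ('a, 'n) module \<Rightarrow>
    (nat \<Rightarrow> ('m \<times> ('a, 'n) syz \<Rightarrow> 'k) set set \<Rightarrow> ('m \<times> ('a, 'n) syz \<Rightarrow> 'k) set set) \<Rightarrow> bool"
  where
  "graded_tor_endo K A M N D \<longleftrightarrow> (\<forall>n. D n \<in> mod_hom K (Tor K A M N n) (Tor K A M N n))"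

text \<open>
  The square relating \<open>D\<close> to $H(f \boxtimes g_\bullet)$ commutes for every projective resolution with
  elements of type \<open>'q\<close> and every lifting $g_\bullet$ of \<open>g\<close> to it.
\<close>

definition squares_commute ::
  "'q itself \<Rightarrow> ('k, 'z) ring_scheme \<Rightarrow> ('k, 'a) module \<Rightarrow> ('a \<Rightarrow> 'a) \<Rightarrow> ('a, 'm) module \<Rightarrow>
    ('a, 'n) module \<Rightarrow> ('m \<Rightarrow> 'm) \<Rightarrow> ('n \<Rightarrow> 'n) \<Rightarrow>
    (nat \<Rightarrow> ('m \<times> ('a, 'n) syz \<Rightarrow> 'k) set set \<Rightarrow> ('m \<times> ('a, 'n) syz \<Rightarrow> 'k) set set) \<Rightarrow> bool"
  where
  "squares_commute (_ :: 'q itself) K A \<delta> M N f g D \<longleftrightarrow>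
    (\<forall>(Q :: nat \<Rightarrow> ('a, 'q) module) d \<eta> gs.
      projective_resolution A N Q d \<eta> \<and> delta_lifting K A \<delta> g Q d \<eta> gs \<longrightarrow>
      (\<forall>n. \<forall>z\<in>carrier (tensor_homology K A M Q d n).
        tor_iso K A M N Q d \<eta> n (nabla_res K A M f Q d gs n z) =
        D n (tor_iso K A M N Q d \<eta> n z)))"

end

(*
  A comparison map phi between resolutions Q and P of N need not commute with delta-liftings g and g'
  of the same operator, but phi g - g' phi is A-linear: the two terms delta(a) phi(q) cancel. It is
  thus an A-linear chain map which is zero on N, hence null-homotopic, and after tensoring with M it
  becomes the difference of phi (f box g) and (f box g') phi, so these agree on homology. On the
  standard resolution a delta-lifting exists, since a delta-operator on a free module can be
  prescribed arbitrarily on the generators; its H(f box g) is the required map on Tor, and it is the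
  only one because the comparison isomorphism of the standard resolution with itself is onto.
*)
theory Submission
  imports Defs
begin

section \<open>Linear maps\<close>

text \<open>The operators \<open>f\<close> and \<open>g\<close> are not linear over
  \<open>A\<close>, so in general neither \<open>f \<otimes> id\<close> nor
  \<open>id \<otimes> g\<close> makes sense on the tensor product; only their sum does. For the same
  reason projectivity, a property of linear maps, cannot be applied directly to lift
  \<open>g\<close> or to build a homotopy between two delta-liftings. Every homotopy is therefore
  built for a linear chain map, and a lifting has to be produced just once, on a resolution that is
  free by construction. In that resolution the basis of F_{i+1} is the whole kernel in degree i, not
  merely a generating set of it. An operator that commutes with the evaluation maps preserves this
  kernel and so acts on the basis: the lift sends the basis element of \<open>s\<close> to the basis
  element of the image of \<open>s\<close> and applies \<open>\<delta>\<close> to coefficients. No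
  preimages have to be chosen, and the recursion carries itself, because the lifted operator again
  preserves the next kernel.\<close>

lemma (in abelian_group) add_diff_add:
  "\<lbrakk>a \<in> carrier G; b \<in> carrier G; c \<in> carrier G; d \<in> carrier G\<rbrakk> \<Longrightarrow>
    (a \<oplus> b) \<ominus> (c \<oplus> d) = (a \<ominus> c) \<oplus> (b \<ominus> d)"
  by (simp add: minus_eq minus_add a_ac)

lemma (in abelian_group) add_diff_cancel:
  "\<lbrakk>a \<in> carrier G; b \<in> carrier G\<rbrakk> \<Longrightarrow> b \<oplus> (a \<ominus> b) = a"
  by (metis a_inv_closed a_lcomm a_minus_def r_neg r_zero)

lemma (in abelian_group) diff_eq_zero_iff:
  "\<lbrakk>a \<in> carrier G; b \<in> carrier G\<rbrakk> \<Longrightarrow> a \<ominus> b = \<zero> \<longleftrightarrow> a = b"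
  by (metis add_diff_cancel a_minus_def r_neg r_zero)

context left_module
begin

lemma smult_l_null: "x \<in> carrier M \<Longrightarrow> \<zero> \<odot>\<^bsub>M\<^esub> x = \<zero>\<^bsub>M\<^esub>"
  by (metis M.add.r_cancel_one' R.r_zero R.zero_closed smult_closed smult_l_distr)

lemma smult_r_null: "a \<in> carrier R \<Longrightarrow> a \<odot>\<^bsub>M\<^esub> \<zero>\<^bsub>M\<^esub> = \<zero>\<^bsub>M\<^esub>"
  by (metis M.add.r_cancel_one' M.r_zero M.zero_closed smult_closed smult_r_distr)

lemma smult_r_minus:
  assumes "a \<in> carrier R" "x \<in> carrier M"
  shows "a \<odot>\<^bsub>M\<^esub> (\<ominus>\<^bsub>M\<^esub> x) = \<ominus>\<^bsub>M\<^esub> (a \<odot>\<^bsub>M\<^esub> x)"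
  by (metis M.a_inv_closed M.l_neg M.minus_equality assms smult_closed smult_r_distr smult_r_null)

lemma smult_l_minus:
  assumes "a \<in> carrier R" "x \<in> carrier M"
  shows "(\<ominus> a) \<odot>\<^bsub>M\<^esub> x = \<ominus>\<^bsub>M\<^esub> (a \<odot>\<^bsub>M\<^esub> x)"
  by (metis M.minus_equality R.a_inv_closed R.l_neg assms smult_closed smult_l_distr smult_l_null)

lemma smult_r_diff:
  assumes "a \<in> carrier R" "x \<in> carrier M" "y \<in> carrier M"
  shows "a \<odot>\<^bsub>M\<^esub> (x \<ominus>\<^bsub>M\<^esub> y) = a \<odot>\<^bsub>M\<^esub> x \<ominus>\<^bsub>M\<^esub> a \<odot>\<^bsub>M\<^esub> y"
  using assms by (simp add: M.minus_eq smult_r_distr smult_r_minus)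

text \<open>Closure under negation is not asked for: it follows from closure under the scalar
  -1.\<close>

lemma submoduleI:
  assumes "H \<subseteq> carrier M" "\<zero>\<^bsub>M\<^esub> \<in> H" "\<And>x y. \<lbrakk>x \<in> H; y \<in> H\<rbrakk> \<Longrightarrow> x \<oplus>\<^bsub>M\<^esub> y \<in> H"
    and smult: "\<And>a x. \<lbrakk>a \<in> carrier R; x \<in> H\<rbrakk> \<Longrightarrow> a \<odot>\<^bsub>M\<^esub> x \<in> H"
  shows "submodule H R M"
proof -
  have "\<ominus>\<^bsub>M\<^esub> x \<in> H" if "x \<in> H" for x
    using smult[of "\<ominus> \<one>" x] that assms(1) smult_l_minus[of \<one> x] smult_one[of x] by auto
  then show ?thesis
    using assms unfolding submodule_def submodule_axioms_def
    by (auto intro!: subgroup.intro simp: a_inv_def)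
qed

text \<open>Homology is a quotient of \<open>C n\<close> with its carrier cut down to the cycles.
  This turns that smaller record into a left module, so that the theory of quotients applies to
  it.\<close>

lemma submodule_is_left_module:
  assumes "submodule H R M"
  shows "left_module R (M\<lparr>carrier := H\<rparr>)"
proof -
  interpret H: submodule H R M by fact
  have sub: "H \<subseteq> carrier M"
    using H.subset by simp
  have "abelian_group (M\<lparr>carrier := H\<rparr>)"
  proof (intro abelian_group.intro abelian_group_axioms.intro)
    show am: "abelian_monoid (M\<lparr>carrier := H\<rparr>)"
      using comm_monoid.submonoid_is_comm_monoid[OF M.a_comm_monoid H.subgroup_is_submonoid]
      by (simp add: abelian_monoid_def)
    show "comm_group (add_monoid (M\<lparr>carrier := H\<rparr>))"
      using H.subgroup_is_group[OF M.a_group] abelian_monoid.a_comm_monoid[OF am]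
      by (simp add: comm_group_def)
  qed
  moreover have "left_module_axioms R (M\<lparr>carrier := H\<rparr>)"
    using sub by (auto intro!: left_module_axioms.intro
        simp: smult_l_distr smult_r_distr smult_assoc smult_one subset_iff)
  ultimately show ?thesis
    by (intro left_module.intro R.ring_axioms)
qed

end

lemma submodule_zero: "submodule H R M \<Longrightarrow> \<zero>\<^bsub>M\<^esub> \<in> H"
  using subgroup.one_closed[OF submodule.axioms(1)] by force

lemma submodule_add: "\<lbrakk>submodule H R M; x \<in> H; y \<in> H\<rbrakk> \<Longrightarrow> x \<oplus>\<^bsub>M\<^esub> y \<in> H"
  using subgroup.m_closed[OF submodule.axioms(1)] by force

lemma submodule_sub: "submodule H R M \<Longrightarrow> H \<subseteq> carrier M"
  using subgroup.subset[OF submodule.axioms(1)] by force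

lemma submodule_smult: "\<lbrakk>submodule H R M; a \<in> carrier R; x \<in> H\<rbrakk> \<Longrightarrow> a \<odot>\<^bsub>M\<^esub> x \<in> H"
  using submodule.smult_closed by metis

lemma mod_homI:
  assumes "\<And>x. x \<in> carrier X \<Longrightarrow> h x \<in> carrier Y"
    and "\<And>x y. \<lbrakk>x \<in> carrier X; y \<in> carrier X\<rbrakk> \<Longrightarrow> h (x \<oplus>\<^bsub>X\<^esub> y) = h x \<oplus>\<^bsub>Y\<^esub> h y"
    and "\<And>r x. \<lbrakk>r \<in> carrier R; x \<in> carrier X\<rbrakk> \<Longrightarrow> h (r \<odot>\<^bsub>X\<^esub> x) = r \<odot>\<^bsub>Y\<^esub> h x"
  shows "h \<in> mod_hom R X Y"
  using assms by (auto simp: mod_hom_def)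

lemma mod_hom_closed: "\<lbrakk>h \<in> mod_hom R X Y; x \<in> carrier X\<rbrakk> \<Longrightarrow> h x \<in> carrier Y"
  by (auto simp: mod_hom_def)

lemma mod_hom_add:
  "\<lbrakk>h \<in> mod_hom R X Y; x \<in> carrier X; y \<in> carrier X\<rbrakk> \<Longrightarrow> h (x \<oplus>\<^bsub>X\<^esub> y) = h x \<oplus>\<^bsub>Y\<^esub> h y"
  by (auto simp: mod_hom_def)

lemma mod_hom_smult:
  "\<lbrakk>h \<in> mod_hom R X Y; r \<in> carrier R; x \<in> carrier X\<rbrakk> \<Longrightarrow> h (r \<odot>\<^bsub>X\<^esub> x) = r \<odot>\<^bsub>Y\<^esub> h x"
  by (auto simp: mod_hom_def)

lemma mod_hom_comp:
  "\<lbrakk>h \<in> mod_hom R X Y; k \<in> mod_hom R Y Z\<rbrakk> \<Longrightarrow> (\<lambda>x. k (h x)) \<in> mod_hom R X Z"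
  by (intro mod_homI) (simp_all add: mod_hom_closed mod_hom_add mod_hom_smult)

lemma mod_hom_id: "(\<lambda>x. x) \<in> mod_hom R X X"
  by (auto simp: mod_hom_def)

lemma mod_hom_cong:
  assumes X: "left_module R X" and h: "h \<in> mod_hom R X Y" and eq: "\<And>x. x \<in> carrier X \<Longrightarrow> h x = k x"
  shows "k \<in> mod_hom R X Y"
proof -
  interpret X: left_module R X by fact
  show ?thesis
    using mod_hom_closed[OF h] mod_hom_add[OF h] mod_hom_smult[OF h]
    by (intro mod_homI) (simp_all add: X.smult_closed flip: eq)
qed

lemma mod_hom_zero:
  assumes "left_module R X" "left_module R Y" "h \<in> mod_hom R X Y"
  shows "h \<zero>\<^bsub>X\<^esub> = \<zero>\<^bsub>Y\<^esub>"
proof -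
  interpret X: left_module R X by fact
  interpret Y: left_module R Y by fact
  have "h \<zero>\<^bsub>X\<^esub> \<oplus>\<^bsub>Y\<^esub> h \<zero>\<^bsub>X\<^esub> = h \<zero>\<^bsub>X\<^esub>"
    using mod_hom_add[OF assms(3), of "\<zero>\<^bsub>X\<^esub>" "\<zero>\<^bsub>X\<^esub>"] by simp
  then show ?thesis
    using mod_hom_closed[OF assms(3) X.M.zero_closed] by simp
qed

lemma mod_hom_neg:
  assumes "left_module R X" "left_module R Y" "h \<in> mod_hom R X Y" "x \<in> carrier X"
  shows "h (\<ominus>\<^bsub>X\<^esub> x) = \<ominus>\<^bsub>Y\<^esub> h x"
proof -
  interpret X: left_module R X by fact
  interpret Y: left_module R Y by fact
  have "h (\<ominus>\<^bsub>X\<^esub> x) \<oplus>\<^bsub>Y\<^esub> h x = \<zero>\<^bsub>Y\<^esub>"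
    using mod_hom_add[OF assms(3), of "\<ominus>\<^bsub>X\<^esub> x" x] mod_hom_zero[OF assms(1-3)] assms(4)
    by (simp add: X.M.l_neg)
  then show ?thesis
    using mod_hom_closed[OF assms(3)] assms(4) by (simp add: Y.M.minus_equality)
qed

lemma mod_hom_minus:
  assumes "left_module R X" "left_module R Y" "h \<in> mod_hom R X Y" "x \<in> carrier X" "y \<in> carrier X"
  shows "h (x \<ominus>\<^bsub>X\<^esub> y) = h x \<ominus>\<^bsub>Y\<^esub> h y"
proof -
  interpret X: left_module R X by fact
  show ?thesis
    using assms by (simp add: a_minus_def mod_hom_add mod_hom_neg)
qed

lemma mod_hom_diff:
  assumes "left_module R Y" "h \<in> mod_hom R X Y" "k \<in> mod_hom R X Y"
  shows "(\<lambda>x. h x \<ominus>\<^bsub>Y\<^esub> k x) \<in> mod_hom R X Y"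
proof -
  interpret Y: left_module R Y by fact
  show ?thesis
    using assms(2,3)
    by (intro mod_homI)
      (auto simp: mod_hom_add mod_hom_smult mod_hom_closed Y.M.add_diff_add Y.smult_r_diff)
qed

lemma mod_hom_plus:
  assumes "left_module R Y" "h \<in> mod_hom R X Y" "k \<in> mod_hom R X Y"
  shows "(\<lambda>x. h x \<oplus>\<^bsub>Y\<^esub> k x) \<in> mod_hom R X Y"
proof -
  interpret Y: left_module R Y by fact
  show ?thesis
    using assms(2,3)
    by (intro mod_homI)
      (auto simp: mod_hom_add mod_hom_smult mod_hom_closed Y.M.a_ac Y.smult_r_distr)
qed

lemma submodule_image:
  assumes "left_module R X" "left_module R Y" "h \<in> mod_hom R X Y"
  shows "submodule (h ` carrier X) R Y"
proof -
  interpret X: left_module R X by fact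
  interpret Y: left_module R Y by fact
  show ?thesis
  proof (rule Y.submoduleI)
    show "\<zero>\<^bsub>Y\<^esub> \<in> h ` carrier X"
      using mod_hom_zero[OF assms] by (metis X.M.zero_closed imageI)
    show "x \<oplus>\<^bsub>Y\<^esub> y \<in> h ` carrier X" if "x \<in> h ` carrier X" "y \<in> h ` carrier X" for x y
      using that by (auto simp: image_iff intro!: bexI mod_hom_add[OF assms(3), symmetric])
    show "a \<odot>\<^bsub>Y\<^esub> x \<in> h ` carrier X" if "a \<in> carrier R" "x \<in> h ` carrier X" for a x
      using that by (auto simp: image_iff intro!: bexI mod_hom_smult[OF assms(3), symmetric] X.smult_closed)
  qed (use mod_hom_closed[OF assms(3)] in auto)
qed

lemma submodule_kernel:
  assumes "left_module R X" "left_module R Y" "h \<in> mod_hom R X Y"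
  shows "submodule {x \<in> carrier X. h x = \<zero>\<^bsub>Y\<^esub>} R X"
proof -
  interpret X: left_module R X by fact
  interpret Y: left_module R Y by fact
  show ?thesis
    using mod_hom_zero[OF assms] mod_hom_add[OF assms(3)] mod_hom_smult[OF assms(3)]
    by (intro X.submoduleI) (auto simp: X.smult_closed Y.smult_r_null)
qed

section \<open>Quotient modules\<close>

locale quotient_setting = left_module R X for R :: "('r, 'z) ring_scheme" and X :: "('r, 'x) module" +
  fixes U assumes submodule_U: "submodule U R X"
begin

sublocale abelian_subgroup U X
  by (intro abelian_subgroupI3 additive_subgroupI submodule.axioms(1)[OF submodule_U]
      M.abelian_group_axioms)

lemma coset_eq_iff:
  assumes "x \<in> carrier X" "y \<in> carrier X"
  shows "U +>\<^bsub>X\<^esub> x = U +>\<^bsub>X\<^esub> y \<longleftrightarrow> x \<ominus>\<^bsub>X\<^esub> y \<in> U"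
proof -
  have "x \<ominus>\<^bsub>X\<^esub> y \<in> U \<longleftrightarrow> x \<in> U +>\<^bsub>X\<^esub> y"
    using assms a_rcos_module[of y x] by (simp add: M.minus_eq)
  then show ?thesis
    using a_repr_independence' a_rcos_self assms by metis
qed

lemma coset_memE:
  assumes "x \<in> carrier X" "y \<in> U +>\<^bsub>X\<^esub> x"
  shows "y \<in> carrier X" "U +>\<^bsub>X\<^esub> y = U +>\<^bsub>X\<^esub> x"
  using assms a_elemrcos_carrier a_repr_independence' by metis+

lemma carrier_quotient:
  "C \<in> carrier (quotient_module X U) \<longleftrightarrow> (\<exists>x\<in>carrier X. C = U +>\<^bsub>X\<^esub> x)"
  by (auto simp: quotient_module_def A_RCOSETS_def')

lemma coset_closed: "x \<in> carrier X \<Longrightarrow> U +>\<^bsub>X\<^esub> x \<in> carrier (quotient_module X U)"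
  by (auto simp: carrier_quotient)

lemma coset_add:
  "\<lbrakk>x \<in> carrier X; y \<in> carrier X\<rbrakk> \<Longrightarrow>
    (U +>\<^bsub>X\<^esub> x) \<oplus>\<^bsub>quotient_module X U\<^esub> (U +>\<^bsub>X\<^esub> y) = U +>\<^bsub>X\<^esub> (x \<oplus>\<^bsub>X\<^esub> y)"
  by (simp add: quotient_module_def a_rcos_sum)

text \<open>Scalar multiplication on a quotient and \<open>homology_map\<close> are both written as
  a union of cosets over all representatives. Once each representative gives the same coset, the
  union is that coset, since there is at least one representative.\<close>

lemma coset_UN_eq:
  assumes "x \<in> carrier X" "\<And>y. y \<in> U +>\<^bsub>X\<^esub> x \<Longrightarrow> F y = C"
  shows "(\<Union>y\<in>U +>\<^bsub>X\<^esub> x. F y) = C"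
  using a_rcos_self[OF assms(1)] assms(2) by fastforce

lemma coset_smult:
  assumes "r \<in> carrier R" "x \<in> carrier X"
  shows "r \<odot>\<^bsub>quotient_module X U\<^esub> (U +>\<^bsub>X\<^esub> x) = U +>\<^bsub>X\<^esub> (r \<odot>\<^bsub>X\<^esub> x)"
proof -
  have "U +>\<^bsub>X\<^esub> (r \<odot>\<^bsub>X\<^esub> y) = U +>\<^bsub>X\<^esub> (r \<odot>\<^bsub>X\<^esub> x)" if y: "y \<in> U +>\<^bsub>X\<^esub> x" for y
  proof -
    note yx = coset_memE[OF assms(2) y]
    then have "r \<odot>\<^bsub>X\<^esub> (y \<ominus>\<^bsub>X\<^esub> x) \<in> U"
      using submodule_smult[OF submodule_U assms(1)] coset_eq_iff assms(2) by blast
    then show ?thesis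
      using assms yx by (simp add: coset_eq_iff smult_closed smult_r_diff)
  qed
  then have "(\<Union>y\<in>U +>\<^bsub>X\<^esub> x. U +>\<^bsub>X\<^esub> (r \<odot>\<^bsub>X\<^esub> y)) = U +>\<^bsub>X\<^esub> (r \<odot>\<^bsub>X\<^esub> x)"
    by (rule coset_UN_eq[OF assms(2)])
  then show ?thesis
    by (simp add: quotient_module_def)
qed

lemma zero_quotient: "\<zero>\<^bsub>quotient_module X U\<^esub> = U +>\<^bsub>X\<^esub> \<zero>\<^bsub>X\<^esub>"
  using a_subset by (simp add: quotient_module_def)

lemma quotient_left_module: "left_module R (quotient_module X U)"
proof -
  let ?Q = "quotient_module X U"
  have ag: "abelian_group ?Q"
  proof (rule abelian_groupI)
    fix C assume "C \<in> carrier ?Q"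
    then obtain x where x: "x \<in> carrier X" "C = U +>\<^bsub>X\<^esub> x" by (auto simp: carrier_quotient)
    then show "\<zero>\<^bsub>?Q\<^esub> \<oplus>\<^bsub>?Q\<^esub> C = C"
      by (simp add: zero_quotient coset_add)
    show "\<exists>D\<in>carrier ?Q. D \<oplus>\<^bsub>?Q\<^esub> C = \<zero>\<^bsub>?Q\<^esub>"
      using x by (intro bexI[of _ "U +>\<^bsub>X\<^esub> (\<ominus>\<^bsub>X\<^esub> x)"])
        (auto simp: zero_quotient coset_add coset_closed M.l_neg)
  qed (auto simp: carrier_quotient zero_quotient coset_add M.a_ac)
  show ?thesis
    by (intro left_module.intro R.ring_axioms ag left_module_axioms.intro)
      (auto simp: carrier_quotient coset_add coset_smult smult_closed smult_l_distr
        smult_r_distr smult_assoc smult_one)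
qed

lemma coset_hom: "(\<lambda>x. U +>\<^bsub>X\<^esub> x) \<in> mod_hom R X (quotient_module X U)"
  by (auto intro!: mod_homI simp: coset_closed coset_add coset_smult)

lemma quotient_universal:
  assumes Y: "left_module R Y" and h: "h \<in> mod_hom R X Y" and h0: "\<And>u. u \<in> U \<Longrightarrow> h u = \<zero>\<^bsub>Y\<^esub>"
  obtains k where "k \<in> mod_hom R (quotient_module X U) Y" "\<And>x. x \<in> carrier X \<Longrightarrow> k (U +>\<^bsub>X\<^esub> x) = h x"
proof
  interpret Y: left_module R Y by fact
  \<comment> \<open>Any representative will do: two of them differ by an element of
    \<open>U\<close>, and \<open>h\<close> vanishes there.\<close>
  define k where "k C = h (SOME x. x \<in> carrier X \<and> C = U +>\<^bsub>X\<^esub> x)" for C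
  show k: "k (U +>\<^bsub>X\<^esub> x) = h x" if x: "x \<in> carrier X" for x
  proof -
    define y where "y = (SOME y. y \<in> carrier X \<and> U +>\<^bsub>X\<^esub> x = U +>\<^bsub>X\<^esub> y)"
    have y: "y \<in> carrier X \<and> U +>\<^bsub>X\<^esub> x = U +>\<^bsub>X\<^esub> y"
      unfolding y_def by (rule someI) (use x in auto)
    then have "h (x \<ominus>\<^bsub>X\<^esub> y) = \<zero>\<^bsub>Y\<^esub>"
      using x h0 coset_eq_iff by blast
    then have "h y = h x"
      using x y mod_hom_minus[OF left_module_axioms Y h x] mod_hom_closed[OF h]
        Y.M.diff_eq_zero_iff by metis
    then show ?thesis
      by (simp only: k_def y_def)
  qed
  show "k \<in> mod_hom R (quotient_module X U) Y"
    using h by (intro mod_homI) (auto simp: carrier_quotient coset_add coset_smult k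
        mod_hom_closed mod_hom_add mod_hom_smult smult_closed)
qed

end

section \<open>Free and projective modules\<close>

lemma free_module_simps:
  "p \<in> carrier (free_module R S) \<longleftrightarrow>
    finite {x. p x \<noteq> \<zero>\<^bsub>R\<^esub>} \<and> (\<forall>x. p x \<in> carrier R) \<and> (\<forall>x. x \<notin> S \<longrightarrow> p x = \<zero>\<^bsub>R\<^esub>)"
  "\<zero>\<^bsub>free_module R S\<^esub> = (\<lambda>x. \<zero>\<^bsub>R\<^esub>)"
  "p \<oplus>\<^bsub>free_module R S\<^esub> q = (\<lambda>x. p x \<oplus>\<^bsub>R\<^esub> q x)"
  "r \<odot>\<^bsub>free_module R S\<^esub> p = (\<lambda>x. r \<otimes>\<^bsub>R\<^esub> p x)"
  by (simp_all add: free_module_def)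

lemma (in ring) free_add_closed:
  assumes "p \<in> carrier (free_module R S)" "q \<in> carrier (free_module R S)"
  shows "(\<lambda>x. p x \<oplus> q x) \<in> carrier (free_module R S)"
proof -
  have "{x. p x \<oplus> q x \<noteq> \<zero>} \<subseteq> {x. p x \<noteq> \<zero>} \<union> {x. q x \<noteq> \<zero>}"
    using assms by (auto simp: free_module_simps)
  then show ?thesis
    using assms by (auto simp: free_module_simps intro: finite_subset)
qed

text \<open>The condition \<open>F \<zero> = \<zero>\<close> keeps the support finite. Besides
  negation and scalar multiplication, \<open>F\<close> will be the derivation
  \<open>\<delta>\<close> acting on coefficients.\<close>

lemma (in ring) free_map_closed:
  assumes "p \<in> carrier (free_module R S)" "\<And>a. a \<in> carrier R \<Longrightarrow> F a \<in> carrier R" "F \<zero> = \<zero>"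
  shows "(\<lambda>x. F (p x)) \<in> carrier (free_module R S)"
proof -
  have "{x. F (p x) \<noteq> \<zero>} \<subseteq> {x. p x \<noteq> \<zero>}"
    using assms by auto
  then show ?thesis
    using assms by (auto simp: free_module_simps intro: finite_subset)
qed

lemma (in ring) free_left_module: "left_module R (free_module R S)"
proof -
  let ?F = "free_module R S"
  have ag: "abelian_group ?F"
  proof (rule abelian_groupI)
    fix p assume p: "p \<in> carrier ?F"
    show "\<exists>q\<in>carrier ?F. q \<oplus>\<^bsub>?F\<^esub> p = \<zero>\<^bsub>?F\<^esub>"
      using p free_map_closed[OF p, of "\<lambda>a. \<ominus> a"]
      by (intro bexI[of _ "\<lambda>x. \<ominus> p x"]) (auto simp: free_module_simps l_neg)
  next
    fix p q assume "p \<in> carrier ?F" "q \<in> carrier ?F"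
    then show "p \<oplus>\<^bsub>?F\<^esub> q \<in> carrier ?F"
      by (simp add: free_module_simps(3) free_add_closed)
  qed (auto simp: free_module_simps a_ac)
  show ?thesis
  proof (intro left_module.intro ring_axioms ag left_module_axioms.intro)
    show "r \<odot>\<^bsub>?F\<^esub> p \<in> carrier ?F" if "r \<in> carrier R" "p \<in> carrier ?F" for r p
      using that free_map_closed[OF that(2), of "\<lambda>a. r \<otimes> a"] by (simp add: free_module_simps(4))
  qed (auto simp: free_module_simps l_distr r_distr m_assoc)
qed

lemma (in ring) free_gen_closed: "s \<in> S \<Longrightarrow> free_gen R s \<in> carrier (free_module R S)"
  by (auto simp: free_module_simps free_gen_def)

lemma (in ring) free_induct [consumes 1, case_names zero gen add]:
  assumes "p \<in> carrier (free_module R S)"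
    and zero: "P \<zero>\<^bsub>free_module R S\<^esub>"
    and gen: "\<And>r s. \<lbrakk>r \<in> carrier R; s \<in> S\<rbrakk> \<Longrightarrow> P (r \<odot>\<^bsub>free_module R S\<^esub> free_gen R s)"
    and add: "\<And>p q. \<lbrakk>p \<in> carrier (free_module R S); q \<in> carrier (free_module R S); P p; P q\<rbrakk> \<Longrightarrow>
      P (p \<oplus>\<^bsub>free_module R S\<^esub> q)"
  shows "P p"
proof -
  let ?F = "free_module R S"
  interpret F: left_module R ?F by (rule free_left_module)
  \<comment> \<open>The induction runs over a finite set \<open>T\<close> that contains the support,
    not over the support itself, so that a step may also remove a point where \<open>p\<close>
    happens to vanish.\<close>
  have "P p" if "finite T" "p \<in> carrier ?F" "{x. p x \<noteq> \<zero>} \<subseteq> T" for T p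
    using that
  proof (induction T arbitrary: p rule: finite_induct)
    case empty
    then have "p = \<zero>\<^bsub>?F\<^esub>"
      by (auto simp: free_module_simps)
    then show ?case using zero by simp
  next
    case (insert t T)
    show ?case
    proof (cases "t \<in> S")
      \<comment> \<open>Coefficients outside \<open>S\<close> are zero, so \<open>t\<close> can
        simply be dropped from the bound on the support.\<close>
      case False
      then have "{x. p x \<noteq> \<zero>} \<subseteq> T"
        using insert.prems by (auto simp: free_module_simps)
      then show ?thesis
        using insert by blast
    next
      case True
      \<comment> \<open>Removing the coefficient at \<open>t\<close> leaves an element supported in
        \<open>T\<close>, to which the induction hypothesis applies.\<close>
      define q where "q = p(t := \<zero>)"
      have sub: "{x. q x \<noteq> \<zero>} \<subseteq> {x. p x \<noteq> \<zero>}"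
        by (auto simp: q_def)
      then have q: "q \<in> carrier ?F"
        using insert.prems(1) finite_subset[OF sub] by (auto simp: free_module_simps q_def)
      have pt: "p t \<in> carrier R" and px: "\<And>x. p x \<in> carrier R"
        using insert.prems(1) by (auto simp: free_module_simps)
      have "P q"
        using insert.prems(2) by (intro insert.IH q) (auto simp: q_def)
      moreover have "p = (p t \<odot>\<^bsub>?F\<^esub> free_gen R t) \<oplus>\<^bsub>?F\<^esub> q"
        using px by (auto simp: free_module_simps free_gen_def q_def)
      ultimately show ?thesis
        using add[of "p t \<odot>\<^bsub>?F\<^esub> free_gen R t" q] gen[OF pt True] q True pt
        by (metis F.smult_closed free_gen_closed)
    qed
  qed
  then show ?thesis
    using assms(1) by (auto simp: free_module_simps)
qed

lemma (in ring) free_hom_eqI: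
  assumes "left_module R X" "h \<in> mod_hom R (free_module R S) X" "k \<in> mod_hom R (free_module R S) X"
    and "\<And>s. s \<in> S \<Longrightarrow> h (free_gen R s) = k (free_gen R s)" "p \<in> carrier (free_module R S)"
  shows "h p = k p"
  using assms(5)
proof (induction p rule: free_induct)
  case zero
  then show ?case
    using mod_hom_zero[OF free_left_module assms(1) assms(2)]
      mod_hom_zero[OF free_left_module assms(1) assms(3)] by simp
qed (use assms(2-4) in \<open>simp_all add: mod_hom_add mod_hom_smult free_gen_closed\<close>)

text \<open>The linear extension to the free module of a map \<open>\<gamma>\<close> given on the
  generators: the existence half of the universal property, with \<open>free_hom_eqI\<close> as the
  uniqueness half.\<close>

definition free_sum ::
  "('r, 'z) ring_scheme \<Rightarrow> ('r, 'x) module \<Rightarrow> ('s \<Rightarrow> 'x) \<Rightarrow> ('s \<Rightarrow> 'r) \<Rightarrow> 'x" where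
  "free_sum R X \<gamma> p = (\<Oplus>\<^bsub>X\<^esub>s\<in>{s. p s \<noteq> \<zero>\<^bsub>R\<^esub>}. p s \<odot>\<^bsub>X\<^esub> \<gamma> s)"

context left_module
begin

lemma finsum_smult:
  assumes "finite T" "r \<in> carrier R" "h \<in> T \<rightarrow> carrier M"
  shows "r \<odot>\<^bsub>M\<^esub> (\<Oplus>\<^bsub>M\<^esub>t\<in>T. h t) = (\<Oplus>\<^bsub>M\<^esub>t\<in>T. r \<odot>\<^bsub>M\<^esub> h t)"
  using assms(1,3)
proof (induction T rule: finite_induct)
  case empty
  then show ?case using assms(2) by (simp add: smult_r_null)
next
  case (insert t T)
  then have "h \<in> T \<rightarrow> carrier M" "h t \<in> carrier M" "(\<lambda>t. r \<odot>\<^bsub>M\<^esub> h t) \<in> T \<rightarrow> carrier M"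
    using assms(2) by (auto simp: Pi_iff intro!: smult_closed)
  then show ?case
    using insert assms(2) by (simp add: smult_r_distr smult_closed)
qed

text \<open>The range of summation in \<open>free_sum\<close> varies with \<open>p\<close>.
  Enlarging it to a common finite set, where the extra terms are zero, lets sums for different
  elements be compared term by term.\<close>

lemma free_sum_superset:
  assumes "\<gamma> \<in> S \<rightarrow> carrier M" "p \<in> carrier (free_module R S)" "finite T" "{s. p s \<noteq> \<zero>} \<subseteq> T" "T \<subseteq> S"
  shows "free_sum R M \<gamma> p = (\<Oplus>\<^bsub>M\<^esub>s\<in>T. p s \<odot>\<^bsub>M\<^esub> \<gamma> s)"
  unfolding free_sum_def
  by (rule M.add.finprod_mono_neutral_cong_left)
    (use assms in \<open>auto simp: free_module_simps smult_closed Pi_iff subset_iff intro!: smult_l_null\<close>)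

lemma free_sum_hom:
  assumes \<gamma>: "\<gamma> \<in> S \<rightarrow> carrier M"
  shows "free_sum R M \<gamma> \<in> mod_hom R (free_module R S) M"
proof (rule mod_homI)
  let ?F = "free_module R S"
  interpret F: left_module R ?F by (rule R.free_left_module)
  have cl: "(\<lambda>s. p s \<odot>\<^bsub>M\<^esub> \<gamma> s) \<in> T \<rightarrow> carrier M" if "p \<in> carrier ?F" "T \<subseteq> S" for p T
    using that \<gamma> by (auto simp: free_module_simps intro!: smult_closed)
  have supp: "{s. p s \<noteq> \<zero>} \<subseteq> S" "finite {s. p s \<noteq> \<zero>}" if "p \<in> carrier ?F" for p
    using that by (auto simp: free_module_simps)
  show "free_sum R M \<gamma> p \<in> carrier M" if "p \<in> carrier ?F" for p
    using cl[OF that supp(1)[OF that]] unfolding free_sum_def by (rule M.finsum_closed)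
  show "free_sum R M \<gamma> (p \<oplus>\<^bsub>?F\<^esub> q) = free_sum R M \<gamma> p \<oplus>\<^bsub>M\<^esub> free_sum R M \<gamma> q"
    if p: "p \<in> carrier ?F" and q: "q \<in> carrier ?F" for p q
  proof -
    define T where "T = {s. p s \<noteq> \<zero>} \<union> {s. q s \<noteq> \<zero>}"
    have T: "finite T" "T \<subseteq> S"
      using supp p q by (auto simp: T_def)
    have sub: "{s. (p \<oplus>\<^bsub>?F\<^esub> q) s \<noteq> \<zero>} \<subseteq> T"
      using p q by (auto simp: T_def free_module_simps)
    have "free_sum R M \<gamma> (p \<oplus>\<^bsub>?F\<^esub> q) = (\<Oplus>\<^bsub>M\<^esub>s\<in>T. (p \<oplus>\<^bsub>?F\<^esub> q) s \<odot>\<^bsub>M\<^esub> \<gamma> s)"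
      using p q T sub by (intro free_sum_superset[OF \<gamma>]) auto
    also have "\<dots> = (\<Oplus>\<^bsub>M\<^esub>s\<in>T. p s \<odot>\<^bsub>M\<^esub> \<gamma> s \<oplus>\<^bsub>M\<^esub> q s \<odot>\<^bsub>M\<^esub> \<gamma> s)"
      using p q T \<gamma> cl[OF p T(2)] cl[OF q T(2)]
      by (intro M.finsum_cong') (auto simp: free_module_simps smult_l_distr Pi_iff subset_iff)
    also have "\<dots> = (\<Oplus>\<^bsub>M\<^esub>s\<in>T. p s \<odot>\<^bsub>M\<^esub> \<gamma> s) \<oplus>\<^bsub>M\<^esub> (\<Oplus>\<^bsub>M\<^esub>s\<in>T. q s \<odot>\<^bsub>M\<^esub> \<gamma> s)"
      by (rule M.finsum_addf[OF cl[OF p T(2)] cl[OF q T(2)]])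
    also have "\<dots> = free_sum R M \<gamma> p \<oplus>\<^bsub>M\<^esub> free_sum R M \<gamma> q"
      using p q T by (simp add: free_sum_superset[OF \<gamma>, of _ T] T_def)
    finally show ?thesis .
  qed
  show "free_sum R M \<gamma> (r \<odot>\<^bsub>?F\<^esub> p) = r \<odot>\<^bsub>M\<^esub> free_sum R M \<gamma> p"
    if r: "r \<in> carrier R" and p: "p \<in> carrier ?F" for r p
  proof -
    define T where "T = {s. p s \<noteq> \<zero>}"
    have T: "finite T" "T \<subseteq> S"
      using supp p by (auto simp: T_def)
    have "free_sum R M \<gamma> (r \<odot>\<^bsub>?F\<^esub> p) = (\<Oplus>\<^bsub>M\<^esub>s\<in>T. (r \<odot>\<^bsub>?F\<^esub> p) s \<odot>\<^bsub>M\<^esub> \<gamma> s)"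
      using r p T by (intro free_sum_superset[OF \<gamma>] F.smult_closed) (auto simp: T_def free_module_simps)
    also have "\<dots> = (\<Oplus>\<^bsub>M\<^esub>s\<in>T. r \<odot>\<^bsub>M\<^esub> (p s \<odot>\<^bsub>M\<^esub> \<gamma> s))"
      using r p T \<gamma> cl[OF p T(2)]
      by (intro M.finsum_cong') (auto simp: free_module_simps smult_assoc smult_closed Pi_iff subset_iff)
    also have "\<dots> = r \<odot>\<^bsub>M\<^esub> free_sum R M \<gamma> p"
      unfolding free_sum_def T_def[symmetric] by (rule finsum_smult[OF T(1) r cl[OF p T(2)], symmetric])
    finally show ?thesis .
  qed
qed

lemma free_sum_gen:
  assumes \<gamma>: "\<gamma> \<in> S \<rightarrow> carrier M" and "s \<in> S"
  shows "free_sum R M \<gamma> (free_gen R s) = \<gamma> s"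
proof -
  have "free_sum R M \<gamma> (free_gen R s) = (\<Oplus>\<^bsub>M\<^esub>t\<in>{s}. free_gen R s t \<odot>\<^bsub>M\<^esub> \<gamma> t)"
    using assms by (intro free_sum_superset[OF \<gamma>] R.free_gen_closed) (auto simp: free_gen_def)
  also have "\<dots> = \<gamma> s"
    using assms by (subst M.finsum_insert) (auto simp: free_gen_def smult_one Pi_iff)
  finally show ?thesis .
qed

end

section \<open>Projective modules: lifting of maps, and retracts of free modules\<close>

lemma projective_left_module: "projective_module R P \<Longrightarrow> left_module R P"
  by (simp add: projective_module_def)

text \<open>
  The projection from the free module on the set \<open>P\<close> splits by projectivity; composing a
  splitting with a lift on generators lifts \<open>h\<close>, for \<open>X\<close> and \<open>Y\<close> of any type.
\<close>

lemma projective_lift: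
  assumes P: "projective_module R P" and X: "left_module R X" and Y: "left_module R Y"
    and e: "e \<in> mod_hom R X Y" and h: "h \<in> mod_hom R P Y" and sub: "h ` carrier P \<subseteq> e ` carrier X"
  obtains k where "k \<in> mod_hom R P X" "\<And>p. p \<in> carrier P \<Longrightarrow> e (k p) = h p"
proof -
  interpret P: left_module R P by (rule projective_left_module[OF P])
  interpret X: left_module R X by fact
  let ?F = "free_module R (carrier P)"
  define \<pi> where "\<pi> = free_sum R P (\<lambda>p. p)"
  have \<pi>: "\<pi> \<in> mod_hom R ?F P"
    unfolding \<pi>_def by (rule P.free_sum_hom) auto
  have \<pi>_gen: "\<pi> (free_gen R p) = p" if "p \<in> carrier P" for p
    unfolding \<pi>_def using that by (subst P.free_sum_gen[where S = "carrier P"]) auto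
  have "\<pi> ` carrier ?F = carrier P"
  proof (intro equalityI subsetI)
    show "p \<in> \<pi> ` carrier ?F" if "p \<in> carrier P" for p
      using \<pi>_gen[OF that] P.R.free_gen_closed[OF that] by (metis imageI)
  qed (use mod_hom_closed[OF \<pi>] in auto)
  then obtain s where s: "s \<in> mod_hom R P ?F" "\<And>p. p \<in> carrier P \<Longrightarrow> \<pi> (s p) = p"
    using P \<pi> mod_hom_id[of R P] P.left_module_axioms P.R.free_left_module
    unfolding projective_module_def by metis
  \<comment> \<open>Preimages are chosen for values of \<open>h\<close> alone, so the inclusion
    \<open>sub\<close> takes the place of surjectivity; exactness of a resolution supplies
    inclusions of exactly this kind.\<close>
  have "\<forall>p\<in>carrier P. \<exists>x\<in>carrier X. h p = e x"
    using sub by (simp add: image_subset_iff image_iff)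
  then obtain \<gamma> where \<gamma>: "\<gamma> \<in> carrier P \<rightarrow> carrier X" "\<And>p. p \<in> carrier P \<Longrightarrow> e (\<gamma> p) = h p"
    using bchoice[of "carrier P" "\<lambda>p x. x \<in> carrier X \<and> h p = e x"] by fastforce
  let ?k = "free_sum R X \<gamma>"
  have k: "?k \<in> mod_hom R ?F X"
    by (rule X.free_sum_hom[OF \<gamma>(1)])
  have "e (?k u) = h (\<pi> u)" if "u \<in> carrier ?F" for u
    by (rule P.R.free_hom_eqI[OF Y mod_hom_comp[OF k e] mod_hom_comp[OF \<pi> h] _ that])
      (simp add: X.free_sum_gen[OF \<gamma>(1)] \<gamma>(2) \<pi>_gen)
  then show ?thesis
    using that[OF mod_hom_comp[OF s(1) k]] s mod_hom_closed[OF s(1)] by simp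
qed

text \<open>The composite of \<open>h\<close> with \<open>i\<close> is lifted on the generators of
  the free module, and the lift is then precomposed with the section \<open>j\<close>. The case of
  interest is \<open>syz_free\<close>, a coded copy of a free module, with encoding as
  \<open>i\<close> and decoding as \<open>j\<close>.\<close>

lemma projective_if_retract_free:
  fixes P :: "('r, 'p) module"
  assumes P: "left_module R P" and i: "i \<in> mod_hom R (free_module R S) P"
    and j: "j \<in> mod_hom R P (free_module R S)" and ij: "\<And>p. p \<in> carrier P \<Longrightarrow> i (j p) = p"
  shows "projective_module R P"
  unfolding projective_module_def
proof (intro conjI allI impI ballI P; elim conjE)
  fix X :: "('r, 'p \<Rightarrow> 'r) module" and Y :: "('r, 'p) module" and e h
  assume X: "left_module R X" and Y: "left_module R Y" and e: "e \<in> mod_hom R X Y"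
    and h: "h \<in> mod_hom R P Y" and surj: "e ` carrier X = carrier Y"
  interpret X: left_module R X by fact
  have gen: "i (free_gen R s) \<in> carrier P" if "s \<in> S" for s
    by (rule mod_hom_closed[OF i X.R.free_gen_closed[OF that]])
  have "\<forall>s\<in>S. \<exists>x\<in>carrier X. h (i (free_gen R s)) = e x"
    using mod_hom_closed[OF h gen] by (simp add: image_iff flip: surj)
  then obtain \<gamma> where \<gamma>: "\<gamma> \<in> S \<rightarrow> carrier X" "\<And>s. s \<in> S \<Longrightarrow> e (\<gamma> s) = h (i (free_gen R s))"
    using bchoice[of S "\<lambda>s x. x \<in> carrier X \<and> h (i (free_gen R s)) = e x"] by fastforce
  let ?k = "free_sum R X \<gamma>"
  have k: "?k \<in> mod_hom R (free_module R S) X"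
    by (rule X.free_sum_hom[OF \<gamma>(1)])
  have "e (?k u) = h (i u)" if "u \<in> carrier (free_module R S)" for u
    by (rule X.R.free_hom_eqI[OF Y mod_hom_comp[OF k e] mod_hom_comp[OF i h] _ that])
      (simp add: X.free_sum_gen[OF \<gamma>(1)] \<gamma>(2))
  then show "\<exists>h'\<in>mod_hom R P X. \<forall>p\<in>carrier P. e (h' p) = h p"
    using mod_hom_closed[OF j] ij by (intro bexI[OF _ mod_hom_comp[OF j k]]) auto
qed

section \<open>Tensor products\<close>

lemma submodule_span_least: "\<lbrakk>submodule U R X; B \<subseteq> U\<rbrakk> \<Longrightarrow> submodule_span R X B \<subseteq> U"
  by (auto simp: submodule_span_def)

lemma submodule_span_superset: "B \<subseteq> submodule_span R X B"
  by (auto simp: submodule_span_def)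

text \<open>Since \<open>B\<close> lies in \<open>carrier M\<close>, the whole module is among the
  submodules being intersected, which bounds the span; the closure properties pass to
  intersections.\<close>

lemma (in left_module) submodule_span_submodule:
  assumes "B \<subseteq> carrier M"
  shows "submodule (submodule_span R M B) R M"
proof (rule submoduleI)
  have "submodule (carrier M) R M"
    by (rule submoduleI) (auto simp: smult_closed)
  then show "submodule_span R M B \<subseteq> carrier M"
    by (rule submodule_span_least) (rule assms)
qed (auto simp: submodule_span_def submodule_zero submodule_add submodule_smult)

lemma restrict_scalars_simps [simp]:
  "carrier (restrict_scalars A X) = carrier X"
  "add (restrict_scalars A X) = add X"
  "r \<odot>\<^bsub>restrict_scalars A X\<^esub> x = (r \<odot>\<^bsub>A\<^esub> \<one>\<^bsub>A\<^esub>) \<odot>\<^bsub>X\<^esub> x"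
  by (simp_all add: restrict_scalars_def)

text \<open>The conditions for \<open>\<beta>\<close> to factor through the tensor product over
  \<open>A\<close>: after the clause on closure, each clause corresponds to one family in
  \<open>tensor_relators\<close>.\<close>

definition balanced ::
  "('k, 'z) ring_scheme \<Rightarrow> ('k, 'a) module \<Rightarrow> ('a, 'm) module \<Rightarrow> ('a, 'n) module \<Rightarrow>
    ('k, 'y) module \<Rightarrow> ('m \<Rightarrow> 'n \<Rightarrow> 'y) \<Rightarrow> bool" where
  "balanced K A M N Y \<beta> \<longleftrightarrow>
    (\<forall>m\<in>carrier M. \<forall>n\<in>carrier N. \<beta> m n \<in> carrier Y) \<and>
    (\<forall>m\<in>carrier M. \<forall>m'\<in>carrier M. \<forall>n\<in>carrier N. \<beta> (m \<oplus>\<^bsub>M\<^esub> m') n = \<beta> m n \<oplus>\<^bsub>Y\<^esub> \<beta> m' n) \<and>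
    (\<forall>m\<in>carrier M. \<forall>n\<in>carrier N. \<forall>n'\<in>carrier N. \<beta> m (n \<oplus>\<^bsub>N\<^esub> n') = \<beta> m n \<oplus>\<^bsub>Y\<^esub> \<beta> m n') \<and>
    (\<forall>a\<in>carrier A. \<forall>m\<in>carrier M. \<forall>n\<in>carrier N. \<beta> (a \<odot>\<^bsub>M\<^esub> m) n = \<beta> m (a \<odot>\<^bsub>N\<^esub> n)) \<and>
    (\<forall>r\<in>carrier K. \<forall>m\<in>carrier M. \<forall>n\<in>carrier N.
      \<beta> ((r \<odot>\<^bsub>A\<^esub> \<one>\<^bsub>A\<^esub>) \<odot>\<^bsub>M\<^esub> m) n = r \<odot>\<^bsub>Y\<^esub> \<beta> m n)"

locale tensor_setting =
  fixes K :: "('k, 'z) ring_scheme" and A :: "('k, 'a) module" and M :: "('a, 'm) module"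
  assumes alg: "k_algebra K A" and rmod: "right_module A M"
begin

sublocale Alg: k_algebra K A by (rule alg)
sublocale RM: right_module A M by (rule rmod)

end

locale tensor_product = tensor_setting K A M
  for K :: "('k, 'z) ring_scheme" and A :: "('k, 'a) module" and M :: "('a, 'm) module" +
  fixes N :: "('a, 'n) module"
  assumes lmod: "left_module A N"
begin

sublocale LN: left_module A N by (rule lmod)

abbreviation "F \<equiv> free_module K (carrier M \<times> carrier N)"
abbreviation "T \<equiv> tensor K A M N"
abbreviation "pt \<equiv> pure_tensor K A M N"

sublocale F: left_module K F by (rule Alg.R.free_left_module)

lemma relators_closed: "tensor_relators K A M N \<subseteq> carrier F"
  by (auto simp: tensor_relators_def Let_def RM.smult_closed LN.smult_closed
      intro!: F.M.minus_closed F.M.a_closed F.smult_closed Alg.R.free_gen_closed)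

sublocale Q: quotient_setting K F "tensor_kernel K A M N"
  by (intro quotient_setting.intro quotient_setting_axioms.intro F.left_module_axioms)
    (simp add: tensor_kernel_def F.submodule_span_submodule relators_closed)

lemma relator_in_kernel: "u \<in> tensor_relators K A M N \<Longrightarrow> u \<in> tensor_kernel K A M N"
  unfolding tensor_kernel_def by (rule subsetD[OF submodule_span_superset])

lemma tensor_left_module: "left_module K T"
  unfolding tensor_def by (rule Q.quotient_left_module)

sublocale T: left_module K T by (rule tensor_left_module)

lemma gen_closed: "\<lbrakk>m \<in> carrier M; n \<in> carrier N\<rbrakk> \<Longrightarrow> free_gen K (m, n) \<in> carrier F"
  by (rule Alg.R.free_gen_closed) simp

lemma pure_closed: "\<lbrakk>m \<in> carrier M; n \<in> carrier N\<rbrakk> \<Longrightarrow> pt m n \<in> carrier T"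
  by (simp add: pure_tensor_def tensor_def Q.coset_closed gen_closed)

lemma pure_add_left:
  assumes "m \<in> carrier M" "m' \<in> carrier M" "n \<in> carrier N"
  shows "pt (m \<oplus>\<^bsub>M\<^esub> m') n = pt m n \<oplus>\<^bsub>T\<^esub> pt m' n"
proof -
  have "free_gen K (m \<oplus>\<^bsub>M\<^esub> m', n) \<ominus>\<^bsub>F\<^esub> (free_gen K (m, n) \<oplus>\<^bsub>F\<^esub> free_gen K (m', n))
      \<in> tensor_kernel K A M N"
    using assms by (intro relator_in_kernel) (auto simp: tensor_relators_def Let_def)
  then show ?thesis
    using assms by (simp add: pure_tensor_def tensor_def Q.coset_add gen_closed Q.coset_eq_iff)
qed

lemma pure_add_right:
  assumes "m \<in> carrier M" "n \<in> carrier N" "n' \<in> carrier N"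
  shows "pt m (n \<oplus>\<^bsub>N\<^esub> n') = pt m n \<oplus>\<^bsub>T\<^esub> pt m n'"
proof -
  have "free_gen K (m, n \<oplus>\<^bsub>N\<^esub> n') \<ominus>\<^bsub>F\<^esub> (free_gen K (m, n) \<oplus>\<^bsub>F\<^esub> free_gen K (m, n'))
      \<in> tensor_kernel K A M N"
    using assms by (intro relator_in_kernel) (auto simp: tensor_relators_def Let_def)
  then show ?thesis
    using assms by (simp add: pure_tensor_def tensor_def Q.coset_add gen_closed Q.coset_eq_iff)
qed

lemma pure_balance:
  assumes "a \<in> carrier A" "m \<in> carrier M" "n \<in> carrier N"
  shows "pt (a \<odot>\<^bsub>M\<^esub> m) n = pt m (a \<odot>\<^bsub>N\<^esub> n)"
proof -
  have "free_gen K (a \<odot>\<^bsub>M\<^esub> m, n) \<ominus>\<^bsub>F\<^esub> free_gen K (m, a \<odot>\<^bsub>N\<^esub> n) \<in> tensor_kernel K A M N"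
    using assms by (intro relator_in_kernel) (auto simp: tensor_relators_def Let_def)
  then show ?thesis
    using assms by (simp add: pure_tensor_def gen_closed Q.coset_eq_iff RM.smult_closed LN.smult_closed)
qed

lemma pure_scalar:
  assumes "r \<in> carrier K" "m \<in> carrier M" "n \<in> carrier N"
  shows "pt ((r \<odot>\<^bsub>A\<^esub> \<one>\<^bsub>A\<^esub>) \<odot>\<^bsub>M\<^esub> m) n = r \<odot>\<^bsub>T\<^esub> pt m n"
proof -
  have "r \<odot>\<^bsub>F\<^esub> free_gen K (m, n) \<ominus>\<^bsub>F\<^esub> free_gen K ((r \<odot>\<^bsub>A\<^esub> \<one>\<^bsub>A\<^esub>) \<odot>\<^bsub>M\<^esub> m, n)
      \<in> tensor_kernel K A M N"
    using assms by (intro relator_in_kernel) (auto simp: tensor_relators_def Let_def)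
  then have "tensor_kernel K A M N +>\<^bsub>F\<^esub> (r \<odot>\<^bsub>F\<^esub> free_gen K (m, n)) =
      tensor_kernel K A M N +>\<^bsub>F\<^esub> free_gen K ((r \<odot>\<^bsub>A\<^esub> \<one>\<^bsub>A\<^esub>) \<odot>\<^bsub>M\<^esub> m, n)"
    using assms by (simp add: gen_closed Q.coset_eq_iff RM.smult_closed F.smult_closed)
  then show ?thesis
    using assms by (simp add: pure_tensor_def tensor_def Q.coset_smult gen_closed)
qed

lemma pure_scalar_right:
  "\<lbrakk>r \<in> carrier K; m \<in> carrier M; n \<in> carrier N\<rbrakk> \<Longrightarrow>
    pt m ((r \<odot>\<^bsub>A\<^esub> \<one>\<^bsub>A\<^esub>) \<odot>\<^bsub>N\<^esub> n) = r \<odot>\<^bsub>T\<^esub> pt m n"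
  by (simp add: pure_scalar flip: pure_balance)

text \<open>Pure tensors are the classes of the free generators, so composing both maps with the
  projection to the quotient reduces the claim to uniqueness for maps out of a free module.\<close>

lemma tensor_hom_eqI:
  assumes Y: "left_module K Y" and h: "h \<in> mod_hom K T Y" and k: "k \<in> mod_hom K T Y"
    and eq: "\<And>m n. \<lbrakk>m \<in> carrier M; n \<in> carrier N\<rbrakk> \<Longrightarrow> h (pt m n) = k (pt m n)"
    and t: "t \<in> carrier T"
  shows "h t = k t"
proof -
  obtain u where u: "u \<in> carrier F" "t = tensor_kernel K A M N +>\<^bsub>F\<^esub> u"
    using t by (auto simp: tensor_def Q.carrier_quotient)
  note c = Q.coset_hom[folded tensor_def]
  show ?thesis
    unfolding u(2)
    by (rule Alg.R.free_hom_eqI[OF Y mod_hom_comp[OF c h] mod_hom_comp[OF c k] _ u(1)])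
      (auto simp: eq simp flip: pure_tensor_def)
qed

text \<open>Since \<open>tensor_lift\<close> is a definite description, its properties become
  available only after both existence and uniqueness are shown. Existence comes from extending
  \<open>\<beta>\<close> to the free module and passing to the quotient, uniqueness from the values
  on pure tensors.\<close>

lemma
  assumes Y: "left_module K Y" and \<beta>: "balanced K A M N Y \<beta>"
  shows tensor_lift_hom: "tensor_lift K A M N Y \<beta> \<in> mod_hom K T Y"
    and tensor_lift_pure:
      "\<And>m n. \<lbrakk>m \<in> carrier M; n \<in> carrier N\<rbrakk> \<Longrightarrow> tensor_lift K A M N Y \<beta> (pt m n) = \<beta> m n"
proof -
  interpret Y: left_module K Y by fact
  define h where "h = free_sum K Y (\<lambda>(m, n). \<beta> m n)"
  have \<gamma>: "(\<lambda>(m, n). \<beta> m n) \<in> carrier M \<times> carrier N \<rightarrow> carrier Y"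
    using \<beta> by (auto simp: balanced_def)
  have h: "h \<in> mod_hom K F Y"
    unfolding h_def by (rule Y.free_sum_hom[OF \<gamma>])
  have h_gen: "h (free_gen K (m, n)) = \<beta> m n" if "m \<in> carrier M" "n \<in> carrier N" for m n
    unfolding h_def using that by (subst Y.free_sum_gen[OF \<gamma>]) auto
  have \<beta>cl: "\<beta> m n \<in> carrier Y" if "m \<in> carrier M" "n \<in> carrier N" for m n
    using \<beta> that by (auto simp: balanced_def)
  have "u \<in> carrier F \<and> h u = \<zero>\<^bsub>Y\<^esub>" if u: "u \<in> tensor_relators K A M N" for u
  proof
    show "u \<in> carrier F"
      using u relators_closed by blast
    note h_simps = mod_hom_minus[OF F.left_module_axioms Y h] mod_hom_add[OF h] mod_hom_smult[OF h]
      h_gen gen_closed RM.smult_closed LN.smult_closed F.smult_closed Y.M.diff_eq_zero_iff \<beta>cl Y.smult_closed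
    show "h u = \<zero>\<^bsub>Y\<^esub>"
      using u \<beta> unfolding tensor_relators_def Let_def
      by (elim UnE; clarsimp simp: h_simps balanced_def)
  qed
  \<comment> \<open>The kernel of \<open>h\<close> is a submodule that contains the relators, hence
    it contains their span.\<close>
  then have "tensor_kernel K A M N \<subseteq> {u \<in> carrier F. h u = \<zero>\<^bsub>Y\<^esub>}"
    unfolding tensor_kernel_def
    by (intro submodule_span_least submodule_kernel F.left_module_axioms Y h) auto
  then obtain k where k: "k \<in> mod_hom K T Y"
    and k_coset: "\<And>u. u \<in> carrier F \<Longrightarrow> k (tensor_kernel K A M N +>\<^bsub>F\<^esub> u) = h u"
    using Q.quotient_universal[OF Y h] unfolding tensor_def by blast
  \<comment> \<open>Linearity says nothing about values off the carrier; the restriction fixes them,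
    as the description demands.\<close>
  define k' where "k' = restrict k (carrier T)"
  let ?P = "\<lambda>h. h \<in> mod_hom K T Y \<inter> extensional (carrier T) \<and>
    (\<forall>m\<in>carrier M. \<forall>n\<in>carrier N. h (pt m n) = \<beta> m n)"
  have k': "?P k'"
    using k k_coset[OF gen_closed] h_gen pure_closed
    by (auto simp: k'_def mod_hom_def T.smult_closed pure_tensor_def)
  have "k'' = k'" if "?P k''" for k''
  proof (rule extensionalityI)
    show "k'' t = k' t" if "t \<in> carrier T" for t
      by (rule tensor_hom_eqI[OF Y _ _ _ that]) (use k' \<open>?P k''\<close> in auto)
  qed (use k' that in auto)
  then have "?P (tensor_lift K A M N Y \<beta>)"
    unfolding tensor_lift_def by (intro theI[of ?P, OF k'])
  then show "tensor_lift K A M N Y \<beta> \<in> mod_hom K T Y"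
    "\<And>m n. \<lbrakk>m \<in> carrier M; n \<in> carrier N\<rbrakk> \<Longrightarrow> tensor_lift K A M N Y \<beta> (pt m n) = \<beta> m n"
    by auto
qed

end

section \<open>Functoriality of the tensor product in the left module\<close>

context tensor_setting
begin

lemma tensor_productI: "left_module A N \<Longrightarrow> tensor_product K A M N"
  by (intro tensor_product.intro tensor_product_axioms.intro tensor_setting_axioms)

lemma
  assumes X: "left_module A X" and Y: "left_module A Y" and h: "h \<in> mod_hom A X Y"
  shows tensor_map_hom: "tensor_map K A M X Y h \<in> mod_hom K (tensor K A M X) (tensor K A M Y)"
    and tensor_map_pure: "\<And>m x. \<lbrakk>m \<in> carrier M; x \<in> carrier X\<rbrakk> \<Longrightarrow>
      tensor_map K A M X Y h (pure_tensor K A M X m x) = pure_tensor K A M Y m (h x)"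
proof -
  interpret X: tensor_product K A M X by (rule tensor_productI[OF X])
  interpret Y: tensor_product K A M Y by (rule tensor_productI[OF Y])
  have "balanced K A M X (tensor K A M Y) (\<lambda>m x. pure_tensor K A M Y m (h x))"
    using mod_hom_closed[OF h] unfolding balanced_def
    by (simp add: mod_hom_add[OF h] mod_hom_smult[OF h] Y.pure_closed Y.pure_add_left
        Y.pure_add_right Y.pure_balance Y.pure_scalar_right)
  from X.tensor_lift_hom[OF Y.tensor_left_module this] X.tensor_lift_pure[OF Y.tensor_left_module this]
  show "tensor_map K A M X Y h \<in> mod_hom K (tensor K A M X) (tensor K A M Y)"
    "\<And>m x. \<lbrakk>m \<in> carrier M; x \<in> carrier X\<rbrakk> \<Longrightarrow>
      tensor_map K A M X Y h (pure_tensor K A M X m x) = pure_tensor K A M Y m (h x)"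
    by (auto simp: tensor_map_def)
qed

lemma tensor_map_comp:
  assumes X: "left_module A X" and Y: "left_module A Y" and Z: "left_module A Z"
    and h: "h \<in> mod_hom A X Y" and k: "k \<in> mod_hom A Y Z" and t: "t \<in> carrier (tensor K A M X)"
  shows "tensor_map K A M Y Z k (tensor_map K A M X Y h t) = tensor_map K A M X Z (\<lambda>x. k (h x)) t"
proof -
  interpret X: tensor_product K A M X by (rule tensor_productI[OF X])
  interpret Z: tensor_product K A M Z by (rule tensor_productI[OF Z])
  note homs = tensor_map_hom[OF X Y h] tensor_map_hom[OF Y Z k] tensor_map_hom[OF X Z mod_hom_comp[OF h k]]
  show ?thesis
    by (rule X.tensor_hom_eqI[OF Z.tensor_left_module mod_hom_comp[OF homs(1,2)] homs(3) _ t])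
      (simp add: tensor_map_pure[OF X Y h] tensor_map_pure[OF Y Z k]
        tensor_map_pure[OF X Z mod_hom_comp[OF h k]] mod_hom_closed[OF h])
qed

lemma tensor_map_add:
  assumes X: "left_module A X" and Y: "left_module A Y"
    and h: "h \<in> mod_hom A X Y" and k: "k \<in> mod_hom A X Y" and l: "l \<in> mod_hom A X Y"
    and eq: "\<And>x. x \<in> carrier X \<Longrightarrow> h x = k x \<oplus>\<^bsub>Y\<^esub> l x" and t: "t \<in> carrier (tensor K A M X)"
  shows "tensor_map K A M X Y h t =
    tensor_map K A M X Y k t \<oplus>\<^bsub>tensor K A M Y\<^esub> tensor_map K A M X Y l t"
proof -
  interpret X: tensor_product K A M X by (rule tensor_productI[OF X])
  interpret Y: tensor_product K A M Y by (rule tensor_productI[OF Y])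
  show ?thesis
    by (rule X.tensor_hom_eqI[OF Y.tensor_left_module tensor_map_hom[OF X Y h]
          mod_hom_plus[OF Y.tensor_left_module tensor_map_hom[OF X Y k] tensor_map_hom[OF X Y l]] _ t])
      (simp add: tensor_map_pure[OF X Y h] tensor_map_pure[OF X Y k] tensor_map_pure[OF X Y l]
        eq Y.pure_add_right mod_hom_closed[OF k] mod_hom_closed[OF l])
qed

lemma tensor_map_id:
  assumes X: "left_module A X" and t: "t \<in> carrier (tensor K A M X)"
  shows "tensor_map K A M X X (\<lambda>x. x) t = t"
proof -
  interpret X: tensor_product K A M X by (rule tensor_productI[OF X])
  show ?thesis
    by (rule X.tensor_hom_eqI[OF X.tensor_left_module tensor_map_hom[OF X X mod_hom_id] mod_hom_id _ t])
      (simp add: tensor_map_pure[OF X X mod_hom_id])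
qed

lemma tensor_map_cong:
  assumes X: "left_module A X" and Y: "left_module A Y"
    and h: "h \<in> mod_hom A X Y" and k: "k \<in> mod_hom A X Y"
    and eq: "\<And>x. x \<in> carrier X \<Longrightarrow> h x = k x" and t: "t \<in> carrier (tensor K A M X)"
  shows "tensor_map K A M X Y h t = tensor_map K A M X Y k t"
proof -
  interpret X: tensor_product K A M X by (rule tensor_productI[OF X])
  interpret Y: tensor_product K A M Y by (rule tensor_productI[OF Y])
  show ?thesis
    by (rule X.tensor_hom_eqI[OF Y.tensor_left_module tensor_map_hom[OF X Y h] tensor_map_hom[OF X Y k] _ t])
      (simp add: tensor_map_pure[OF X Y h] tensor_map_pure[OF X Y k] eq)
qed

lemma pure_zero_right:
  assumes X: "left_module A X" and m: "m \<in> carrier M"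
  shows "pure_tensor K A M X m \<zero>\<^bsub>X\<^esub> = \<zero>\<^bsub>tensor K A M X\<^esub>"
proof -
  interpret X: tensor_product K A M X by (rule tensor_productI[OF X])
  have "pure_tensor K A M X m \<zero>\<^bsub>X\<^esub> \<oplus>\<^bsub>tensor K A M X\<^esub> pure_tensor K A M X m \<zero>\<^bsub>X\<^esub> =
      pure_tensor K A M X m \<zero>\<^bsub>X\<^esub>"
    using X.pure_add_right[OF m, of "\<zero>\<^bsub>X\<^esub>" "\<zero>\<^bsub>X\<^esub>"] by simp
  then show ?thesis
    using X.pure_closed[OF m X.LN.M.zero_closed] X.T.M.add.r_cancel_one by blast
qed

lemma tensor_map_zero:
  assumes X: "left_module A X" and Y: "left_module A Y" and h: "h \<in> mod_hom A X Y"
    and eq: "\<And>x. x \<in> carrier X \<Longrightarrow> h x = \<zero>\<^bsub>Y\<^esub>" and t: "t \<in> carrier (tensor K A M X)"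
  shows "tensor_map K A M X Y h t = \<zero>\<^bsub>tensor K A M Y\<^esub>"
proof -
  interpret X: tensor_product K A M X by (rule tensor_productI[OF X])
  interpret Y: tensor_product K A M Y by (rule tensor_productI[OF Y])
  have "(\<lambda>_. \<zero>\<^bsub>tensor K A M Y\<^esub>) \<in> mod_hom K (tensor K A M X) (tensor K A M Y)"
    by (auto intro!: mod_homI simp: Y.T.smult_r_null)
  then show ?thesis
    by (rule X.tensor_hom_eqI[OF Y.tensor_left_module tensor_map_hom[OF X Y h] _ _ t])
      (simp add: tensor_map_pure[OF X Y h] eq pure_zero_right[OF Y])
qed

end

section \<open>Delta-operators on tensor products\<close>

locale derivation_setting = tensor_setting K A M
  for K :: "('k, 'z) ring_scheme" and A :: "('k, 'a) module" and M :: "('a, 'm) module" +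
  fixes \<delta> :: "'a \<Rightarrow> 'a" and f :: "'m \<Rightarrow> 'm"
  assumes deriv: "derivation K A \<delta>" and f_op: "right_delta_operator K A \<delta> M f"
begin

lemma delta_hom: "\<delta> \<in> mod_hom K A A"
  using deriv by (simp add: derivation_def)

lemma delta_mult:
  "\<lbrakk>a \<in> carrier A; b \<in> carrier A\<rbrakk> \<Longrightarrow> \<delta> (a \<otimes>\<^bsub>A\<^esub> b) = \<delta> a \<otimes>\<^bsub>A\<^esub> b \<oplus>\<^bsub>A\<^esub> a \<otimes>\<^bsub>A\<^esub> \<delta> b"
  using deriv by (simp add: derivation_def)

lemmas delta_closed = mod_hom_closed[OF delta_hom]

lemma f_props:
  assumes "m \<in> carrier M"
  shows "f m \<in> carrier M"
    and "m' \<in> carrier M \<Longrightarrow> f (m \<oplus>\<^bsub>M\<^esub> m') = f m \<oplus>\<^bsub>M\<^esub> f m'"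
    and "r \<in> carrier K \<Longrightarrow> f ((r \<odot>\<^bsub>A\<^esub> \<one>\<^bsub>A\<^esub>) \<odot>\<^bsub>M\<^esub> m) = (r \<odot>\<^bsub>A\<^esub> \<one>\<^bsub>A\<^esub>) \<odot>\<^bsub>M\<^esub> f m"
    and "a \<in> carrier A \<Longrightarrow> f (a \<odot>\<^bsub>M\<^esub> m) = a \<odot>\<^bsub>M\<^esub> f m \<oplus>\<^bsub>M\<^esub> \<delta> a \<odot>\<^bsub>M\<^esub> m"
  using assms f_op by (auto simp: right_delta_operator_def mod_hom_def)

lemma left_op_props:
  assumes "left_delta_operator K A \<delta> X g" "x \<in> carrier X"
  shows "g x \<in> carrier X"
    and "x' \<in> carrier X \<Longrightarrow> g (x \<oplus>\<^bsub>X\<^esub> x') = g x \<oplus>\<^bsub>X\<^esub> g x'"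
    and "r \<in> carrier K \<Longrightarrow> g ((r \<odot>\<^bsub>A\<^esub> \<one>\<^bsub>A\<^esub>) \<odot>\<^bsub>X\<^esub> x) = (r \<odot>\<^bsub>A\<^esub> \<one>\<^bsub>A\<^esub>) \<odot>\<^bsub>X\<^esub> g x"
    and "a \<in> carrier A \<Longrightarrow> g (a \<odot>\<^bsub>X\<^esub> x) = \<delta> a \<odot>\<^bsub>X\<^esub> x \<oplus>\<^bsub>X\<^esub> a \<odot>\<^bsub>X\<^esub> g x"
  using assms by (auto simp: left_delta_operator_def mod_hom_def)

text \<open>Neither summand is balanced by itself. Moving \<open>a\<close> from the left factor to
  the right, the first summand loses the term m \<delta>(a) \<otimes> n that the rule for
  \<open>f\<close> creates, and the second gains m \<otimes> \<delta>(a) n from the rule for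
  \<open>g\<close>; in the tensor product these are equal, so the sum is balanced.\<close>

lemma
  assumes X: "left_module A X" and g: "left_delta_operator K A \<delta> X g"
  shows boxtimes_hom: "boxtimes K A M X f g \<in> mod_hom K (tensor K A M X) (tensor K A M X)"
    and boxtimes_pure: "\<And>m x. \<lbrakk>m \<in> carrier M; x \<in> carrier X\<rbrakk> \<Longrightarrow>
      boxtimes K A M X f g (pure_tensor K A M X m x) =
        pure_tensor K A M X (f m) x \<oplus>\<^bsub>tensor K A M X\<^esub> pure_tensor K A M X m (g x)"
proof -
  interpret X: tensor_product K A M X by (rule tensor_productI[OF X])
  have "balanced K A M X (tensor K A M X) (\<lambda>m x.
      pure_tensor K A M X (f m) x \<oplus>\<^bsub>tensor K A M X\<^esub> pure_tensor K A M X m (g x))"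
    unfolding balanced_def
  proof (intro conjI)
    \<comment> \<open>A scalar is also an element of \<open>A\<close>, so both linearity over
      \<open>K\<close> and the delta-rule apply to it. Only linearity is used here, which keeps
      \<open>\<delta>\<close> out of the computation.\<close>
    show "\<forall>r\<in>carrier K. \<forall>m\<in>carrier M. \<forall>x\<in>carrier X.
      pure_tensor K A M X (f ((r \<odot>\<^bsub>A\<^esub> \<one>\<^bsub>A\<^esub>) \<odot>\<^bsub>M\<^esub> m)) x
        \<oplus>\<^bsub>tensor K A M X\<^esub> pure_tensor K A M X ((r \<odot>\<^bsub>A\<^esub> \<one>\<^bsub>A\<^esub>) \<odot>\<^bsub>M\<^esub> m) (g x) =
      r \<odot>\<^bsub>tensor K A M X\<^esub> (pure_tensor K A M X (f m) x
        \<oplus>\<^bsub>tensor K A M X\<^esub> pure_tensor K A M X m (g x))"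
      by (simp add: f_props(1,3) left_op_props(1)[OF g] X.pure_closed X.pure_scalar
          X.T.smult_r_distr)
  qed (simp_all add: f_props left_op_props[OF g] delta_closed X.pure_closed X.pure_add_left
        X.pure_add_right X.pure_balance RM.smult_closed X.LN.smult_closed X.T.M.a_ac)
  from X.tensor_lift_hom[OF X.tensor_left_module this] X.tensor_lift_pure[OF X.tensor_left_module this]
  show "boxtimes K A M X f g \<in> mod_hom K (tensor K A M X) (tensor K A M X)"
    "\<And>m x. \<lbrakk>m \<in> carrier M; x \<in> carrier X\<rbrakk> \<Longrightarrow>
      boxtimes K A M X f g (pure_tensor K A M X m x) =
        pure_tensor K A M X (f m) x \<oplus>\<^bsub>tensor K A M X\<^esub> pure_tensor K A M X m (g x)"
    by (auto simp: boxtimes_def)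
qed

text \<open>The \<open>\<delta>\<close>-terms cancel, so the failure of \<open>\<phi>\<close> to commute with \<open>\<delta>\<close>-operators is linear.\<close>

lemma delta_defect_hom:
  assumes X: "left_module A X" and Y: "left_module A Y" and g: "left_delta_operator K A \<delta> X g"
    and g': "left_delta_operator K A \<delta> Y g'" and \<phi>: "\<phi> \<in> mod_hom A X Y"
  shows "(\<lambda>x. \<phi> (g x) \<ominus>\<^bsub>Y\<^esub> g' (\<phi> x)) \<in> mod_hom A X Y"
proof -
  interpret X: left_module A X by fact
  interpret Y: left_module A Y by fact
  note cl = mod_hom_closed[OF \<phi>] left_op_props[OF g] left_op_props[OF g'] X.smult_closed
    Y.smult_closed delta_closed
  show ?thesis
  proof (rule mod_homI)
    fix r x assume r: "r \<in> carrier A" and x: "x \<in> carrier X"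
    have "\<phi> (g (r \<odot>\<^bsub>X\<^esub> x)) \<ominus>\<^bsub>Y\<^esub> g' (\<phi> (r \<odot>\<^bsub>X\<^esub> x)) =
        (\<delta> r \<odot>\<^bsub>Y\<^esub> \<phi> x \<oplus>\<^bsub>Y\<^esub> r \<odot>\<^bsub>Y\<^esub> \<phi> (g x)) \<ominus>\<^bsub>Y\<^esub>
        (\<delta> r \<odot>\<^bsub>Y\<^esub> \<phi> x \<oplus>\<^bsub>Y\<^esub> r \<odot>\<^bsub>Y\<^esub> g' (\<phi> x))"
      using r x by (simp add: cl mod_hom_add[OF \<phi>] mod_hom_smult[OF \<phi>])
    also have "\<dots> = r \<odot>\<^bsub>Y\<^esub> \<phi> (g x) \<ominus>\<^bsub>Y\<^esub> r \<odot>\<^bsub>Y\<^esub> g' (\<phi> x)"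
      using r x by (simp add: cl Y.M.add_diff_add) (simp add: cl Y.M.minus_eq Y.M.r_neg)
    finally show "\<phi> (g (r \<odot>\<^bsub>X\<^esub> x)) \<ominus>\<^bsub>Y\<^esub> g' (\<phi> (r \<odot>\<^bsub>X\<^esub> x)) =
        r \<odot>\<^bsub>Y\<^esub> (\<phi> (g x) \<ominus>\<^bsub>Y\<^esub> g' (\<phi> x))"
      using r x by (simp add: cl Y.smult_r_diff)
  qed (auto simp: cl mod_hom_add[OF \<phi>] Y.M.add_diff_add)
qed

text \<open>On a pure tensor the terms with \<open>f\<close> agree on both sides, and what remains
  is the equation \<open>eq\<close> tensored with \<open>m\<close>. It serves twice: with a
  differential as \<open>\<phi>\<close> and \<open>\<theta>\<close> zero it gives a chain map, and
  with a comparison map as \<open>\<phi>\<close> and its defect as \<open>\<theta>\<close> it gives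
  the square on homology.\<close>

lemma boxtimes_square:
  assumes X: "left_module A X" and Y: "left_module A Y" and g: "left_delta_operator K A \<delta> X g"
    and g': "left_delta_operator K A \<delta> Y g'" and \<phi>: "\<phi> \<in> mod_hom A X Y"
    and \<theta>: "\<theta> \<in> mod_hom A X Y" and eq: "\<And>x. x \<in> carrier X \<Longrightarrow> \<phi> (g x) = g' (\<phi> x) \<oplus>\<^bsub>Y\<^esub> \<theta> x"
    and t: "t \<in> carrier (tensor K A M X)"
  shows "tensor_map K A M X Y \<phi> (boxtimes K A M X f g t) =
    boxtimes K A M Y f g' (tensor_map K A M X Y \<phi> t) \<oplus>\<^bsub>tensor K A M Y\<^esub> tensor_map K A M X Y \<theta> t"
proof -
  interpret X: tensor_product K A M X by (rule tensor_productI[OF X])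
  interpret Y: tensor_product K A M Y by (rule tensor_productI[OF Y])
  note T\<phi> = tensor_map_hom[OF X Y \<phi>]
  show ?thesis
  proof (rule X.tensor_hom_eqI[OF Y.tensor_left_module mod_hom_comp[OF boxtimes_hom[OF X g] T\<phi>]
          mod_hom_plus[OF Y.tensor_left_module mod_hom_comp[OF T\<phi> boxtimes_hom[OF Y g']]
            tensor_map_hom[OF X Y \<theta>]] _ t])
    fix m x assume "m \<in> carrier M" "x \<in> carrier X"
    then show "tensor_map K A M X Y \<phi> (boxtimes K A M X f g (pure_tensor K A M X m x)) =
      boxtimes K A M Y f g' (tensor_map K A M X Y \<phi> (pure_tensor K A M X m x))
        \<oplus>\<^bsub>tensor K A M Y\<^esub> tensor_map K A M X Y \<theta> (pure_tensor K A M X m x)"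
      by (simp add: boxtimes_pure[OF X g] boxtimes_pure[OF Y g'] tensor_map_pure[OF X Y \<phi>]
          tensor_map_pure[OF X Y \<theta>] mod_hom_add[OF T\<phi>] X.pure_closed Y.pure_closed f_props
          left_op_props[OF g] left_op_props[OF g'] mod_hom_closed[OF \<phi>] mod_hom_closed[OF \<theta>] eq
          Y.pure_add_right Y.T.M.a_assoc)
  qed
qed

end

section \<open>Homology\<close>

text \<open>Only the addition enters into a coset, so classes formed inside the module of cycles are
  cosets in \<open>C n\<close> itself.\<close>

lemma a_r_coset_carrier_update [simp]: "U +>\<^bsub>X\<lparr>carrier := S\<rparr>\<^esub> x = U +>\<^bsub>X\<^esub> x"
  by (simp add: a_r_coset_def')

locale chain_complex =
  fixes K :: "('k, 'z) ring_scheme" and C :: "nat \<Rightarrow> ('k, 'c) module" and d :: "nat \<Rightarrow> 'c \<Rightarrow> 'c"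
  assumes C_module: "left_module K (C i)"
    and d_hom: "d (Suc i) \<in> mod_hom K (C (Suc i)) (C i)"
    and d_d: "x \<in> carrier (C (Suc (Suc i))) \<Longrightarrow> d (Suc i) (d (Suc (Suc i)) x) = \<zero>\<^bsub>C i\<^esub>"
begin

sublocale C: left_module K "C i" for i by (rule C_module)

lemma cycles_submodule: "submodule (cycles C d n) K (C n)"
proof (cases n)
  case 0
  then show ?thesis
    by (auto simp: cycles_def intro!: C.submoduleI C.smult_closed)
next
  case (Suc i)
  then show ?thesis
    using submodule_kernel[OF C_module C_module d_hom] by (simp add: cycles_def)
qed

lemma cycles_closed: "z \<in> cycles C d n \<Longrightarrow> z \<in> carrier (C n)"
  using submodule_sub[OF cycles_submodule] by blast

lemma boundaries_subset: "boundaries C d n \<subseteq> cycles C d n"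
  by (cases n) (auto simp: boundaries_def cycles_def d_d mod_hom_closed[OF d_hom])

lemma cycles_module: "left_module K ((C n)\<lparr>carrier := cycles C d n\<rparr>)"
  by (rule C.submodule_is_left_module[OF cycles_submodule])

sublocale H: quotient_setting K "(C n)\<lparr>carrier := cycles C d n\<rparr>" "boundaries C d n" for n
proof (intro quotient_setting.intro quotient_setting_axioms.intro cycles_module)
  have "submodule (boundaries C d n) K (C n)"
    unfolding boundaries_def by (rule submodule_image[OF C_module C_module d_hom])
  then show "submodule (boundaries C d n) K ((C n)\<lparr>carrier := cycles C d n\<rparr>)"
    using boundaries_subset submodule_zero submodule_add submodule_smult
    by (intro left_module.submoduleI[OF cycles_module]) fastforce+
qed

abbreviation hclass :: "nat \<Rightarrow> 'c \<Rightarrow> 'c set" where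
  "hclass n z \<equiv> boundaries C d n +>\<^bsub>C n\<^esub> z"

lemma homology_carrier: "Z \<in> carrier (homology C d n) \<longleftrightarrow> (\<exists>z\<in>cycles C d n. Z = hclass n z)"
  using H.carrier_quotient by (simp add: homology_def)

lemma hclass_memE:
  assumes "w \<in> hclass n z"
  obtains y where "y \<in> carrier (C (Suc n))" "w = d (Suc n) y \<oplus>\<^bsub>C n\<^esub> z"
  using assms by (auto simp: a_r_coset_def' boundaries_def)

lemma hclass_eqI:
  assumes "z \<in> cycles C d n" "y \<in> carrier (C (Suc n))"
  shows "hclass n (d (Suc n) y \<oplus>\<^bsub>C n\<^esub> z) = hclass n z"
proof -
  have "d (Suc n) y \<oplus>\<^bsub>C n\<^esub> z \<in> hclass n z"
    using assms(2) by (auto simp: a_r_coset_def' boundaries_def)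
  then show ?thesis
    using H.coset_memE(2)[of z n "d (Suc n) y \<oplus>\<^bsub>C n\<^esub> z"] assms(1) by simp
qed

lemma hclass_add:
  "\<lbrakk>z \<in> cycles C d n; w \<in> cycles C d n\<rbrakk> \<Longrightarrow>
    hclass n z \<oplus>\<^bsub>homology C d n\<^esub> hclass n w = hclass n (z \<oplus>\<^bsub>C n\<^esub> w)"
  using H.coset_add[of z n w] by (simp add: homology_def)

lemma hclass_smult:
  "\<lbrakk>r \<in> carrier K; z \<in> cycles C d n\<rbrakk> \<Longrightarrow> r \<odot>\<^bsub>homology C d n\<^esub> hclass n z = hclass n (r \<odot>\<^bsub>C n\<^esub> z)"
  using H.coset_smult[of r z n] by (simp add: homology_def)

end

section \<open>Chain maps and the maps they induce on homology\<close>

locale chain_map = C: chain_complex K C d + C': chain_complex K C' d'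
  for K :: "('k, 'z) ring_scheme" and C :: "nat \<Rightarrow> ('k, 'c) module" and d
    and C' :: "nat \<Rightarrow> ('k, 'e) module" and d' +
  fixes u :: "nat \<Rightarrow> 'c \<Rightarrow> 'e"
  assumes u_hom: "u i \<in> mod_hom K (C i) (C' i)"
    and u_d: "x \<in> carrier (C (Suc i)) \<Longrightarrow> d' (Suc i) (u (Suc i) x) = u i (d (Suc i) x)"
begin

lemma u_cycles: "z \<in> cycles C d n \<Longrightarrow> u n z \<in> cycles C' d' n"
  using mod_hom_closed[OF u_hom] u_d mod_hom_zero[OF C.C_module C'.C_module u_hom]
  by (cases n) (auto simp: cycles_def)

text \<open>A change of representative by a boundary changes its image by a boundary, so the union
  that defines \<open>homology_map\<close> is over copies of one class.\<close>

lemma homology_map_class: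
  assumes z: "z \<in> cycles C d n"
  shows "homology_map C' d' u n (C.hclass n z) = C'.hclass n (u n z)"
proof -
  have "C'.hclass n (u n w) = C'.hclass n (u n z)" if "w \<in> C.hclass n z" for w
  proof -
    obtain y where y: "y \<in> carrier (C (Suc n))" "w = d (Suc n) y \<oplus>\<^bsub>C n\<^esub> z"
      using \<open>w \<in> C.hclass n z\<close> by (rule C.hclass_memE)
    then have "u n w = d' (Suc n) (u (Suc n) y) \<oplus>\<^bsub>C' n\<^esub> u n z"
      using C.cycles_closed[OF z] mod_hom_closed[OF C.d_hom y(1)]
      by (simp add: mod_hom_add[OF u_hom] u_d)
    then show ?thesis
      using C'.hclass_eqI[OF u_cycles[OF z]] mod_hom_closed[OF u_hom y(1)] by simp
  qed
  then show ?thesis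
    using C.H.coset_UN_eq[of z n "\<lambda>w. C'.hclass n (u n w)" "C'.hclass n (u n z)"] z
    by (simp add: homology_map_def)
qed

lemma homology_map_hom: "homology_map C' d' u n \<in> mod_hom K (homology C d n) (homology C' d' n)"
proof (rule mod_homI)
  note sub = C.cycles_submodule[of n]
  show "homology_map C' d' u n Z \<in> carrier (homology C' d' n)"
    if "Z \<in> carrier (homology C d n)" for Z
    using that by (auto simp: C.homology_carrier C'.homology_carrier homology_map_class u_cycles)
  show "homology_map C' d' u n (Z \<oplus>\<^bsub>homology C d n\<^esub> W) =
      homology_map C' d' u n Z \<oplus>\<^bsub>homology C' d' n\<^esub> homology_map C' d' u n W"
    if "Z \<in> carrier (homology C d n)" "W \<in> carrier (homology C d n)" for Z W
    using that by (auto simp: C.homology_carrier C.hclass_add C'.hclass_add homology_map_class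
        u_cycles submodule_add[OF sub] mod_hom_add[OF u_hom] C.cycles_closed)
  show "homology_map C' d' u n (r \<odot>\<^bsub>homology C d n\<^esub> Z) =
      r \<odot>\<^bsub>homology C' d' n\<^esub> homology_map C' d' u n Z"
    if "r \<in> carrier K" "Z \<in> carrier (homology C d n)" for r Z
    using that by (auto simp: C.homology_carrier C.hclass_smult C'.hclass_smult homology_map_class
        u_cycles submodule_smult[OF sub] mod_hom_smult[OF u_hom] C.cycles_closed)
qed

end

text \<open>The criterion is pointwise: on each cycle the two maps differ by some boundary, and
  \<open>y\<close> may depend on the cycle in any way. A homotopy provides such a \<open>y\<close>,
  but need not itself be carried over to the tensored complexes as a chain homotopy.\<close>

lemma homology_map_eqI:
  assumes "chain_map K C d C' d' u" "chain_map K C d C' d' v"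
    and eq: "\<And>z. z \<in> cycles C d n \<Longrightarrow> \<exists>y\<in>carrier (C' (Suc n)). u n z = v n z \<oplus>\<^bsub>C' n\<^esub> d' (Suc n) y"
    and Z: "Z \<in> carrier (homology C d n)"
  shows "homology_map C' d' u n Z = homology_map C' d' v n Z"
proof -
  interpret u: chain_map K C d C' d' u by fact
  interpret v: chain_map K C d C' d' v by fact
  obtain z where z: "z \<in> cycles C d n" "Z = u.C.hclass n z"
    using Z by (auto simp: u.C.homology_carrier)
  obtain y where y: "y \<in> carrier (C' (Suc n))" "u n z = v n z \<oplus>\<^bsub>C' n\<^esub> d' (Suc n) y"
    using eq[OF z(1)] by blast
  have "u n z = d' (Suc n) y \<oplus>\<^bsub>C' n\<^esub> v n z"
    using y mod_hom_closed[OF u.C'.d_hom y(1)] u.C'.cycles_closed[OF v.u_cycles[OF z(1)]]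
    by (simp add: u.C'.C.M.a_comm)
  then show ?thesis
    using z y u.C'.hclass_eqI[OF v.u_cycles[OF z(1)] y(1)]
    by (simp add: u.homology_map_class v.homology_map_class)
qed

lemma chain_map_comp:
  assumes "chain_map K C d C' d' u" "chain_map K C' d' C'' d'' v"
  shows "chain_map K C d C'' d'' (\<lambda>i x. v i (u i x))"
proof -
  interpret u: chain_map K C d C' d' u by fact
  interpret v: chain_map K C' d' C'' d'' v by fact
  show ?thesis
    by unfold_locales (auto intro: mod_hom_comp[OF u.u_hom v.u_hom]
        simp: u.u_d v.u_d mod_hom_closed[OF u.u_hom])
qed

lemma homology_map_comp:
  assumes "chain_map K C d C' d' u" "chain_map K C' d' C'' d'' v" "Z \<in> carrier (homology C d n)"
  shows "homology_map C'' d'' v n (homology_map C' d' u n Z) =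
    homology_map C'' d'' (\<lambda>i x. v i (u i x)) n Z"
proof -
  interpret u: chain_map K C d C' d' u by fact
  interpret v: chain_map K C' d' C'' d'' v by fact
  interpret vu: chain_map K C d C'' d'' "\<lambda>i x. v i (u i x)" by (rule chain_map_comp[OF assms(1,2)])
  show ?thesis
    using assms(3)
    by (auto simp: u.C.homology_carrier u.homology_map_class v.homology_map_class
        vu.homology_map_class u.u_cycles)
qed

lemma homology_map_cong:
  assumes "chain_map K C d C' d' u" "chain_map K C d C' d' v"
    and eq: "\<And>z. z \<in> carrier (C n) \<Longrightarrow> u n z = v n z" and Z: "Z \<in> carrier (homology C d n)"
  shows "homology_map C' d' u n Z = homology_map C' d' v n Z"
proof -
  interpret u: chain_map K C d C' d' u by fact
  interpret v: chain_map K C d C' d' v by fact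
  show ?thesis
    using Z by (auto simp: u.C.homology_carrier u.homology_map_class v.homology_map_class eq
        u.C.cycles_closed)
qed

section \<open>Comparison of projective resolutions\<close>

locale resolution =
  fixes A :: "('a, 'z) ring_scheme" and N :: "('a, 'n) module" and Q :: "nat \<Rightarrow> ('a, 'q) module"
    and d :: "nat \<Rightarrow> 'q \<Rightarrow> 'q" and \<eta> :: "'q \<Rightarrow> 'n"
  assumes res: "projective_resolution A N Q d \<eta>" and N_module: "left_module A N"
begin

lemma proj: "projective_module A (Q i)"
  and d_hom: "d (Suc i) \<in> mod_hom A (Q (Suc i)) (Q i)"
  and \<eta>_hom: "\<eta> \<in> mod_hom A (Q 0) N"
  and \<eta>_surj: "\<eta> ` carrier (Q 0) = carrier N"
  and exact_0: "d (Suc 0) ` carrier (Q (Suc 0)) = {q \<in> carrier (Q 0). \<eta> q = \<zero>\<^bsub>N\<^esub>}"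
  and exact_Suc: "d (Suc (Suc i)) ` carrier (Q (Suc (Suc i))) =
    {q \<in> carrier (Q (Suc i)). d (Suc i) q = \<zero>\<^bsub>Q i\<^esub>}"
  using res by (auto simp: projective_resolution_def)

lemma Q_module: "left_module A (Q i)"
  by (rule projective_left_module[OF proj])

sublocale Q: left_module A "Q i" for i by (rule Q_module)

lemma \<eta>_d: "q \<in> carrier (Q (Suc 0)) \<Longrightarrow> \<eta> (d (Suc 0) q) = \<zero>\<^bsub>N\<^esub>"
  using exact_0 by blast

lemma d_d: "q \<in> carrier (Q (Suc (Suc i))) \<Longrightarrow> d (Suc i) (d (Suc (Suc i)) q) = \<zero>\<^bsub>Q i\<^esub>"
  using exact_Suc by blast

lemmas d_closed = mod_hom_closed[OF d_hom]

end

text \<open>Turns conditions for \<open>i \<ge> 1\<close> that mention \<open>i - 1\<close> into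
  conditions on \<open>Suc i\<close>, the form in which recursion and exactness are used.\<close>

lemma all_ge_1_iff: "(\<forall>i\<ge>Suc 0. R i) \<longleftrightarrow> (\<forall>i. R (Suc i))" for R :: "nat \<Rightarrow> bool"
  by (metis Suc_le_D Suc_le_mono zero_le)

lemma comparison_map_alt:
  "comparison_map A Q d \<eta> P d' \<eta>' \<phi> \<longleftrightarrow>
    (\<forall>i. \<phi> i \<in> mod_hom A (Q i) (P i)) \<and>
    (\<forall>q\<in>carrier (Q 0). \<eta>' (\<phi> 0 q) = \<eta> q) \<and>
    (\<forall>i. \<forall>q\<in>carrier (Q (Suc i)). d' (Suc i) (\<phi> (Suc i) q) = \<phi> i (d (Suc i) q))"
  by (simp add: comparison_map_def all_ge_1_iff)

lemma comparison_mapD: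
  assumes "comparison_map A Q d \<eta> P d' \<eta>' \<phi>"
  shows "\<phi> i \<in> mod_hom A (Q i) (P i)"
    and "q \<in> carrier (Q 0) \<Longrightarrow> \<eta>' (\<phi> 0 q) = \<eta> q"
    and "q \<in> carrier (Q (Suc i)) \<Longrightarrow> d' (Suc i) (\<phi> (Suc i) q) = \<phi> i (d (Suc i) q)"
  using assms unfolding comparison_map_alt by blast+

lemma comparison_map_comp:
  assumes "comparison_map A Q d \<eta> P d' \<eta>' \<phi>" "comparison_map A P d' \<eta>' Q' d'' \<eta>'' \<psi>"
  shows "comparison_map A Q d \<eta> Q' d'' \<eta>'' (\<lambda>i q. \<psi> i (\<phi> i q))"
proof -
  note \<phi> = comparison_mapD[OF assms(1)] and \<psi> = comparison_mapD[OF assms(2)]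
  show ?thesis
    unfolding comparison_map_alt
  proof (intro conjI allI ballI)
    show "(\<lambda>q. \<psi> i (\<phi> i q)) \<in> mod_hom A (Q i) (Q' i)" for i
      by (rule mod_hom_comp[OF \<phi>(1) \<psi>(1)])
    show "\<eta>'' (\<psi> 0 (\<phi> 0 q)) = \<eta> q" if "q \<in> carrier (Q 0)" for q
      using \<psi>(2)[OF mod_hom_closed[OF \<phi>(1) that]] \<phi>(2)[OF that] by (rule trans)
    show "d'' (Suc i) (\<psi> (Suc i) (\<phi> (Suc i) q)) = \<psi> i (\<phi> i (d (Suc i) q))"
      if "q \<in> carrier (Q (Suc i))" for i q
      unfolding \<psi>(3)[OF mod_hom_closed[OF \<phi>(1) that]] \<phi>(3)[OF that] ..
  qed
qed

lemma delta_lifting_alt: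
  "delta_lifting K A \<delta> g Q d \<eta> gs \<longleftrightarrow>
    (\<forall>i. left_delta_operator K A \<delta> (Q i) (gs i)) \<and>
    (\<forall>q\<in>carrier (Q 0). \<eta> (gs 0 q) = g (\<eta> q)) \<and>
    (\<forall>i. \<forall>q\<in>carrier (Q (Suc i)). d (Suc i) (gs (Suc i) q) = gs i (d (Suc i) q))"
  by (simp add: delta_lifting_def all_ge_1_iff)

lemma delta_liftingD:
  assumes "delta_lifting K A \<delta> g Q d \<eta> gs"
  shows "left_delta_operator K A \<delta> (Q i) (gs i)"
    and "q \<in> carrier (Q 0) \<Longrightarrow> \<eta> (gs 0 q) = g (\<eta> q)"
    and "q \<in> carrier (Q (Suc i)) \<Longrightarrow> d (Suc i) (gs (Suc i) q) = gs i (d (Suc i) q)"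
  using assms unfolding delta_lifting_alt by blast+

section \<open>The comparison theorem: existence of comparison maps, and null-homotopies\<close>

locale resolution_pair = Q: resolution A N Q d \<eta> + P: resolution A N P d' \<eta>'
  for A :: "('a, 'z) ring_scheme" and N :: "('a, 'n) module" and Q :: "nat \<Rightarrow> ('a, 'q) module"
    and d \<eta> and P :: "nat \<Rightarrow> ('a, 'p) module" and d' \<eta>'
begin

lemma comparison_exists: "\<exists>\<phi>. comparison_map A Q d \<eta> P d' \<eta>' \<phi>"
proof -
  \<comment> \<open>The invariant concerns a single degree: \<open>\<phi>\<close> carries boundaries
    of \<open>Q\<close> to boundaries of \<open>P\<close>, which is the inclusion that projectivity
    needs for the next map. Commutation with the differentials links two consecutive maps and is
    therefore the step relation of the dependent choice.\<close>
  define R where "R n \<phi> \<longleftrightarrow> \<phi> \<in> mod_hom A (Q n) (P n) \<and> (n = 0 \<longrightarrow> (\<forall>q\<in>carrier (Q 0). \<eta>' (\<phi> q) = \<eta> q)) \<and>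
    (\<forall>q\<in>carrier (Q (Suc n)). \<phi> (d (Suc n) q) \<in> d' (Suc n) ` carrier (P (Suc n)))"
    for n and \<phi> :: "'q \<Rightarrow> 'p"
  obtain \<phi>0 where \<phi>0: "\<phi>0 \<in> mod_hom A (Q 0) (P 0)" "\<And>q. q \<in> carrier (Q 0) \<Longrightarrow> \<eta>' (\<phi>0 q) = \<eta> q"
    using projective_lift[OF Q.proj P.Q_module P.N_module P.\<eta>_hom Q.\<eta>_hom]
      Q.\<eta>_surj P.\<eta>_surj by blast
  have "\<exists>\<phi>. R 0 \<phi>"
    using \<phi>0 Q.d_closed mod_hom_closed[OF \<phi>0(1)] Q.\<eta>_d
    by (intro exI[of _ \<phi>0]) (simp add: R_def P.exact_0)
  moreover have "\<exists>\<phi>'. R (Suc n) \<phi>' \<and> (\<forall>q\<in>carrier (Q (Suc n)). d' (Suc n) (\<phi>' q) = \<phi> (d (Suc n) q))"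
    if R: "R n \<phi>" for n \<phi>
  proof -
    have \<phi>: "\<phi> \<in> mod_hom A (Q n) (P n)"
      using R by (simp add: R_def)
    have "(\<lambda>q. \<phi> (d (Suc n) q)) ` carrier (Q (Suc n)) \<subseteq> d' (Suc n) ` carrier (P (Suc n))"
      using R by (auto simp: R_def)
    then obtain \<phi>' where \<phi>': "\<phi>' \<in> mod_hom A (Q (Suc n)) (P (Suc n))"
        "\<And>q. q \<in> carrier (Q (Suc n)) \<Longrightarrow> d' (Suc n) (\<phi>' q) = \<phi> (d (Suc n) q)"
      using projective_lift[OF Q.proj P.Q_module P.Q_module P.d_hom mod_hom_comp[OF Q.d_hom \<phi>]] by blast
    \<comment> \<open>On a boundary \<open>d q\<close> the differential of \<phi>'(d q) is \<phi>(d
      (d q)), hence zero; exactness of \<open>P\<close> makes \<phi>'(d q) a boundary.\<close>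
    then have "R (Suc n) \<phi>'"
      using Q.d_closed mod_hom_closed[OF \<phi>'(1)] mod_hom_zero[OF Q.Q_module P.Q_module \<phi>]
      by (simp add: R_def P.exact_Suc Q.d_d)
    then show ?thesis
      using \<phi>' by blast
  qed
  ultimately obtain \<phi> where \<phi>: "\<And>n. R n (\<phi> n) \<and>
      (\<forall>q\<in>carrier (Q (Suc n)). d' (Suc n) (\<phi> (Suc n) q) = \<phi> n (d (Suc n) q))"
    using dependent_nat_choice[of R "\<lambda>n \<phi> \<phi>'. \<forall>q\<in>carrier (Q (Suc n)). d' (Suc n) (\<phi>' q) = \<phi> (d (Suc n) q)"]
    by blast
  then show ?thesis
    unfolding comparison_map_alt by (metis R_def)
qed

lemma null_homotopic:
  assumes \<theta>: "\<And>i. \<theta> i \<in> mod_hom A (Q i) (P i)"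
    and \<theta>0: "\<And>q. q \<in> carrier (Q 0) \<Longrightarrow> \<eta>' (\<theta> 0 q) = \<zero>\<^bsub>N\<^esub>"
    and \<theta>d: "\<And>i q. q \<in> carrier (Q (Suc i)) \<Longrightarrow> d' (Suc i) (\<theta> (Suc i) q) = \<theta> i (d (Suc i) q)"
  obtains s where "\<And>i. s i \<in> mod_hom A (Q i) (P (Suc i))"
    "\<And>q. q \<in> carrier (Q 0) \<Longrightarrow> \<theta> 0 q = d' (Suc 0) (s 0 q)"
    "\<And>i q. q \<in> carrier (Q (Suc i)) \<Longrightarrow>
      \<theta> (Suc i) q = d' (Suc (Suc i)) (s (Suc i) q) \<oplus>\<^bsub>P (Suc i)\<^esub> s i (d (Suc i) q)"
proof -
  note \<theta>cl = mod_hom_closed[OF \<theta>]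
  \<comment> \<open>The part of \<open>\<theta>\<close> in degree n + 1 that is not accounted for by
    \<open>s\<close> in degree n; the next homotopy map is a lift of it along the differential of
    \<open>P\<close>.\<close>
  define r where "r n s q = \<theta> (Suc n) q \<ominus>\<^bsub>P (Suc n)\<^esub> s (d (Suc n) q)" for n and s :: "'q \<Rightarrow> 'p" and q
  \<comment> \<open>The last clause is the homotopy equation restricted to boundaries, where the
    term with the preceding homotopy map disappears because \<open>d\<close> composed with
    \<open>d\<close> is zero. The invariant thus mentions one map only, as the dependent choice
    requires.\<close>
  define R where "R n s \<longleftrightarrow> s \<in> mod_hom A (Q n) (P (Suc n)) \<and>
      (n = 0 \<longrightarrow> (\<forall>q\<in>carrier (Q 0). \<theta> 0 q = d' (Suc 0) (s q))) \<and>
      (\<forall>q\<in>carrier (Q (Suc n)). d' (Suc n) (s (d (Suc n) q)) = \<theta> n (d (Suc n) q))"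
    for n and s :: "'q \<Rightarrow> 'p"
  have "\<theta> 0 ` carrier (Q 0) \<subseteq> d' (Suc 0) ` carrier (P (Suc 0))"
    using \<theta>0 \<theta>cl by (auto simp: P.exact_0)
  then obtain s0 where "s0 \<in> mod_hom A (Q 0) (P (Suc 0))"
      "\<And>q. q \<in> carrier (Q 0) \<Longrightarrow> d' (Suc 0) (s0 q) = \<theta> 0 q"
    using projective_lift[OF Q.proj P.Q_module P.Q_module P.d_hom \<theta>] by blast
  then have "\<exists>s. R 0 s"
    using Q.d_closed by (intro exI[of _ s0]) (simp add: R_def)
  moreover have "\<exists>s'. R (Suc n) s' \<and> (\<forall>q\<in>carrier (Q (Suc n)).
      \<theta> (Suc n) q = d' (Suc (Suc n)) (s' q) \<oplus>\<^bsub>P (Suc n)\<^esub> s (d (Suc n) q))"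
    if R: "R n s" for n s
  proof -
    have s: "s \<in> mod_hom A (Q n) (P (Suc n))"
      and sd: "\<And>q. q \<in> carrier (Q (Suc n)) \<Longrightarrow> d' (Suc n) (s (d (Suc n) q)) = \<theta> n (d (Suc n) q)"
      using R by (auto simp: R_def)
    note scl = mod_hom_closed[OF s]
    have r: "r n s \<in> mod_hom A (Q (Suc n)) (P (Suc n))"
      unfolding r_def by (rule mod_hom_diff[OF P.Q_module \<theta> mod_hom_comp[OF Q.d_hom s]])
    \<comment> \<open>Both \<theta>(q) and s(d q) have the differential \<theta>(d q): the former
      since \<open>\<theta>\<close> is a chain map, the latter by the invariant. So \<open>r\<close>
      takes values in cycles, which are boundaries by exactness.\<close>
    have "d' (Suc n) (r n s q) = \<zero>\<^bsub>P n\<^esub>" if "q \<in> carrier (Q (Suc n))" for q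
      using that by (simp add: r_def mod_hom_minus[OF P.Q_module P.Q_module P.d_hom] \<theta>cl scl
          Q.d_closed \<theta>d sd P.Q.M.diff_eq_zero_iff)
    then have "r n s ` carrier (Q (Suc n)) \<subseteq> d' (Suc (Suc n)) ` carrier (P (Suc (Suc n)))"
      using mod_hom_closed[OF r] by (auto simp: P.exact_Suc)
    then obtain s' where s': "s' \<in> mod_hom A (Q (Suc n)) (P (Suc (Suc n)))"
        "\<And>q. q \<in> carrier (Q (Suc n)) \<Longrightarrow> d' (Suc (Suc n)) (s' q) = r n s q"
      using projective_lift[OF Q.proj P.Q_module P.Q_module P.d_hom r] by blast
    have "\<theta> (Suc n) q = d' (Suc (Suc n)) (s' q) \<oplus>\<^bsub>P (Suc n)\<^esub> s (d (Suc n) q)"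
      if "q \<in> carrier (Q (Suc n))" for q
      using that by (simp add: s'(2) r_def P.Q.M.a_comm P.Q.M.add_diff_cancel \<theta>cl scl Q.d_closed)
    moreover have "R (Suc n) s'"
    proof -
      \<comment> \<open>On boundaries the subtracted term is \<open>s\<close> applied to zero, so
        lifting \<open>r\<close> restores the invariant for \<open>\<theta>\<close>.\<close>
      have "r n s (d (Suc (Suc n)) q) = \<theta> (Suc n) (d (Suc (Suc n)) q)"
        if "q \<in> carrier (Q (Suc (Suc n)))" for q
        using that \<theta>cl[OF Q.d_closed[OF that]]
        by (simp add: r_def Q.d_d mod_hom_zero[OF Q.Q_module P.Q_module s] a_minus_def
            P.Q.M.minus_equality)
      then show ?thesis
        using s' Q.d_closed by (simp add: R_def)
    qed
    ultimately show ?thesis by blast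
  qed
  ultimately obtain s where s: "\<And>n. R n (s n) \<and> (\<forall>q\<in>carrier (Q (Suc n)).
      \<theta> (Suc n) q = d' (Suc (Suc n)) (s (Suc n) q) \<oplus>\<^bsub>P (Suc n)\<^esub> s n (d (Suc n) q))"
    using dependent_nat_choice[of R "\<lambda>n s s'. \<forall>q\<in>carrier (Q (Suc n)).
      \<theta> (Suc n) q = d' (Suc (Suc n)) (s' q) \<oplus>\<^bsub>P (Suc n)\<^esub> s (d (Suc n) q)"]
    by blast
  have "s n \<in> mod_hom A (Q n) (P (Suc n))" "\<And>q. q \<in> carrier (Q 0) \<Longrightarrow> \<theta> 0 q = d' (Suc 0) (s 0 q)" for n
    using s R_def by blast+
  then show ?thesis
    using that s by blast
qed

end

section \<open>Homology of tensored resolutions\<close>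

context tensor_setting
begin

abbreviation "TC \<equiv> tensor_complex K A M"
abbreviation "TD \<equiv> tensor_diff K A M"
abbreviation (input) "TM Q P \<phi> \<equiv> \<lambda>i. tensor_map K A M (Q i) (P i) (\<phi> i)"

lemma tensor_left_module: "left_module A X \<Longrightarrow> left_module K (tensor K A M X)"
  by (rule tensor_product.tensor_left_module[OF tensor_productI])

lemma tensor_chain_complex:
  assumes "resolution A N Q d \<eta>"
  shows "chain_complex K (TC Q) (TD Q d)"
proof -
  interpret Q: resolution A N Q d \<eta> by fact
  show ?thesis
  proof (rule chain_complex.intro)
    show "left_module K (TC Q i)" for i
      unfolding tensor_complex_def by (rule tensor_left_module[OF Q.Q_module])
    show "TD Q d (Suc i) \<in> mod_hom K (TC Q (Suc i)) (TC Q i)" for i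
      using tensor_map_hom[OF Q.Q_module Q.Q_module Q.d_hom]
      by (simp add: tensor_diff_def tensor_complex_def)
    show "TD Q d (Suc i) (TD Q d (Suc (Suc i)) x) = \<zero>\<^bsub>TC Q i\<^esub>" if "x \<in> carrier (TC Q (Suc (Suc i)))" for i x
      using that Q.d_d
      by (simp add: tensor_diff_def tensor_complex_def
          tensor_map_comp[OF Q.Q_module Q.Q_module Q.Q_module Q.d_hom Q.d_hom]
          tensor_map_zero[OF Q.Q_module Q.Q_module mod_hom_comp[OF Q.d_hom Q.d_hom]])
  qed
qed

lemma tensor_chain_map:
  assumes "resolution_pair A N Q d \<eta> P d' \<eta>'" and \<phi>: "\<And>i. \<phi> i \<in> mod_hom A (Q i) (P i)"
    and \<phi>d: "\<And>i q. q \<in> carrier (Q (Suc i)) \<Longrightarrow> d' (Suc i) (\<phi> (Suc i) q) = \<phi> i (d (Suc i) q)"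
  shows "chain_map K (TC Q) (TD Q d) (TC P) (TD P d') (TM Q P \<phi>)"
proof -
  interpret resolution_pair A N Q d \<eta> P d' \<eta>' by fact
  show ?thesis
  proof (intro chain_map.intro chain_map_axioms.intro tensor_chain_complex)
    show "resolution A N Q d \<eta>" "resolution A N P d' \<eta>'" by unfold_locales
    show "TM Q P \<phi> i \<in> mod_hom K (TC Q i) (TC P i)" for i
      unfolding tensor_complex_def by (rule tensor_map_hom[OF Q.Q_module P.Q_module \<phi>])
    fix i x assume x: "x \<in> carrier (TC Q (Suc i))"
    have "tensor_map K A M (Q (Suc i)) (P i) (\<lambda>q. d' (Suc i) (\<phi> (Suc i) q)) x =
        tensor_map K A M (Q (Suc i)) (P i) (\<lambda>q. \<phi> i (d (Suc i) q)) x"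
      using x by (intro tensor_map_cong Q.Q_module P.Q_module mod_hom_comp[OF \<phi> P.d_hom]
          mod_hom_comp[OF Q.d_hom \<phi>] \<phi>d) (simp_all add: tensor_complex_def)
    then show "TD P d' (Suc i) (TM Q P \<phi> (Suc i) x) = TM Q P \<phi> i (TD Q d (Suc i) x)"
      using x by (simp add: tensor_diff_def tensor_complex_def
          tensor_map_comp[OF Q.Q_module P.Q_module P.Q_module \<phi> P.d_hom]
          tensor_map_comp[OF Q.Q_module Q.Q_module P.Q_module Q.d_hom \<phi>])
  qed
qed

text \<open>The homotopy writes \<open>\<theta>\<close> as d' s + s d, and this survives tensoring
  with \<open>M\<close>. On a cycle the second term vanishes, so the image of \<open>z\<close> is
  the boundary of its image under \<open>s\<close>; in degree 0 there is no second term at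
  all.\<close>

lemma tensor_null_homotopic:
  assumes "resolution_pair A N Q d \<eta> P d' \<eta>'" and \<theta>: "\<And>i. \<theta> i \<in> mod_hom A (Q i) (P i)"
    and \<theta>0: "\<And>q. q \<in> carrier (Q 0) \<Longrightarrow> \<eta>' (\<theta> 0 q) = \<zero>\<^bsub>N\<^esub>"
    and \<theta>d: "\<And>i q. q \<in> carrier (Q (Suc i)) \<Longrightarrow> d' (Suc i) (\<theta> (Suc i) q) = \<theta> i (d (Suc i) q)"
    and z: "z \<in> cycles (TC Q) (TD Q d) n"
  shows "\<exists>y\<in>carrier (TC P (Suc n)). TM Q P \<theta> n z = TD P d' (Suc n) y"
proof -
  interpret resolution_pair A N Q d \<eta> P d' \<eta>' by fact
  interpret TQ: chain_complex K "TC Q" "TD Q d" by (rule tensor_chain_complex) unfold_locales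
  interpret TP: chain_complex K "TC P" "TD P d'" by (rule tensor_chain_complex) unfold_locales
  obtain s where s: "\<And>i. s i \<in> mod_hom A (Q i) (P (Suc i))"
    and s0: "\<And>q. q \<in> carrier (Q 0) \<Longrightarrow> \<theta> 0 q = d' (Suc 0) (s 0 q)"
    and sS: "\<And>i q. q \<in> carrier (Q (Suc i)) \<Longrightarrow>
      \<theta> (Suc i) q = d' (Suc (Suc i)) (s (Suc i) q) \<oplus>\<^bsub>P (Suc i)\<^esub> s i (d (Suc i) q)"
    using null_homotopic[OF \<theta> \<theta>0 \<theta>d] by blast
  define y where "y = tensor_map K A M (Q n) (P (Suc n)) (s n) z"
  have zc: "z \<in> carrier (tensor K A M (Q n))"
    using TQ.cycles_closed[OF z] by (simp add: tensor_complex_def)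
  have Ts: "tensor_map K A M (Q i) (P (Suc i)) (s i) \<in> mod_hom K (tensor K A M (Q i)) (tensor K A M (P (Suc i)))" for i
    by (rule tensor_map_hom[OF Q.Q_module P.Q_module s])
  have y: "y \<in> carrier (TC P (Suc n))"
    unfolding y_def tensor_complex_def by (rule mod_hom_closed[OF Ts zc])
  have dy: "TD P d' (Suc n) y = tensor_map K A M (Q n) (P n) (\<lambda>q. d' (Suc n) (s n q)) z"
    by (simp add: y_def tensor_diff_def tensor_map_comp[OF Q.Q_module P.Q_module P.Q_module s P.d_hom zc])
  have "TM Q P \<theta> n z = TD P d' (Suc n) y"
  proof (cases n)
    case 0
    then show ?thesis
      using tensor_map_cong[OF Q.Q_module P.Q_module \<theta> mod_hom_comp[OF s P.d_hom], of 0 z] s0 zc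
      unfolding dy by simp
  next
    case (Suc i)
    \<comment> \<open>In positive degree the cycle condition is what removes the term s d.\<close>
    have dz: "TD Q d (Suc i) z = \<zero>\<^bsub>tensor K A M (Q i)\<^esub>"
      using z Suc by (simp add: cycles_def tensor_complex_def)
    have "tensor_map K A M (Q n) (P n) (\<lambda>q. s i (d (Suc i) q)) z =
        tensor_map K A M (Q i) (P n) (s i) (TD Q d (Suc i) z)"
      using zc Suc by (simp add: tensor_diff_def
          tensor_map_comp[OF Q.Q_module Q.Q_module P.Q_module Q.d_hom s])
    also have "\<dots> = \<zero>\<^bsub>TC P n\<^esub>"
      using mod_hom_zero[OF tensor_left_module[OF Q.Q_module] tensor_left_module[OF P.Q_module] Ts] Suc dz
      by (simp add: tensor_complex_def)
    finally have "tensor_map K A M (Q n) (P n) (\<lambda>q. s i (d (Suc i) q)) z = \<zero>\<^bsub>TC P n\<^esub>" .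
    moreover have "TM Q P \<theta> n z = TD P d' (Suc n) y \<oplus>\<^bsub>TC P n\<^esub>
        tensor_map K A M (Q n) (P n) (\<lambda>q. s i (d (Suc i) q)) z"
      unfolding dy using Suc zc sS
      by (simp add: tensor_complex_def, intro tensor_map_add[OF Q.Q_module P.Q_module \<theta>
            mod_hom_comp[OF s P.d_hom] mod_hom_comp[OF Q.d_hom s]]) auto
    ultimately show ?thesis
      using mod_hom_closed[OF TP.d_hom y] by simp
  qed
  then show ?thesis
    using y by blast
qed

lemma comparison_chain_map:
  assumes "resolution_pair A N Q d \<eta> P d' \<eta>'" "comparison_map A Q d \<eta> P d' \<eta>' \<phi>"
  shows "chain_map K (TC Q) (TD Q d) (TC P) (TD P d') (TM Q P \<phi>)"
  using assms by (intro tensor_chain_map) (auto simp: comparison_mapD)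

text \<open>The difference of two comparison maps is a linear chain map that is zero over
  \<open>N\<close>, so it sends cycles to boundaries after tensoring. Hence the choice made in
  \<open>tor_iso\<close> has no influence on the map.\<close>

lemma comparison_homology_unique:
  assumes RP: "resolution_pair A N Q d \<eta> P d' \<eta>'" and \<phi>: "comparison_map A Q d \<eta> P d' \<eta>' \<phi>"
    and \<psi>: "comparison_map A Q d \<eta> P d' \<eta>' \<psi>" and Z: "Z \<in> carrier (tensor_homology K A M Q d n)"
  shows "homology_map (TC P) (TD P d') (TM Q P \<phi>) n Z = homology_map (TC P) (TD P d') (TM Q P \<psi>) n Z"
proof (rule homology_map_eqI[OF comparison_chain_map[OF RP \<phi>] comparison_chain_map[OF RP \<psi>]])
  interpret resolution_pair A N Q d \<eta> P d' \<eta>' by fact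
  interpret N: left_module A N by (rule Q.N_module)
  fix z assume z: "z \<in> cycles (TC Q) (TD Q d) n"
  define \<theta> where "\<theta> i q = \<phi> i q \<ominus>\<^bsub>P i\<^esub> \<psi> i q" for i q
  note hom = comparison_mapD(1)[OF \<phi>] comparison_mapD(1)[OF \<psi>]
  note cl = mod_hom_closed[OF hom(1)] mod_hom_closed[OF hom(2)]
  have \<theta>: "\<theta> i \<in> mod_hom A (Q i) (P i)" for i
    unfolding \<theta>_def by (rule mod_hom_diff[OF P.Q_module hom])
  have "\<exists>y\<in>carrier (TC P (Suc n)). TM Q P \<theta> n z = TD P d' (Suc n) y"
  proof (rule tensor_null_homotopic[OF RP \<theta> _ _ z])
    show "\<eta>' (\<theta> 0 q) = \<zero>\<^bsub>N\<^esub>" if "q \<in> carrier (Q 0)" for q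
      using that mod_hom_closed[OF Q.\<eta>_hom that]
      by (simp add: \<theta>_def mod_hom_minus[OF P.Q_module P.N_module P.\<eta>_hom] cl
          comparison_mapD(2)[OF \<phi>] comparison_mapD(2)[OF \<psi>] N.M.diff_eq_zero_iff)
    show "d' (Suc i) (\<theta> (Suc i) q) = \<theta> i (d (Suc i) q)" if "q \<in> carrier (Q (Suc i))" for i q
      using that
      by (simp add: \<theta>_def mod_hom_minus[OF P.Q_module P.Q_module P.d_hom] cl
          comparison_mapD(3)[OF \<phi>] comparison_mapD(3)[OF \<psi>])
  qed
  moreover have "TM Q P \<phi> n z = TM Q P \<psi> n z \<oplus>\<^bsub>TC P n\<^esub> TM Q P \<theta> n z"
    unfolding tensor_complex_def
    using chain_complex.cycles_closed[OF tensor_chain_complex z] Q.resolution_axioms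
    by (intro tensor_map_add[OF Q.Q_module P.Q_module hom \<theta>])
      (simp_all add: \<theta>_def P.Q.M.add_diff_cancel cl tensor_complex_def)
  ultimately show "\<exists>y\<in>carrier (TC P (Suc n)).
      TM Q P \<phi> n z = TM Q P \<psi> n z \<oplus>\<^bsub>TC P n\<^esub> TD P d' (Suc n) y"
    by metis
qed (use Z in \<open>simp add: tensor_homology_def\<close>)

text \<open>The identity is a comparison map from \<open>Q\<close> to itself, and all of these agree
  on homology.\<close>

lemma comparison_homology_id:
  assumes R: "resolution A N Q d \<eta>" and \<phi>: "comparison_map A Q d \<eta> Q d \<eta> \<phi>"
    and Z: "Z \<in> carrier (tensor_homology K A M Q d n)"
  shows "homology_map (TC Q) (TD Q d) (TM Q Q \<phi>) n Z = Z"
proof -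
  interpret Q: resolution A N Q d \<eta> by fact
  interpret RP: resolution_pair A N Q d \<eta> Q d \<eta> by unfold_locales
  have id: "comparison_map A Q d \<eta> Q d \<eta> (\<lambda>i q. q)"
    by (simp add: comparison_map_alt mod_hom_id)
  interpret I: chain_map K "TC Q" "TD Q d" "TC Q" "TD Q d" "TM Q Q (\<lambda>i q. q)"
    by (rule comparison_chain_map[OF RP.resolution_pair_axioms id])
  obtain z where z: "z \<in> cycles (TC Q) (TD Q d) n" "Z = I.C.hclass n z"
    using Z by (auto simp: tensor_homology_def I.C.homology_carrier)
  have "tensor_map K A M (Q n) (Q n) (\<lambda>q. q) z = z"
    using I.C.cycles_closed[OF z(1)] by (intro tensor_map_id Q.Q_module) (simp add: tensor_complex_def)
  then show ?thesis
    unfolding comparison_homology_unique[OF RP.resolution_pair_axioms \<phi> id Z]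
    using I.homology_map_class[OF z(1)] z(2) by simp
qed

text \<open>The composite of comparison maps there and back is a comparison map from
  \<open>Q\<close> to itself, hence the identity on homology.\<close>

lemma comparison_homology_inverse:
  assumes RP: "resolution_pair A N Q d \<eta> P d' \<eta>'" and \<phi>: "comparison_map A Q d \<eta> P d' \<eta>' \<phi>"
    and \<psi>: "comparison_map A P d' \<eta>' Q d \<eta> \<psi>" and Z: "Z \<in> carrier (tensor_homology K A M Q d n)"
  shows "homology_map (TC Q) (TD Q d) (TM P Q \<psi>) n (homology_map (TC P) (TD P d') (TM Q P \<phi>) n Z) = Z"
proof -
  interpret resolution_pair A N Q d \<eta> P d' \<eta>' by fact
  interpret PQ: resolution_pair A N P d' \<eta>' Q d \<eta> by unfold_locales
  interpret QQ: resolution_pair A N Q d \<eta> Q d \<eta> by unfold_locales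
  note \<phi>\<psi> = comparison_map_comp[OF \<phi> \<psi>]
  note cm = comparison_chain_map[OF RP \<phi>] comparison_chain_map[OF PQ.resolution_pair_axioms \<psi>]
    comparison_chain_map[OF QQ.resolution_pair_axioms \<phi>\<psi>]
  note hom = comparison_mapD(1)[OF \<phi>] comparison_mapD(1)[OF \<psi>]
  have Z': "Z \<in> carrier (homology (TC Q) (TD Q d) n)"
    using Z by (simp add: tensor_homology_def)
  have "homology_map (TC Q) (TD Q d) (\<lambda>i z. TM P Q \<psi> i (TM Q P \<phi> i z)) n Z =
      homology_map (TC Q) (TD Q d) (TM Q Q (\<lambda>i q. \<psi> i (\<phi> i q))) n Z"
    by (rule homology_map_cong[OF chain_map_comp[OF cm(1,2)] cm(3) _ Z'])
      (simp add: tensor_complex_def tensor_map_comp[OF Q.Q_module P.Q_module Q.Q_module hom])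
  then show ?thesis
    unfolding homology_map_comp[OF cm(1,2) Z']
    using comparison_homology_id[OF Q.resolution_axioms \<phi>\<psi> Z] by simp
qed

lemma comparison_homology_iso:
  assumes RP: "resolution_pair A N Q d \<eta> P d' \<eta>'" and \<phi>: "comparison_map A Q d \<eta> P d' \<eta>' \<phi>"
  shows "homology_map (TC P) (TD P d') (TM Q P \<phi>) n \<in>
    mod_iso K (tensor_homology K A M Q d n) (tensor_homology K A M P d' n)"
proof -
  interpret resolution_pair A N Q d \<eta> P d' \<eta>' by fact
  interpret PQ: resolution_pair A N P d' \<eta>' Q d \<eta> by unfold_locales
  obtain \<psi> where \<psi>: "comparison_map A P d' \<eta>' Q d \<eta> \<psi>"
    using PQ.comparison_exists by blast
  have h\<phi>: "homology_map (TC P) (TD P d') (TM Q P \<phi>) n \<in>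
      mod_hom K (tensor_homology K A M Q d n) (tensor_homology K A M P d' n)"
    using chain_map.homology_map_hom[OF comparison_chain_map[OF RP \<phi>]] by (simp add: tensor_homology_def)
  have h\<psi>: "homology_map (TC Q) (TD Q d) (TM P Q \<psi>) n \<in>
      mod_hom K (tensor_homology K A M P d' n) (tensor_homology K A M Q d n)"
    using chain_map.homology_map_hom[OF comparison_chain_map[OF PQ.resolution_pair_axioms \<psi>]]
    by (simp add: tensor_homology_def)
  have "bij_betw (homology_map (TC P) (TD P d') (TM Q P \<phi>) n)
      (carrier (tensor_homology K A M Q d n)) (carrier (tensor_homology K A M P d' n))"
    using mod_hom_closed[OF h\<phi>] mod_hom_closed[OF h\<psi>] comparison_homology_inverse[OF RP \<phi> \<psi>]
      comparison_homology_inverse[OF PQ.resolution_pair_axioms \<psi> \<phi>]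
    by (intro bij_betwI[where g = "homology_map (TC Q) (TD Q d) (TM P Q \<psi>) n"]) auto
  then show ?thesis
    using h\<phi> by (simp add: mod_iso_def)
qed

end

section \<open>Delta-liftings on the homology of tensored resolutions\<close>

context derivation_setting
begin

lemma boxtimes_chain_map:
  assumes R: "resolution A N Q d \<eta>" and gs: "delta_lifting K A \<delta> g Q d \<eta> gs"
  shows "chain_map K (TC Q) (TD Q d) (TC Q) (TD Q d) (\<lambda>i. boxtimes K A M (Q i) f (gs i))"
proof -
  interpret Q: resolution A N Q d \<eta> by fact
  note gop = delta_liftingD(1)[OF gs]
  show ?thesis
  proof (intro chain_map.intro chain_map_axioms.intro tensor_chain_complex[OF R])
    show "boxtimes K A M (Q i) f (gs i) \<in> mod_hom K (TC Q i) (TC Q i)" for i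
      unfolding tensor_complex_def by (rule boxtimes_hom[OF Q.Q_module gop])
    fix i x assume x: "x \<in> carrier (TC Q (Suc i))"
    \<comment> \<open>A lifting commutes with the differentials, so the square for \<open>d\<close>
      holds with zero defect.\<close>
    let ?o = "\<lambda>_. \<zero>\<^bsub>Q i\<^esub>"
    have o: "?o \<in> mod_hom A (Q (Suc i)) (Q i)"
      by (auto intro!: mod_homI simp: Q.Q.smult_r_null)
    have dg: "d (Suc i) (gs (Suc i) q) = gs i (d (Suc i) q) \<oplus>\<^bsub>Q i\<^esub> \<zero>\<^bsub>Q i\<^esub>" if "q \<in> carrier (Q (Suc i))" for q
      using that left_op_props(1)[OF gop Q.d_closed[OF that]] by (simp add: delta_liftingD(3)[OF gs])
    interpret T: left_module K "tensor K A M (Q i)"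
      by (rule tensor_left_module[OF Q.Q_module])
    have xt: "x \<in> carrier (tensor K A M (Q (Suc i)))"
      using x by (simp add: tensor_complex_def)
    have "boxtimes K A M (Q i) f (gs i) (TD Q d (Suc i) x) \<in> carrier (tensor K A M (Q i))"
      using mod_hom_closed[OF boxtimes_hom[OF Q.Q_module gop]
          mod_hom_closed[OF tensor_map_hom[OF Q.Q_module Q.Q_module Q.d_hom] xt]]
      by (simp add: tensor_diff_def)
    then show "TD Q d (Suc i) (boxtimes K A M (Q (Suc i)) f (gs (Suc i)) x) =
        boxtimes K A M (Q i) f (gs i) (TD Q d (Suc i) x)"
      using boxtimes_square[OF Q.Q_module Q.Q_module gop gop Q.d_hom o dg xt]
        tensor_map_zero[OF Q.Q_module Q.Q_module o _ xt]
      by (simp add: tensor_diff_def)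
  qed
qed

lemma comparison_boxtimes_square:
  assumes RP: "resolution_pair A N Q d \<eta> P d' \<eta>'" and \<phi>: "comparison_map A Q d \<eta> P d' \<eta>' \<phi>"
    and gs: "delta_lifting K A \<delta> g Q d \<eta> gs" and gs': "delta_lifting K A \<delta> g P d' \<eta>' gs'"
    and g: "left_delta_operator K A \<delta> N g"
    and Z: "Z \<in> carrier (tensor_homology K A M Q d n)"
  shows "homology_map (TC P) (TD P d') (TM Q P \<phi>) n (nabla_res K A M f Q d gs n Z) =
    nabla_res K A M f P d' gs' n (homology_map (TC P) (TD P d') (TM Q P \<phi>) n Z)"
proof -
  interpret resolution_pair A N Q d \<eta> P d' \<eta>' by fact
  interpret N: left_module A N by (rule Q.N_module)
  note bQ = boxtimes_chain_map[OF Q.resolution_axioms gs]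
  note bP = boxtimes_chain_map[OF P.resolution_axioms gs']
  note c\<phi> = comparison_chain_map[OF RP \<phi>]
  note hom = comparison_mapD(1)[OF \<phi>]
  note gop = delta_liftingD(1)[OF gs] delta_liftingD(1)[OF gs']
  note cl = mod_hom_closed[OF hom] left_op_props(1)[OF gop(1)] left_op_props(1)[OF gop(2)]
    Q.d_closed P.d_closed
  define \<theta> where "\<theta> i q = \<phi> i (gs i q) \<ominus>\<^bsub>P i\<^esub> gs' i (\<phi> i q)" for i q
  have \<theta>: "\<theta> i \<in> mod_hom A (Q i) (P i)" for i
    unfolding \<theta>_def by (rule delta_defect_hom[OF Q.Q_module P.Q_module gop hom])
  have Z': "Z \<in> carrier (homology (TC Q) (TD Q d) n)"
    using Z by (simp add: tensor_homology_def)
  show ?thesis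
    unfolding nabla_res_def homology_map_comp[OF bQ c\<phi> Z'] homology_map_comp[OF c\<phi> bP Z']
  proof (rule homology_map_eqI[OF chain_map_comp[OF bQ c\<phi>] chain_map_comp[OF c\<phi> bP] _ Z'])
    fix z assume z: "z \<in> cycles (TC Q) (TD Q d) n"
    have "\<exists>y\<in>carrier (TC P (Suc n)). TM Q P \<theta> n z = TD P d' (Suc n) y"
    proof (rule tensor_null_homotopic[OF RP \<theta> _ _ z])
      \<comment> \<open>Both composites in the defect lie over the same map: following either one by
        the augmentation of \<open>P\<close> gives \<open>g\<close> of \<eta>(q). This is where it
        matters that both liftings belong to the same \<open>g\<close>.\<close>
      show "\<eta>' (\<theta> 0 q) = \<zero>\<^bsub>N\<^esub>" if "q \<in> carrier (Q 0)" for q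
        using that left_op_props(1)[OF g] mod_hom_closed[OF Q.\<eta>_hom that]
        by (simp add: \<theta>_def mod_hom_minus[OF P.Q_module P.N_module P.\<eta>_hom] cl
            comparison_mapD(2)[OF \<phi>] delta_liftingD(2)[OF gs] delta_liftingD(2)[OF gs']
            N.M.diff_eq_zero_iff)
      show "d' (Suc i) (\<theta> (Suc i) q) = \<theta> i (d (Suc i) q)" if "q \<in> carrier (Q (Suc i))" for i q
        using that
        by (simp add: \<theta>_def mod_hom_minus[OF P.Q_module P.Q_module P.d_hom] cl
            comparison_mapD(3)[OF \<phi>] delta_liftingD(3)[OF gs] delta_liftingD(3)[OF gs'])
    qed
    moreover have "TM Q P \<phi> n (boxtimes K A M (Q n) f (gs n) z) =
        boxtimes K A M (P n) f (gs' n) (TM Q P \<phi> n z) \<oplus>\<^bsub>TC P n\<^esub> TM Q P \<theta> n z"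
      unfolding tensor_complex_def
      using chain_complex.cycles_closed[OF tensor_chain_complex z] Q.resolution_axioms
      by (intro boxtimes_square[OF Q.Q_module P.Q_module gop hom \<theta>])
        (simp_all add: \<theta>_def P.Q.M.add_diff_cancel cl tensor_complex_def)
    ultimately show "\<exists>y\<in>carrier (TC P (Suc n)).
        TM Q P \<phi> n (boxtimes K A M (Q n) f (gs n) z) =
        boxtimes K A M (P n) f (gs' n) (TM Q P \<phi> n z) \<oplus>\<^bsub>TC P n\<^esub> TD P d' (Suc n) y"
      by metis
  qed
qed

end

section \<open>The standard resolution\<close>

context
  fixes R :: "('r, 'z) ring_scheme" and X :: "('r, 'x) module" and h :: "'x \<Rightarrow> 'y"
  assumes X: "left_module R X" and inj: "inj_on h (carrier X)"
begin

interpretation X: left_module R X by (rule X)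

lemma transport_inv: "x \<in> carrier X \<Longrightarrow> inv_into (carrier X) h (h x) = x"
  by (rule inv_into_f_f[OF inj])

lemma transport_carrier: "carrier (transport_module h X) = h ` carrier X"
  by (simp add: transport_module_def Let_def)

lemma transport_hom: "h \<in> mod_hom R X (transport_module h X)"
  by (rule mod_homI) (simp_all add: transport_module_def Let_def transport_inv)

lemma transport_inv_hom: "inv_into (carrier X) h \<in> mod_hom R (transport_module h X) X"
  by (rule mod_homI)
    (auto simp: transport_module_def Let_def transport_inv X.smult_closed)

lemma transport_left_module: "left_module R (transport_module h X)"
proof -
  let ?T = "transport_module h X"
  have add: "h x \<oplus>\<^bsub>?T\<^esub> h y = h (x \<oplus>\<^bsub>X\<^esub> y)" if "x \<in> carrier X" "y \<in> carrier X" for x y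
    using mod_hom_add[OF transport_hom that] by simp
  have smult: "r \<odot>\<^bsub>?T\<^esub> h x = h (r \<odot>\<^bsub>X\<^esub> x)" if "r \<in> carrier R" "x \<in> carrier X" for r x
    using mod_hom_smult[OF transport_hom that] by simp
  have zero: "\<zero>\<^bsub>?T\<^esub> = h \<zero>\<^bsub>X\<^esub>"
    by (simp add: transport_module_def Let_def)
  have "abelian_group ?T"
  proof (rule abelian_groupI)
    show "\<exists>v\<in>carrier ?T. v \<oplus>\<^bsub>?T\<^esub> u = \<zero>\<^bsub>?T\<^esub>" if "u \<in> carrier ?T" for u
    proof -
      obtain x where x: "x \<in> carrier X" "u = h x"
        using \<open>u \<in> carrier ?T\<close> by (auto simp: transport_carrier)
      then show ?thesis
        by (intro bexI[of _ "h (\<ominus>\<^bsub>X\<^esub> x)"]) (simp_all add: transport_carrier add zero X.M.l_neg)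
    qed
  qed (auto simp: transport_carrier add zero X.M.a_ac)
  then show ?thesis
    by (intro left_module.intro X.R.ring_axioms left_module_axioms.intro)
      (auto simp: transport_carrier add smult X.smult_closed X.smult_l_distr X.smult_r_distr
        X.smult_assoc X.smult_one)
qed

end

section \<open>Free modules coded in the datatype \<open>syz\<close>\<close>

lemma inj_Gen: "inj_on Gen S"
  by (simp add: inj_on_def)

text \<open>Finite support makes the graph outside the zeros a finite set, on which
  \<open>Abs_fset\<close> is injective; points missing from the graph have value zero, so the graph
  determines the function.\<close>

lemma encode_syz_inj: "inj_on (encode_syz A) (carrier (free_module A S))"
proof (rule inj_onI)
  fix p q assume p: "p \<in> carrier (free_module A S)" and q: "q \<in> carrier (free_module A S)"
    and eq: "encode_syz A p = encode_syz A q"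
  have fin: "finite {(x, p x) | x. p x \<noteq> \<zero>\<^bsub>A\<^esub>}" if "p \<in> carrier (free_module A S)" for p
    using that by (simp add: free_module_simps setcompr_eq_image)
  have "{(x, p x) | x. p x \<noteq> \<zero>\<^bsub>A\<^esub>} = {(x, q x) | x. q x \<noteq> \<zero>\<^bsub>A\<^esub>}"
    using eq Abs_fset_inject[of "{(x, p x) | x. p x \<noteq> \<zero>\<^bsub>A\<^esub>}" "{(x, q x) | x. q x \<noteq> \<zero>\<^bsub>A\<^esub>}"]
      fin[OF p] fin[OF q] by (simp add: encode_syz_def)
  then have eq: "p x = y \<and> p x \<noteq> \<zero>\<^bsub>A\<^esub> \<longleftrightarrow> q x = y \<and> q x \<noteq> \<zero>\<^bsub>A\<^esub>" for x y
    by (auto simp: set_eq_iff)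
  show "p = q"
  proof
    show "p x = q x" for x
      using eq[of x "p x"] eq[of x "q x"] by metis
  qed
qed

abbreviation decode_syz ::
  "('a, 'z) ring_scheme \<Rightarrow> ('a, 'n) syz set \<Rightarrow> ('a, 'n) syz \<Rightarrow> ('a, 'n) syz \<Rightarrow> 'a" where
  "decode_syz A S \<equiv> inv_into (carrier (free_module A S)) (encode_syz A)"

context ring
begin

lemma syz_free_module: "left_module R (syz_free R S)"
  unfolding syz_free_def by (rule transport_left_module[OF free_left_module encode_syz_inj])

lemma encode_hom: "encode_syz R \<in> mod_hom R (free_module R S) (syz_free R S)"
  unfolding syz_free_def by (rule transport_hom[OF free_left_module encode_syz_inj])

lemma decode_hom: "decode_syz R S \<in> mod_hom R (syz_free R S) (free_module R S)"
  unfolding syz_free_def by (rule transport_inv_hom[OF free_left_module encode_syz_inj])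

lemma decode_encode: "p \<in> carrier (free_module R S) \<Longrightarrow> decode_syz R S (encode_syz R p) = p"
  by (rule inv_into_f_f[OF encode_syz_inj])

lemma syz_free_carrier: "carrier (syz_free R S) = encode_syz R ` carrier (free_module R S)"
  by (simp add: syz_free_def transport_carrier[OF free_left_module encode_syz_inj])

lemma encode_decode: "u \<in> carrier (syz_free R S) \<Longrightarrow> encode_syz R (decode_syz R S u) = u"
  by (auto simp: syz_free_carrier decode_encode)

lemma syz_free_projective: "projective_module R (syz_free R S)"
  by (rule projective_if_retract_free[OF syz_free_module encode_hom decode_hom]) (rule encode_decode)

end

context
  fixes R :: "('a, 'z) ring_scheme" and X :: "('a, ('a, 'n) syz) module"
  assumes X: "left_module R X"
begin

interpretation X: left_module R X by (rule X)

lemma syz_eval_eq: "syz_eval R X S u = free_sum R X (\<lambda>s. s) (decode_syz R S u)"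
  by (simp add: syz_eval_def free_sum_def Let_def)

lemma syz_eval_hom:
  assumes "S \<subseteq> carrier X"
  shows "syz_eval R X S \<in> mod_hom R (syz_free R S) X"
proof -
  have "(\<lambda>s. s) \<in> S \<rightarrow> carrier X"
    using assms by auto
  then show ?thesis
    using mod_hom_comp[OF X.R.decode_hom X.free_sum_hom] by (simp add: syz_eval_eq[abs_def])
qed

text \<open>A submodule is closed under linear combinations, so evaluating them yields nothing
  outside \<open>S\<close>, while generators already yield all of \<open>S\<close>. With a kernel as
  \<open>S\<close> this becomes exactness.\<close>

lemma syz_eval_image:
  assumes "submodule S R X"
  shows "syz_eval R X S ` carrier (syz_free R S) = S"
proof -
  let ?\<pi> = "free_sum R X (\<lambda>s. s)"
  have S: "(\<lambda>s. s) \<in> S \<rightarrow> carrier X"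
    using submodule_sub[OF assms] by auto
  note \<pi> = X.free_sum_hom[OF S]
  have mem: "?\<pi> p \<in> S" if "p \<in> carrier (free_module R S)" for p
    using that
  proof (induction p rule: X.R.free_induct)
    case zero
    then show ?case
      using mod_hom_zero[OF X.R.free_left_module X \<pi>] submodule_zero[OF assms] by simp
  next
    case (gen r s)
    then show ?case
      by (simp add: mod_hom_smult[OF \<pi>] X.R.free_gen_closed X.free_sum_gen[OF S] submodule_smult[OF assms])
  next
    case (add p q)
    then show ?case
      by (simp add: mod_hom_add[OF \<pi>] submodule_add[OF assms])
  qed
  have "s \<in> ?\<pi> ` carrier (free_module R S)" if "s \<in> S" for s
    using X.free_sum_gen[OF S that] X.R.free_gen_closed[OF that] by (metis imageI)
  then have "?\<pi> ` carrier (free_module R S) = S"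
    using mem by blast
  then show ?thesis
    by (simp add: X.R.syz_free_carrier image_image syz_eval_eq X.R.decode_encode)
qed

end

section \<open>The stages of the standard resolution and its exactness\<close>

context
  fixes A :: "('a, 'z) ring_scheme" and N :: "('a, 'n) module"
  assumes N: "left_module A N"
begin

interpretation N: left_module A N by (rule N)

abbreviation "stage n \<equiv> fst (standard_stage A N n)"
abbreviation "gens n \<equiv> snd (standard_stage A N n)"
abbreviation "ev n \<equiv> syz_eval A (stage n) (gens n)"

lemma stage_Suc:
  "stage (Suc n) = syz_free A (gens n)"
  "gens (Suc n) = {u \<in> carrier (stage (Suc n)). ev n u = \<zero>\<^bsub>stage n\<^esub>}"
  by (simp_all add: case_prod_beta)

text \<open>The two claims depend on each other: \<open>ev n\<close> maps linearly into
  \<open>stage n\<close> because \<open>gens n\<close> lies in it, and \<open>gens (Suc n)\<close>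
  is a submodule because it is the kernel of this map.\<close>

lemma stage_props: "left_module A (stage n) \<and> submodule (gens n) A (stage n)"
proof (induction n)
  case 0
  have eq: "standard_stage A N 0 = (transport_module Gen N, carrier (transport_module Gen N))"
    by (simp add: transport_carrier[OF N inj_Gen])
  interpret T: left_module A "transport_module Gen N :: ('a, ('a, 'n) syz) module"
    by (rule transport_left_module[OF N inj_Gen])
  show ?case
    unfolding eq fst_conv snd_conv
    by (intro conjI T.left_module_axioms T.submoduleI) (auto simp: T.smult_closed)
next
  case (Suc n)
  then interpret X: left_module A "stage n" by simp
  have "left_module A (stage (Suc n))"
    unfolding stage_Suc by (rule N.R.syz_free_module)
  moreover have "ev n \<in> mod_hom A (stage (Suc n)) (stage n)"
    unfolding stage_Suc(1)
    by (rule syz_eval_hom[OF X.left_module_axioms submodule_sub[OF conjunct2[OF Suc]]])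
  ultimately show ?case
    unfolding stage_Suc(2) using submodule_kernel X.left_module_axioms by blast
qed

lemma stage_module: "left_module A (stage n)"
  and gens_submodule: "submodule (gens n) A (stage n)"
  using stage_props[of n] by simp_all

lemma ev_hom: "ev n \<in> mod_hom A (stage (Suc n)) (stage n)"
  unfolding stage_Suc(1) by (intro syz_eval_hom stage_module submodule_sub[OF gens_submodule])

lemma ev_image: "ev n ` carrier (stage (Suc n)) = gens n"
  unfolding stage_Suc(1) by (intro syz_eval_image stage_module gens_submodule)

text \<open>Degree and stage are off by one: stage 0 is the copy of \<open>N\<close> and does not
  belong to the resolution. Accordingly \<open>ev 0\<close> is the augmentation before decoding, and
  the differentials proper begin with \<open>ev 1\<close>.\<close>

lemma standard_eqs:
  "standard_res A N i = stage (Suc i)" "standard_diff A N i = ev i"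
  by (simp_all only: standard_res_def standard_diff_def case_prod_beta)

text \<open>The augmentation decodes with the inverse of \<open>Gen\<close> on all of
  \<open>N\<close>'s type, whereas transport of structure inverts it on the carrier only; on the
  coded carrier the two agree since \<open>Gen\<close> is injective.\<close>

lemma stage_0_hom: "inv_into UNIV Gen \<in> mod_hom A (stage 0) N"
proof -
  have "inv_into (carrier N) Gen \<in> mod_hom A (stage 0) N"
    using transport_inv_hom[OF N inj_Gen] by simp
  then show ?thesis
  proof (rule mod_hom_cong[OF stage_module])
    fix u assume "u \<in> carrier (stage 0)"
    then obtain x where "x \<in> carrier N" "u = Gen x"
      using transport_carrier[OF N inj_Gen] by auto
    then show "inv_into (carrier N) Gen u = inv_into UNIV Gen u"
      by (simp add: inv_into_f_f[OF inj_Gen])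
  qed
qed

lemma standard_aug_eq: "standard_aug A N u = inv_into UNIV Gen (ev 0 u)"
  by (simp only: standard_aug_def standard_eqs)

text \<open>Exactness is built in: the image of each evaluation map is its set of generators, and
  these were taken to be the kernel of the map before it.\<close>

lemma standard_resolution:
  "projective_resolution A N (standard_res A N) (standard_diff A N) (standard_aug A N)"
proof -
  have gens0: "gens 0 = Gen ` carrier N"
    by simp
  have aug: "standard_aug A N \<in> mod_hom A (stage (Suc 0)) N"
    unfolding standard_aug_eq[abs_def] by (rule mod_hom_comp[OF ev_hom stage_0_hom])
  have inv: "inv_into UNIV (Gen :: 'n \<Rightarrow> ('a, 'n) syz) (Gen x) = x" for x
    by (simp add: inv_into_f_f[OF inj_Gen])
  have "standard_aug A N ` carrier (stage (Suc 0)) = inv_into UNIV Gen ` (ev 0 ` carrier (stage (Suc 0)))"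
    unfolding standard_aug_eq[abs_def] by (simp only: image_image)
  also have "\<dots> = inv_into UNIV Gen ` (Gen ` carrier N :: ('a, 'n) syz set)"
    unfolding ev_image by (simp only: gens0)
  also have "\<dots> = carrier N"
    by (simp only: image_image inv image_ident)
  finally have surj: "standard_aug A N ` carrier (stage (Suc 0)) = carrier N" .
  \<comment> \<open>Values of \<open>ev 0\<close> are coded elements of \<open>N\<close>, and
    decoding is injective on them, so the augmentation has the same kernel as
    \<open>ev 0\<close>.\<close>
  have zero: "standard_aug A N u = \<zero>\<^bsub>N\<^esub> \<longleftrightarrow> ev 0 u = \<zero>\<^bsub>stage 0\<^esub>" if u: "u \<in> carrier (stage (Suc 0))" for u
  proof -
    have "ev 0 u \<in> Gen ` carrier N"
      using ev_image[of 0] u gens0 by blast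
    moreover have "\<zero>\<^bsub>stage 0\<^esub> = Gen \<zero>\<^bsub>N\<^esub>"
      by (simp add: transport_module_def Let_def)
    ultimately show ?thesis
      using inv by (auto simp only: standard_aug_eq syz.inject image_iff)
  qed
  have proj: "projective_module A (stage (Suc i))" for i
    unfolding stage_Suc(1) by (rule N.R.syz_free_projective)
  have ex0: "ev (Suc 0) ` carrier (stage (Suc (Suc 0))) =
      {q \<in> carrier (stage (Suc 0)). standard_aug A N q = \<zero>\<^bsub>N\<^esub>}"
    unfolding ev_image unfolding stage_Suc(2)[of 0] using zero by blast
  have ex: "ev (Suc (Suc i)) ` carrier (stage (Suc (Suc (Suc i)))) =
      {q \<in> carrier (stage (Suc (Suc i))). ev (Suc i) q = \<zero>\<^bsub>stage (Suc i)\<^esub>}" for i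
    unfolding ev_image unfolding stage_Suc(2)[of "Suc i"] ..
  show ?thesis
    unfolding projective_resolution_def standard_eqs One_nat_def
    using proj ev_hom aug surj ex0 ex by blast
qed

end

section \<open>Delta-operators on free modules and their lifts along the standard resolution\<close>

context derivation_setting
begin

lemma left_op_zero:
  assumes "left_module A X" "left_delta_operator K A \<delta> X g"
  shows "g \<zero>\<^bsub>X\<^esub> = \<zero>\<^bsub>X\<^esub>"
proof -
  interpret X: left_module A X by fact
  note g = left_op_props[OF assms(2) X.M.zero_closed]
  show ?thesis
    using g(1) g(2)[OF X.M.zero_closed] X.M.add.r_cancel_one by force
qed

lemma left_opI:
  assumes "\<And>x. x \<in> carrier X \<Longrightarrow> g x \<in> carrier X"
    and "\<And>x y. \<lbrakk>x \<in> carrier X; y \<in> carrier X\<rbrakk> \<Longrightarrow> g (x \<oplus>\<^bsub>X\<^esub> y) = g x \<oplus>\<^bsub>X\<^esub> g y"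
    and "\<And>r x. \<lbrakk>r \<in> carrier K; x \<in> carrier X\<rbrakk> \<Longrightarrow>
      g ((r \<odot>\<^bsub>A\<^esub> \<one>\<^bsub>A\<^esub>) \<odot>\<^bsub>X\<^esub> x) = (r \<odot>\<^bsub>A\<^esub> \<one>\<^bsub>A\<^esub>) \<odot>\<^bsub>X\<^esub> g x"
    and "\<And>a x. \<lbrakk>a \<in> carrier A; x \<in> carrier X\<rbrakk> \<Longrightarrow>
      g (a \<odot>\<^bsub>X\<^esub> x) = \<delta> a \<odot>\<^bsub>X\<^esub> x \<oplus>\<^bsub>X\<^esub> a \<odot>\<^bsub>X\<^esub> g x"
  shows "left_delta_operator K A \<delta> X g"
  using assms by (simp add: left_delta_operator_def mod_hom_def)

text \<open>Linearity of \<open>i\<close> and \<open>j\<close> carries the delta-rule over, with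
  \<open>ij\<close> needed for the term in which \<delta>(a) multiplies i(j y). It moves operators
  to coded copies, of \<open>N\<close> and of free modules.\<close>

lemma left_op_conjugate:
  assumes g: "left_delta_operator K A \<delta> X g" and i: "i \<in> mod_hom A X Y" and j: "j \<in> mod_hom A Y X"
    and X: "left_module A X" and ij: "\<And>y. y \<in> carrier Y \<Longrightarrow> i (j y) = y"
  shows "left_delta_operator K A \<delta> Y (\<lambda>y. i (g (j y)))"
proof -
  interpret X: left_module A X by fact
  note jcl = mod_hom_closed[OF j]
  show ?thesis
  proof (rule left_opI)
    show "i (g (j ((r \<odot>\<^bsub>A\<^esub> \<one>\<^bsub>A\<^esub>) \<odot>\<^bsub>Y\<^esub> y))) = (r \<odot>\<^bsub>A\<^esub> \<one>\<^bsub>A\<^esub>) \<odot>\<^bsub>Y\<^esub> i (g (j y))"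
      if "r \<in> carrier K" "y \<in> carrier Y" for r y
      using that by (simp add: mod_hom_smult[OF i] mod_hom_smult[OF j] left_op_props(1,3)[OF g] jcl)
  qed (simp_all add: mod_hom_closed[OF i] mod_hom_add[OF i] mod_hom_add[OF j] mod_hom_smult[OF i]
      mod_hom_smult[OF j] left_op_props[OF g] jcl X.smult_closed delta_closed ij)
qed

lemma delta_zero: "\<delta> \<zero>\<^bsub>A\<^esub> = \<zero>\<^bsub>A\<^esub>"
  using mod_hom_add[OF delta_hom Alg.M.zero_closed Alg.M.zero_closed]
    delta_closed[OF Alg.M.zero_closed] by simp

text \<open>The product rule for 1 = 1 * 1 gives \<delta>(1) = \<delta>(1) + \<delta>(1).\<close>

lemma delta_one: "\<delta> \<one>\<^bsub>A\<^esub> = \<zero>\<^bsub>A\<^esub>"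
  using delta_mult[OF Alg.A.one_closed Alg.A.one_closed] delta_closed[OF Alg.A.one_closed] by simp

lemma delta_scalar_mult:
  assumes "r \<in> carrier K" "a \<in> carrier A"
  shows "\<delta> ((r \<odot>\<^bsub>A\<^esub> \<one>\<^bsub>A\<^esub>) \<otimes>\<^bsub>A\<^esub> a) = (r \<odot>\<^bsub>A\<^esub> \<one>\<^bsub>A\<^esub>) \<otimes>\<^bsub>A\<^esub> \<delta> a"
  using assms by (simp add: Alg.smult_mult_left mod_hom_smult[OF delta_hom] delta_closed)

text \<open>Applying \<open>\<delta>\<close> to every coefficient is one delta-operator, and adding
  a linear map to a delta-operator gives another. As the coefficientwise part kills the generators,
  the values there are those of \<open>l\<close>.\<close>

lemma free_delta_operator:
  fixes S :: "'s set"
  assumes l: "l \<in> mod_hom A (free_module A S) (free_module A S)"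
  shows "left_delta_operator K A \<delta> (free_module A S) (\<lambda>p. (\<lambda>x. \<delta> (p x)) \<oplus>\<^bsub>free_module A S\<^esub> l p)"
proof -
  let ?F = "free_module A S"
  interpret F: left_module A ?F by (rule Alg.A.free_left_module)
  define D where "D p = (\<lambda>x. \<delta> (p x))" for p :: "'s \<Rightarrow> 'a"
  have D: "D p \<in> carrier ?F" if "p \<in> carrier ?F" for p
    unfolding D_def by (rule Alg.A.free_map_closed[of p S \<delta>, OF that delta_closed delta_zero])
  have px: "p x \<in> carrier A" if "p \<in> carrier ?F" for p x
    using that by (simp add: free_module_simps)
  have D_add: "D (p \<oplus>\<^bsub>?F\<^esub> q) = D p \<oplus>\<^bsub>?F\<^esub> D q" if "p \<in> carrier ?F" "q \<in> carrier ?F" for p q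
    using that by (auto simp: D_def free_module_simps(3) px mod_hom_add[OF delta_hom])
  have D_smult: "D (a \<odot>\<^bsub>?F\<^esub> p) = \<delta> a \<odot>\<^bsub>?F\<^esub> p \<oplus>\<^bsub>?F\<^esub> a \<odot>\<^bsub>?F\<^esub> D p"
    if "a \<in> carrier A" "p \<in> carrier ?F" for a p
    using that by (auto simp: D_def free_module_simps(3,4) px delta_mult)
  have D_scalar: "D ((r \<odot>\<^bsub>A\<^esub> \<one>\<^bsub>A\<^esub>) \<odot>\<^bsub>?F\<^esub> p) = (r \<odot>\<^bsub>A\<^esub> \<one>\<^bsub>A\<^esub>) \<odot>\<^bsub>?F\<^esub> D p"
    if "r \<in> carrier K" "p \<in> carrier ?F" for r p
    using that by (auto simp: D_def free_module_simps(4) px delta_scalar_mult)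
  note cl = D mod_hom_closed[OF l] F.smult_closed delta_closed
  have "left_delta_operator K A \<delta> ?F (\<lambda>p. D p \<oplus>\<^bsub>?F\<^esub> l p)"
  proof (rule left_opI)
    show "D (p \<oplus>\<^bsub>?F\<^esub> q) \<oplus>\<^bsub>?F\<^esub> l (p \<oplus>\<^bsub>?F\<^esub> q) = (D p \<oplus>\<^bsub>?F\<^esub> l p) \<oplus>\<^bsub>?F\<^esub> (D q \<oplus>\<^bsub>?F\<^esub> l q)"
      if "p \<in> carrier ?F" "q \<in> carrier ?F" for p q
      using that by (simp add: D_add mod_hom_add[OF l] cl F.M.a_ac)
    show "D ((r \<odot>\<^bsub>A\<^esub> \<one>\<^bsub>A\<^esub>) \<odot>\<^bsub>?F\<^esub> p) \<oplus>\<^bsub>?F\<^esub> l ((r \<odot>\<^bsub>A\<^esub> \<one>\<^bsub>A\<^esub>) \<odot>\<^bsub>?F\<^esub> p) =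
        (r \<odot>\<^bsub>A\<^esub> \<one>\<^bsub>A\<^esub>) \<odot>\<^bsub>?F\<^esub> (D p \<oplus>\<^bsub>?F\<^esub> l p)" if "r \<in> carrier K" "p \<in> carrier ?F" for r p
      using that by (simp add: D_scalar mod_hom_smult[OF l] cl F.smult_r_distr)
    show "D (a \<odot>\<^bsub>?F\<^esub> p) \<oplus>\<^bsub>?F\<^esub> l (a \<odot>\<^bsub>?F\<^esub> p) =
        \<delta> a \<odot>\<^bsub>?F\<^esub> p \<oplus>\<^bsub>?F\<^esub> a \<odot>\<^bsub>?F\<^esub> (D p \<oplus>\<^bsub>?F\<^esub> l p)" if "a \<in> carrier A" "p \<in> carrier ?F" for a p
      using that by (simp add: D_smult mod_hom_smult[OF l] cl F.smult_r_distr F.M.a_assoc)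
  qed (simp add: cl)
  then show ?thesis
    by (simp only: D_def)
qed

text \<open>Both sides of the required identity are additive and obey the delta-rule, so multiples
  of generators decide it; on the generator of \<open>s\<close> both sides equal
  \<open>G s\<close>.\<close>

lemma syz_free_delta_lift:
  fixes X :: "('a, ('a, 'n) syz) module"
  assumes X: "left_module A X" and S: "submodule S A X"
    and G: "left_delta_operator K A \<delta> X G" and GS: "G ` S \<subseteq> S"
  shows "\<exists>G'. left_delta_operator K A \<delta> (syz_free A S) G' \<and>
    (\<forall>u\<in>carrier (syz_free A S). syz_eval A X S (G' u) = G (syz_eval A X S u))"
proof -
  interpret X: left_module A X by fact
  let ?F = "free_module A S"
  interpret F: left_module A ?F by (rule Alg.A.free_left_module)
  \<comment> \<open>Since \<open>G\<close> maps \<open>S\<close> to itself, a lift of \<open>G s\<close> along the evaluation map is the generator \<open>G s\<close>.\<close>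
  define l where "l = free_sum A ?F (\<lambda>s. free_gen A (G s))"
  have \<gamma>: "(\<lambda>s. free_gen A (G s)) \<in> S \<rightarrow> carrier ?F"
    using GS by (auto intro!: Alg.A.free_gen_closed)
  have l: "l \<in> mod_hom A ?F ?F"
    unfolding l_def by (rule F.free_sum_hom[OF \<gamma>])
  define H where "H p = (\<lambda>x. \<delta> (p x)) \<oplus>\<^bsub>?F\<^esub> l p" for p
  have H: "left_delta_operator K A \<delta> ?F H"
    unfolding H_def[abs_def] by (rule free_delta_operator[OF l])
  note Hp = left_op_props[OF H]
  let ?\<pi> = "free_sum A X (\<lambda>s. s)"
  have id: "(\<lambda>s. s) \<in> S \<rightarrow> carrier X"
    using submodule_sub[OF S] by auto
  note \<pi> = X.free_sum_hom[OF id]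
  have \<pi>H: "?\<pi> (H p) = G (?\<pi> p)" if "p \<in> carrier ?F" for p
    using that
  proof (induction p rule: Alg.A.free_induct)
    case zero
    then show ?case
      by (simp add: left_op_zero[OF Alg.A.free_left_module H] left_op_zero[OF X G]
          mod_hom_zero[OF Alg.A.free_left_module X \<pi>])
  next
    case (gen a s)
    have e: "free_gen A s \<in> carrier ?F" and Gs: "G s \<in> S" and s: "s \<in> carrier X"
      using gen Alg.A.free_gen_closed GS submodule_sub[OF S] by auto
    \<comment> \<open>The coefficients of a generator are 0 and 1, and \<open>\<delta>\<close> kills
      both.\<close>
    have "(\<lambda>x. \<delta> (free_gen A s x)) = \<zero>\<^bsub>?F\<^esub>"
      by (auto simp: free_module_simps(2) free_gen_def delta_zero delta_one)
    then have He: "H (free_gen A s) = free_gen A (G s)"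
      using Alg.A.free_gen_closed[OF Gs] gen(2) by (simp add: H_def l_def F.free_sum_gen[OF \<gamma>])
    then have "?\<pi> (H (free_gen A s)) = G s"
      by (simp add: X.free_sum_gen[OF id Gs])
    then show ?case
      using gen e s
      by (simp add: Hp mod_hom_add[OF \<pi>] mod_hom_smult[OF \<pi>] F.smult_closed delta_closed
          X.free_sum_gen[OF id] left_op_props[OF G])
  next
    case (add p q)
    then show ?case
      by (simp add: Hp mod_hom_add[OF \<pi>] mod_hom_closed[OF \<pi>] left_op_props[OF G])
  qed
  let ?G' = "\<lambda>u. encode_syz A (H (decode_syz A S u))"
  have "left_delta_operator K A \<delta> (syz_free A S) ?G'"
    by (rule left_op_conjugate[OF H Alg.A.encode_hom Alg.A.decode_hom Alg.A.free_left_module])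
      (rule Alg.A.encode_decode)
  moreover have "syz_eval A X S (?G' u) = G (syz_eval A X S u)" if "u \<in> carrier (syz_free A S)" for u
    using mod_hom_closed[OF Alg.A.decode_hom that]
    by (simp add: syz_eval_eq[OF X] Alg.A.decode_encode Hp(1) \<pi>H)
  ultimately show ?thesis
    by blast
qed

lemma standard_delta_lifting:
  fixes N :: "('a, 'n) module"
  assumes N: "left_module A N" and g: "left_delta_operator K A \<delta> N g"
  shows "\<exists>gs. delta_lifting K A \<delta> g (standard_res A N) (standard_diff A N) (standard_aug A N) gs"
proof -
  let ?X = "\<lambda>n. fst (standard_stage A N n)" and ?S = "\<lambda>n. snd (standard_stage A N n)"
  let ?e = "\<lambda>n. syz_eval A (?X n) (?S n)"
  note XM = stage_module[OF N] and SM = gens_submodule[OF N]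
  define G0 where "G0 = (\<lambda>u :: ('a, 'n) syz. Gen (g (inv_into (carrier N) Gen u)) :: ('a, 'n) syz)"
  have inv: "inv_into (carrier N) Gen (Gen x) = x" if "x \<in> carrier N" for x
    by (rule inv_into_f_f[OF inj_Gen that])
  \<comment> \<open>Preserving the generators \<open>?S n\<close> is what permits the next lift. The
    clause for \<open>n = 0\<close> records that the bottom operator is the coded \<open>g\<close>,
    which the condition on the augmentation needs at the end.\<close>
  define R where "R n G \<longleftrightarrow> left_delta_operator K A \<delta> (?X n) G \<and> G ` ?S n \<subseteq> ?S n \<and> (n = 0 \<longrightarrow> G = G0)" for n G
  have "left_delta_operator K A \<delta> (?X 0) G0"
  proof -
    have "left_delta_operator K A \<delta> (transport_module Gen N) G0"
      unfolding G0_def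
      by (rule left_op_conjugate[OF g transport_hom[OF N inj_Gen] transport_inv_hom[OF N inj_Gen] N])
        (auto simp: transport_carrier[OF N inj_Gen] inv)
    then show ?thesis by simp
  qed
  moreover have "G0 ` ?S 0 \<subseteq> ?S 0"
    using left_op_props(1)[OF g] by (auto simp: G0_def inv)
  ultimately have "\<exists>G. R 0 G"
    by (auto simp: R_def)
  moreover have "\<exists>G'. R (Suc n) G' \<and> (\<forall>u\<in>carrier (?X (Suc n)). ?e n (G' u) = G (?e n u))"
    if R: "R n G" for n G
  proof -
    have G: "left_delta_operator K A \<delta> (?X n) G" and GS: "G ` ?S n \<subseteq> ?S n"
      using R by (auto simp: R_def)
    obtain G' where G': "left_delta_operator K A \<delta> (?X (Suc n)) G'"
        "\<forall>u\<in>carrier (?X (Suc n)). ?e n (G' u) = G (?e n u)"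
      using syz_free_delta_lift[OF XM SM G GS] unfolding stage_Suc(1)[OF N, symmetric] by blast
    \<comment> \<open>For \<open>u\<close> in the kernel of the evaluation map, G'(u) evaluates to
      \<open>G\<close> of zero, which is zero; so the next set of generators is preserved.\<close>
    have "G' ` ?S (Suc n) \<subseteq> ?S (Suc n)"
      unfolding stage_Suc(2)[OF N] using left_op_props(1)[OF G'(1)] G'(2) left_op_zero[OF XM G] by auto
    then show ?thesis
      using G' unfolding R_def by blast
  qed
  ultimately obtain G where G: "\<And>n. R n (G n) \<and> (\<forall>u\<in>carrier (?X (Suc n)). ?e n (G (Suc n) u) = G n (?e n u))"
    using dependent_nat_choice[of R "\<lambda>n G G'. \<forall>u\<in>carrier (?X (Suc n)). ?e n (G' u) = G (?e n u)"]
    by blast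
  have op: "left_delta_operator K A \<delta> (?X n) (G n)" for n
    using G R_def by blast
  have comm: "?e n (G (Suc n) u) = G n (?e n u)" if "u \<in> carrier (?X (Suc n))" for n u
    using G that by blast
  have "standard_aug A N (G (Suc 0) u) = g (standard_aug A N u)" if u: "u \<in> carrier (?X (Suc 0))" for u
  proof -
    have "?e 0 u \<in> Gen ` carrier N"
      using ev_image[OF N, of 0] u by (metis image_eqI snd_conv standard_stage.simps(1))
    then obtain x where x: "x \<in> carrier N" "?e 0 u = Gen x" by blast
    have "G 0 = G0"
      using G R_def by blast
    then have "?e 0 (G (Suc 0) u) = Gen (g x)"
      using comm[OF u] x by (simp only: G0_def inv)
    then show ?thesis
      using x by (simp only: standard_aug_eq[OF N] inv_into_f_f[OF inj_Gen] UNIV_I)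
  qed
  \<comment> \<open>Degree \<open>i\<close> of the resolution is stage \<open>Suc i\<close>, whence
    the shift in the witness; \<open>G 0\<close> acts on the copy of \<open>N\<close> and is left
    out.\<close>
  then show ?thesis
    unfolding delta_lifting_alt standard_eqs[OF N]
    using op comm by (intro exI[of _ "\<lambda>i. G (Suc i)"]) blast
qed

section \<open>The induced maps on Tor\<close>

lemma standard_resolution_resolution:
  "left_module A N \<Longrightarrow> resolution A N (standard_res A N) (standard_diff A N) (standard_aug A N)"
  by (intro resolution.intro standard_resolution)

text \<open>By the comparison theorem the choice operator in \<open>tor_iso\<close> picks an actual
  comparison map, which the proofs below can then name.\<close>

lemma tor_iso_comparison:
  assumes "resolution A N Q d \<eta>"
  obtains \<phi> where
    "comparison_map A Q d \<eta> (standard_res A N) (standard_diff A N) (standard_aug A N) \<phi>"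
    "tor_iso K A M N Q d \<eta> = homology_map (TC (standard_res A N))
      (TD (standard_res A N) (standard_diff A N)) (TM Q (standard_res A N) \<phi>)"
proof -
  interpret resolution_pair A N Q d \<eta> "standard_res A N" "standard_diff A N" "standard_aug A N"
    by (intro resolution_pair.intro assms standard_resolution_resolution resolution.N_module[OF assms])
  show ?thesis
    using that[OF someI_ex[OF comparison_exists]] by (simp add: tor_iso_def Let_def)
qed

lemma tor_iso_mod_iso:
  assumes Q: "resolution A N Q d \<eta>"
  shows "tor_iso K A M N Q d \<eta> n \<in> mod_iso K (tensor_homology K A M Q d n) (Tor K A M N n)"
proof -
  obtain \<phi> where \<phi>: "comparison_map A Q d \<eta> (standard_res A N) (standard_diff A N) (standard_aug A N) \<phi>"
    "tor_iso K A M N Q d \<eta> = homology_map (TC (standard_res A N))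
      (TD (standard_res A N) (standard_diff A N)) (TM Q (standard_res A N) \<phi>)"
    by (rule tor_iso_comparison[OF Q])
  have "resolution_pair A N Q d \<eta> (standard_res A N) (standard_diff A N) (standard_aug A N)"
    by (intro resolution_pair.intro Q standard_resolution_resolution resolution.N_module[OF Q])
  then show ?thesis
    unfolding \<phi>(2) Tor_def by (rule comparison_homology_iso[OF _ \<phi>(1)])
qed

lemma nabla_hom:
  assumes R: "resolution A N Q d \<eta>" and gs: "delta_lifting K A \<delta> g Q d \<eta> gs"
  shows "nabla_res K A M f Q d gs n \<in>
    mod_hom K (tensor_homology K A M Q d n) (tensor_homology K A M Q d n)"
  using chain_map.homology_map_hom[OF boxtimes_chain_map[OF R gs]]
  by (simp add: tensor_homology_def nabla_res_def)

lemma nabla_square: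
  assumes Q: "resolution A N Q d \<eta>" and g: "left_delta_operator K A \<delta> N g"
    and gs: "delta_lifting K A \<delta> g Q d \<eta> gs"
    and hs: "delta_lifting K A \<delta> g (standard_res A N) (standard_diff A N) (standard_aug A N) hs"
    and z: "z \<in> carrier (tensor_homology K A M Q d n)"
  shows "tor_iso K A M N Q d \<eta> n (nabla_res K A M f Q d gs n z) =
    nabla_res K A M f (standard_res A N) (standard_diff A N) hs n (tor_iso K A M N Q d \<eta> n z)"
proof -
  obtain \<phi> where \<phi>: "comparison_map A Q d \<eta> (standard_res A N) (standard_diff A N) (standard_aug A N) \<phi>"
    "tor_iso K A M N Q d \<eta> = homology_map (TC (standard_res A N))
      (TD (standard_res A N) (standard_diff A N)) (TM Q (standard_res A N) \<phi>)"
    by (rule tor_iso_comparison[OF Q])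
  have "resolution_pair A N Q d \<eta> (standard_res A N) (standard_diff A N) (standard_aug A N)"
    by (intro resolution_pair.intro Q standard_resolution_resolution resolution.N_module[OF Q])
  then show ?thesis
    unfolding \<phi>(2) by (rule comparison_boxtimes_square[OF _ \<phi>(1) gs hs g z])
qed

end

text \<open>The type \<open>'q\<close> is arbitrary, but a map obtained for one type could a priori
  vary with it. The squares over \<open>('a, 'n) syz\<close> rule this out: the standard resolution
  has its elements in that type, so these squares alone determine \<open>nab\<close> on Tor, and all
  instances of \<open>'q\<close> share the same map.\<close>

theorem theorem2:
  fixes K :: "('k, 'z) ring_scheme"
    and A :: "('k, 'a) module"
    and \<delta> :: "'a \<Rightarrow> 'a"
    and M :: "('a, 'm) module"
    and N :: "('a, 'n) module"
    and f :: "'m \<Rightarrow> 'm"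
    and g :: "'n \<Rightarrow> 'n"
  assumes "k_algebra K A"
    and "projective_module K A"
    and "derivation K A \<delta>"
    and "right_module A M"
    and "left_module A N"
    and "right_delta_operator K A \<delta> M f"
    and "left_delta_operator K A \<delta> N g"
  shows "(\<forall>(Q :: nat \<Rightarrow> ('a, 'q) module) d \<eta>. projective_resolution A N Q d \<eta> \<longrightarrow>
      (\<forall>n. tor_iso K A M N Q d \<eta> n \<in> mod_iso K (tensor_homology K A M Q d n) (Tor K A M N n))) \<and>
    (\<exists>nab. graded_tor_endo K A M N nab \<and>
      squares_commute TYPE('q) K A \<delta> M N f g nab \<and>
      squares_commute TYPE(('a, 'n) syz) K A \<delta> M N f g nab \<and>
      (\<forall>D. graded_tor_endo K A M N D \<and> squares_commute TYPE(('a, 'n) syz) K A \<delta> M N f g D \<longrightarrow>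
        (\<forall>n. \<forall>x\<in>carrier (Tor K A M N n). D n x = nab n x)))"
proof -
  interpret derivation_setting K A M \<delta> f
    by (intro derivation_setting.intro derivation_setting_axioms.intro tensor_setting.intro assms)
  note N = \<open>left_module A N\<close> and g = \<open>left_delta_operator K A \<delta> N g\<close>
  let ?F = "standard_res A N" and ?d = "standard_diff A N" and ?\<epsilon> = "standard_aug A N"
  note F = standard_resolution_resolution[OF N]
  obtain hs where hs: "delta_lifting K A \<delta> g ?F ?d ?\<epsilon> hs"
    using standard_delta_lifting[OF N g] by blast
  \<comment> \<open>The lifting \<open>hs\<close> lives on the standard resolution, so this map
    involves neither \<open>'q\<close> nor the resolution \<open>Q\<close> of a given
    square.\<close>
  define nab where "nab = nabla_res K A M f ?F ?d hs"
  have "graded_tor_endo K A M N nab"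
    unfolding graded_tor_endo_def nab_def Tor_def using nabla_hom[OF F hs] by blast
  moreover have "squares_commute TYPE('q) K A \<delta> M N f g nab"
    and "squares_commute TYPE(('a, 'n) syz) K A \<delta> M N f g nab"
    unfolding squares_commute_def nab_def
    using nabla_square[OF resolution.intro[OF _ N] g _ hs] by blast+
  moreover have "D n x = nab n x"
    if sq: "squares_commute TYPE(('a, 'n) syz) K A \<delta> M N f g D" and x: "x \<in> carrier (Tor K A M N n)"
    for D n x
  proof -
    have "bij_betw (tor_iso K A M N ?F ?d ?\<epsilon> n)
        (carrier (tensor_homology K A M ?F ?d n)) (carrier (Tor K A M N n))"
      using tor_iso_mod_iso[OF F] by (simp add: mod_iso_def)
    then obtain z where z: "z \<in> carrier (tensor_homology K A M ?F ?d n)"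
      "x = tor_iso K A M N ?F ?d ?\<epsilon> n z"
      using x by (auto simp: bij_betw_def)
    \<comment> \<open>The squares of \<open>D\<close> and of \<open>nab\<close> are compared at the
      standard resolution with the same lifting \<open>hs\<close>, where they share their upper
      path.\<close>
    have "D n x = tor_iso K A M N ?F ?d ?\<epsilon> n (nabla_res K A M f ?F ?d hs n z)"
      using sq standard_resolution[OF N] hs z unfolding squares_commute_def by metis
    also have "\<dots> = nab n x"
      unfolding nab_def z(2) by (rule nabla_square[OF F g hs hs z(1)])
    finally show ?thesis .
  qed
  ultimately show ?thesis
    using tor_iso_mod_iso[OF resolution.intro[OF _ N]] by blast
qed

end
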